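(* Let $X$ and $Y$ be Banach spaces such that $X$ has the metric lifting property and $Y$ has the metric extension property. Let $T \in \mathcal{L}(X,Y)$, with adjoint $T^{*} \in \mathcal{L}(Y^{*},X^{*})$. Then $\delta_n(T^{*}) = \delta_n(T)$ for all $n$.
   Context: $\mathcal{L}(X,Y)$ denotes the normed space of all continuous linear operators from $X$ to $Y$; $X^{*}$ is the dual space of $X$ and $T^{*}$ is the adjoint of $T$. Kolmogorov diameters: for Banach spaces $X,Y$ and $T \in \mathcal{L}(X,Y)$, the $n$th Kolmogorov diameter is $$\delta_n(T) = \inf\{\|Q_G T\| : G \subset Y \text{ a subspace with } \dim G \le n\},$$ where $Q_G : Y \to Y/G$ is the canonical quotient map. Metric lifting property: a Banach space $X$ has the (metric) lifting property if for every Banach space $Z$, every closed subspace $F$ of $Z$, every $T \in \mathcal{L}(X, Z/F)$ and every $\epsilon > 0$ there exists $S \in \mathcal{L}(X,Z)$ such that $\|S\| \le (1+\epsilon)\|T\|$ and $T = Q_F S$, where $Q_F : Z \to Z/F$ is the canonical projection. Metric extension property: a Banach space $Y$ has the (metric) extension property if for every Banach space $Z$, every closed subspace $M$ of $Z$ and every $T \in \mathcal{L}(M,Y)$ there exists $S \in \mathcal{L}(Z,Y)$ such that $T = S J_M$ and $\|T\| = \|S\|$, where $J_M : M \to Z$ is the canonical injection. *)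

theory Defs
  imports "HOL-Analysis.Analysis" "HOL-Algebra.Module" "HOL-Algebra.AbelCoset"
begin

text \<open>
  The lifting and extension properties quantify over all Banach spaces, which type classes cannot
  express inside a formula. Banach spaces are therefore carrier-based: modules of HOL-Algebra with
  a norm. The scalar field is a subset \<open>K\<close> of the complex numbers, meant to be \<open>\<real>\<close> or \<open>UNIV\<close>, so
  that real and complex Banach spaces are treated together. The fields \<open>mult\<close> and \<open>one\<close>, which the
  record of modules inherits from rings, are not used.
\<close>

definition scalar_ring :: "complex set \<Rightarrow> complex ring" where
  "scalar_ring K = \<lparr>carrier = K, monoid.mult = (*), one = 1, zero = 0, add = (+)\<rparr>"

record 'a nspace = "(complex, 'a) module" +
  nrm :: "'a \<Rightarrow> real"

locale normed_space = Module.module "scalar_ring K" V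
  for K :: "complex set" and V :: "'a nspace" (structure) +
  assumes nrm_nonneg: "x \<in> carrier V \<Longrightarrow> 0 \<le> nrm V x"
    and nrm_eq_0: "x \<in> carrier V \<Longrightarrow> nrm V x = 0 \<longleftrightarrow> x = \<zero>"
    and nrm_smult: "\<lbrakk>c \<in> K; x \<in> carrier V\<rbrakk> \<Longrightarrow> nrm V (c \<odot> x) = cmod c * nrm V x"
    and nrm_triangle: "\<lbrakk>x \<in> carrier V; y \<in> carrier V\<rbrakk> \<Longrightarrow> nrm V (x \<oplus> y) \<le> nrm V x + nrm V y"

text \<open>
  The value \<open>0\<close> outside the carrier is needed because the locale \<open>Metric_space\<close> requires symmetry
  and nonnegativity of the distance on the whole type.
\<close>

definition ndist :: "'a nspace \<Rightarrow> 'a \<Rightarrow> 'a \<Rightarrow> real" where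
  "ndist V x y = (if x \<in> carrier V \<and> y \<in> carrier V then nrm V (x \<ominus>\<^bsub>V\<^esub> y) else 0)"

definition ntop :: "'a nspace \<Rightarrow> 'a topology" where
  "ntop V = Metric_space.mtopology (carrier V) (ndist V)"

definition banach_space :: "complex set \<Rightarrow> 'a nspace \<Rightarrow> bool" where
  "banach_space K V \<longleftrightarrow> normed_space K V \<and> Metric_space.mcomplete (carrier V) (ndist V)"

definition closed_subspace :: "complex set \<Rightarrow> 'a nspace \<Rightarrow> 'a set \<Rightarrow> bool" where
  "closed_subspace K V F \<longleftrightarrow> submodule F (scalar_ring K) V \<and> closedin (ntop V) F"

definition lin_span :: "complex set \<Rightarrow> 'a nspace \<Rightarrow> 'a set \<Rightarrow> 'a set" where
  "lin_span K V B = \<Inter>{H. submodule H (scalar_ring K) V \<and> B \<subseteq> H}"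

text \<open>\<open>G\<close> has a basis of at most \<open>n\<close> elements.\<close>

definition dim_at_most :: "complex set \<Rightarrow> 'a nspace \<Rightarrow> 'a set \<Rightarrow> nat \<Rightarrow> bool" where
  "dim_at_most K V G n \<longleftrightarrow> (\<exists>B. B \<subseteq> carrier V \<and> finite B \<and> card B \<le> n \<and>
     (\<forall>b\<in>B. b \<notin> lin_span K V (B - {b})) \<and> lin_span K V B = G)"

text \<open>
  Operators are extensional functions, that is, they take the value \<open>undefined\<close> off the carrier
  of their domain, so that equality of operators is equality of functions.
\<close>

definition operators :: "complex set \<Rightarrow> 'a nspace \<Rightarrow> 'b nspace \<Rightarrow> ('a \<Rightarrow> 'b) set" where
  "operators K X Y = {T \<in> carrier X \<rightarrow>\<^sub>E carrier Y.
     (\<forall>x\<in>carrier X. \<forall>y\<in>carrier X. T (x \<oplus>\<^bsub>X\<^esub> y) = T x \<oplus>\<^bsub>Y\<^esub> T y) \<and>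
     (\<forall>c\<in>K. \<forall>x\<in>carrier X. T (c \<odot>\<^bsub>X\<^esub> x) = c \<odot>\<^bsub>Y\<^esub> T x) \<and>
     continuous_map (ntop X) (ntop Y) T}"

definition opnorm :: "'a nspace \<Rightarrow> 'b nspace \<Rightarrow> ('a \<Rightarrow> 'b) \<Rightarrow> real" where
  "opnorm X Y T = (SUP x \<in> {x \<in> carrier X. nrm X x \<le> 1}. nrm Y (T x))"

definition op_space :: "complex set \<Rightarrow> 'a nspace \<Rightarrow> 'b nspace \<Rightarrow> ('a \<Rightarrow> 'b) nspace" where
  "op_space K X Y = \<lparr>carrier = operators K X Y, monoid.mult = undefined, one = undefined,
     zero = (\<lambda>x\<in>carrier X. \<zero>\<^bsub>Y\<^esub>), add = (\<lambda>S T. \<lambda>x\<in>carrier X. S x \<oplus>\<^bsub>Y\<^esub> T x),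
     module.smult = (\<lambda>c T. \<lambda>x\<in>carrier X. c \<odot>\<^bsub>Y\<^esub> T x), nrm = opnorm X Y\<rparr>"

definition scalar_space :: "complex set \<Rightarrow> complex nspace" where
  "scalar_space K = \<lparr>carrier = K, monoid.mult = (*), one = 1, zero = 0, add = (+),
     module.smult = (*), nrm = cmod\<rparr>"

definition dual :: "complex set \<Rightarrow> 'a nspace \<Rightarrow> ('a \<Rightarrow> complex) nspace" where
  "dual K X = op_space K X (scalar_space K)"

definition adjoint_op ::
    "complex set \<Rightarrow> 'a nspace \<Rightarrow> 'b nspace \<Rightarrow> ('a \<Rightarrow> 'b) \<Rightarrow> ('b \<Rightarrow> complex) \<Rightarrow> ('a \<Rightarrow> complex)" where
  "adjoint_op K X Y T = (\<lambda>\<phi>\<in>carrier (dual K Y). compose (carrier X) \<phi> T)"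

text \<open>
  In the scalar multiplication of the quotient, the union is over equal cosets; the coset of \<open>F\<close>
  is taken so that \<open>0\<close> times a coset is \<open>F\<close> and not just its zero element.
\<close>

definition quotient_space :: "'a nspace \<Rightarrow> 'a set \<Rightarrow> 'a set nspace" where
  "quotient_space V F = \<lparr>carrier = a_rcosets\<^bsub>V\<^esub> F, monoid.mult = undefined, one = undefined,
     zero = F, add = set_add V, module.smult = (\<lambda>c A. \<Union>a\<in>A. F +>\<^bsub>V\<^esub> (c \<odot>\<^bsub>V\<^esub> a)),
     nrm = (\<lambda>A. INF a\<in>A. nrm V a)\<rparr>"

definition quotient_map :: "'a nspace \<Rightarrow> 'a set \<Rightarrow> 'a \<Rightarrow> 'a set" where
  "quotient_map V F = (\<lambda>x\<in>carrier V. F +>\<^bsub>V\<^esub> x)"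

definition kolmogorov_diameter ::
    "complex set \<Rightarrow> 'a nspace \<Rightarrow> 'b nspace \<Rightarrow> nat \<Rightarrow> ('a \<Rightarrow> 'b) \<Rightarrow> real" where
  "kolmogorov_diameter K X Y n T =
     Inf {opnorm X (quotient_space Y G) (compose (carrier X) (quotient_map Y G) T) | G.
       submodule G (scalar_ring K) Y \<and> dim_at_most K Y G n}"

text \<open>
  In the next two properties the test space \<open>Z\<close> ranges over all Banach spaces whose elements form
  a subset of the type \<open>'a universe\<close>, where \<open>'a\<close> is the type of the elements of the given space.
  This is equivalent to ranging over all Banach spaces of every type.

  Lifting: the universe contains an isometric copy of \<open>\<ell>\<^sub>1(B)\<close>, where \<open>B\<close> is the unit ball of \<open>X\<close>,
  and \<open>X\<close> is isometric to a quotient of \<open>\<ell>\<^sub>1(B)\<close>. Lifting the identity of \<open>X\<close> to \<open>\<ell>\<^sub>1(B)\<close> with norm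
  at most \<open>1 + \<epsilon>\<close>, and then lifting operators from \<open>\<ell>\<^sub>1(B)\<close>, solves every other lifting problem.

  Extension: the universe contains an isometric copy of \<open>\<ell>\<^sub>\<infinity>(B)\<close>, where \<open>B\<close> is the unit ball of the
  dual of \<open>Y\<close>, and \<open>Y\<close> embeds isometrically into \<open>\<ell>\<^sub>\<infinity>(B)\<close>. Extending the inverse of the embedding
  to a projection of \<open>\<ell>\<^sub>\<infinity>(B)\<close> onto \<open>Y\<close> of the same norm, and applying Hahn-Banach coordinatewise,
  solves every other extension problem.
\<close>

type_synonym 'a universe = "('a \<Rightarrow> complex) \<Rightarrow> complex"

definition metric_lifting_property :: "complex set \<Rightarrow> 'a nspace \<Rightarrow> bool" where
  "metric_lifting_property K X \<longleftrightarrow>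
     (\<forall>(Z :: 'a universe nspace) F T \<epsilon>.
        banach_space K Z \<and> closed_subspace K Z F \<and>
        T \<in> operators K X (quotient_space Z F) \<and> \<epsilon> > 0 \<longrightarrow>
        (\<exists>S \<in> operators K X Z. opnorm X Z S \<le> (1 + \<epsilon>) * opnorm X (quotient_space Z F) T \<and>
           T = compose (carrier X) (quotient_map Z F) S))"

definition metric_extension_property :: "complex set \<Rightarrow> 'a nspace \<Rightarrow> bool" where
  "metric_extension_property K Y \<longleftrightarrow>
     (\<forall>(Z :: 'a universe nspace) M T.
        banach_space K Z \<and> closed_subspace K Z M \<and>
        T \<in> operators K (Z\<lparr>carrier := M\<rparr>) Y \<longrightarrow>
        (\<exists>S \<in> operators K Z Y. T = compose M S (\<lambda>x\<in>M. x) \<and>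
           opnorm (Z\<lparr>carrier := M\<rparr>) Y T = opnorm Z Y S))"

end

theory Submission
  imports Defs
begin

text \<open>
  Both diameters are compared with the distance of \<open>T\<close> from the operators of rank at most \<open>n\<close>.

  If \<open>G\<close> is a subspace of \<open>Y\<close> of dimension at most \<open>n\<close>, the lifting property of \<open>X\<close> turns \<open>Q\<^sub>G T\<close>
  into an operator \<open>S\<close> from \<open>X\<close> to \<open>Y\<close> of almost the same norm with \<open>Q\<^sub>G S = Q\<^sub>G T\<close>. Then \<open>A = T - S\<close>
  maps into \<open>G\<close>, so its adjoint has a range \<open>H\<close> of dimension at most \<open>n\<close>, and the norm of \<open>Q\<^sub>H T\<^sup>*\<close> is at
  most that of \<open>T\<^sup>* - A\<^sup>* = S\<^sup>*\<close>, hence at most that of \<open>S\<close> (\<open>lifting_approximation\<close>,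
  \<open>kolmogorov_diameter_adjoint_le\<close>).

  If \<open>G\<close> is a subspace of the dual of \<open>X\<close> of dimension at most \<open>n\<close>, let \<open>M\<close> be the subspace of \<open>X\<close> on
  which all elements of \<open>G\<close> vanish. By Hahn-Banach (\<open>norming_functional\<close>) the norm of \<open>T\<close> on \<open>M\<close> is
  at most that of \<open>Q\<^sub>G T\<^sup>*\<close>. The extension property of \<open>Y\<close> extends \<open>T\<close> from \<open>M\<close> to an operator \<open>S\<close>
  on \<open>X\<close> of no larger norm. As \<open>T - S\<close> vanishes on \<open>M\<close>, which has codimension at most \<open>n\<close>, its range
  \<open>H\<close> has dimension at most \<open>n\<close>, and \<open>Q\<^sub>H T = Q\<^sub>H S\<close> (\<open>extension_approximation\<close>,
  \<open>kolmogorov_diameter_le_adjoint\<close>).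

  The properties of \<open>X\<close> and \<open>Y\<close> only concern test spaces in the universe over the type of \<open>X\<close> or of \<open>Y\<close>
  itself, whereas \<open>Q\<^sub>G T\<close> takes values in a quotient of \<open>Y\<close>, and \<open>T\<close> is to be extended from \<open>M\<close> to \<open>X\<close>.
  A pullback and a pushout move these problems into the right universe. The pullback
  \<open>Z = {(x, y). T x - y \<in> G}\<close> maps onto \<open>X\<close> with kernel \<open>{0} \<times> G\<close>, and lifting the identity of \<open>X\<close> along
  this map amounts to lifting \<open>Q\<^sub>G T\<close>. The pushout \<open>P = (X \<times> Y) / {(m, - T m). m \<in> M}\<close> contains \<open>Y\<close>
  isometrically, and a projection of \<open>P\<close> onto \<open>Y\<close> amounts to an extension of \<open>T\<close> from \<open>M\<close>. Both are
  finite-dimensional extensions, \<open>Z\<close> of the graph of \<open>T\<close>, a copy of \<open>X\<close>, and \<open>P\<close> of \<open>Y\<close>. Therefore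
  (\<open>finite_extension\<close>, \<open>universe_embedding\<close>) they are complete, and an element of them is encoded by an
  element of \<open>X\<close> or \<open>Y\<close> and finitely many scalars, which fits into the universe.

  Dimensions enter only through spanning sets of at most \<open>n\<close> elements. The passage between dimension
  in a space and codimension in its dual or predual is \<open>finite_functionals_split\<close>.
\<close>

section \<open>Real and complex normed spaces\<close>

lemma scalar_ring_simps [simp]:
  "carrier (scalar_ring K) = K" "zero (scalar_ring K) = 0" "one (scalar_ring K) = 1"
  "add (scalar_ring K) = (+)" "mult (scalar_ring K) = (*)"
  by (simp_all add: scalar_ring_def)

lemma cring_scalar_ring:
  assumes "K = \<real> \<or> K = (UNIV :: complex set)"
  shows "cring (scalar_ring K)"
proof (rule cringI)
  show "abelian_group (scalar_ring K)"
    using assms by (intro abelian_groupI) (auto simp: add.assoc add.commute intro: bexI[of _ "- x" for x])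
  show "comm_monoid (scalar_ring K)"
    using assms by (intro comm_monoidI) (auto simp: mult.assoc mult.commute)
qed (auto simp: algebra_simps)

locale kspace = normed_space K V
  for K :: "complex set" and V :: "'a nspace" (structure) +
  assumes scalars: "K = \<real> \<or> K = UNIV"
begin

lemma K_closed [simp, intro]:
  "0 \<in> K" "1 \<in> K" "complex_of_real r \<in> K"
  "a \<in> K \<Longrightarrow> - a \<in> K" "a \<in> K \<Longrightarrow> inverse a \<in> K"
  "a \<in> K \<Longrightarrow> b \<in> K \<Longrightarrow> a + b \<in> K" "a \<in> K \<Longrightarrow> b \<in> K \<Longrightarrow> a - b \<in> K"
  "a \<in> K \<Longrightarrow> b \<in> K \<Longrightarrow> a * b \<in> K" "a \<in> K \<Longrightarrow> b \<in> K \<Longrightarrow> a / b \<in> K"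
  using scalars by auto

lemma K_limit: "(\<And>n. f n \<in> K) \<Longrightarrow> f \<longlonglongrightarrow> c \<Longrightarrow> c \<in> K"
  using scalars closed_complex_Reals closed_sequentially by blast

lemma smult_in [simp, intro]: "c \<in> K \<Longrightarrow> x \<in> carrier V \<Longrightarrow> c \<odot> x \<in> carrier V"
  using smult_closed by simp

lemma smult_add_left: "\<lbrakk>a \<in> K; b \<in> K; x \<in> carrier V\<rbrakk> \<Longrightarrow> (a + b) \<odot> x = a \<odot> x \<oplus> b \<odot> x"
  using smult_l_distr by simp

lemma smult_add_right: "\<lbrakk>a \<in> K; x \<in> carrier V; y \<in> carrier V\<rbrakk> \<Longrightarrow> a \<odot> (x \<oplus> y) = a \<odot> x \<oplus> a \<odot> y"
  using smult_r_distr by simp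

lemma smult_smult: "\<lbrakk>a \<in> K; b \<in> K; x \<in> carrier V\<rbrakk> \<Longrightarrow> a \<odot> (b \<odot> x) = (a * b) \<odot> x"
  using smult_assoc1 by simp

lemma smult_1 [simp]: "x \<in> carrier V \<Longrightarrow> 1 \<odot> x = x"
  using smult_one by simp

lemma smult_0 [simp]: "x \<in> carrier V \<Longrightarrow> 0 \<odot> x = \<zero>"
  using smult_l_null by simp

lemma smult_zero [simp]: "c \<in> K \<Longrightarrow> c \<odot> \<zero> = \<zero>"
  using smult_r_null by simp

lemma neg_eq: "x \<in> carrier V \<Longrightarrow> \<ominus> x = (-1) \<odot> x"
  by (rule M.minus_equality) (use smult_add_left[of "-1" 1 x] in auto)

lemma minus_eq': "x \<in> carrier V \<Longrightarrow> y \<in> carrier V \<Longrightarrow> x \<ominus> y = x \<oplus> (-1) \<odot> y"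
  by (simp add: a_minus_def neg_eq)

lemma smult_minus: "\<lbrakk>c \<in> K; x \<in> carrier V; y \<in> carrier V\<rbrakk> \<Longrightarrow> c \<odot> (x \<ominus> y) = c \<odot> x \<ominus> c \<odot> y"
  by (simp add: minus_eq' smult_add_right smult_smult)

lemma add_minus_add: "\<lbrakk>a \<in> carrier V; b \<in> carrier V; c \<in> carrier V; d \<in> carrier V\<rbrakk>
   \<Longrightarrow> (a \<oplus> b) \<ominus> (c \<oplus> d) = (a \<ominus> c) \<oplus> (b \<ominus> d)"
  by (simp add: a_minus_def M.minus_add M.a_ac)

lemma minus_add_minus: "\<lbrakk>a \<in> carrier V; b \<in> carrier V; c \<in> carrier V\<rbrakk>
   \<Longrightarrow> (a \<ominus> b) \<oplus> (b \<ominus> c) = a \<ominus> c"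
  by (simp add: a_minus_def M.a_ac M.r_neg1 M.r_neg2)

lemma add_minus_cancel [simp]: "\<lbrakk>a \<in> carrier V; b \<in> carrier V\<rbrakk> \<Longrightarrow> b \<oplus> (a \<ominus> b) = a"
  by (simp add: a_minus_def M.a_ac M.r_neg2 M.r_neg)

lemma minus_add_cancel [simp]: "\<lbrakk>a \<in> carrier V; b \<in> carrier V\<rbrakk> \<Longrightarrow> (a \<ominus> b) \<oplus> b = a"
  by (simp add: M.a_comm[of _ b])

lemma add_minus_cancel' [simp]: "\<lbrakk>a \<in> carrier V; b \<in> carrier V\<rbrakk> \<Longrightarrow> (a \<oplus> b) \<ominus> b = a"
  by (simp add: a_minus_def M.a_ac M.r_neg)

lemma add_minus_cancel'' [simp]: "\<lbrakk>a \<in> carrier V; b \<in> carrier V\<rbrakk> \<Longrightarrow> (b \<oplus> a) \<ominus> b = a"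
  by (simp add: M.a_comm[of b a])

lemma minus_minus_cancel [simp]: "\<lbrakk>a \<in> carrier V; b \<in> carrier V\<rbrakk> \<Longrightarrow> a \<ominus> (a \<ominus> b) = b"
  by (simp add: a_minus_def M.minus_add M.r_neg2)

lemma minus_self [simp]: "x \<in> carrier V \<Longrightarrow> x \<ominus> x = \<zero>"
  by (simp add: a_minus_def M.r_neg)

lemma minus_zero' [simp]: "x \<in> carrier V \<Longrightarrow> x \<ominus> \<zero> = x"
  by (simp add: a_minus_def)

lemma eq_if_minus_zero: "\<lbrakk>a \<in> carrier V; b \<in> carrier V; a \<ominus> b = \<zero>\<rbrakk> \<Longrightarrow> a = b"
  using add_minus_cancel[of a b] by simp

lemma nrm_zero [simp]: "nrm V \<zero> = 0"
  using nrm_eq_0 by simp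

lemma nrm_neg [simp]: "x \<in> carrier V \<Longrightarrow> nrm V (\<ominus> x) = nrm V x"
  by (simp add: neg_eq nrm_smult)

lemma nrm_minus_commute: "x \<in> carrier V \<Longrightarrow> y \<in> carrier V \<Longrightarrow> nrm V (x \<ominus> y) = nrm V (y \<ominus> x)"
  using nrm_neg[of "x \<ominus> y"] by (simp add: a_minus_def M.minus_add M.a_comm)

lemma nrm_minus_le: "x \<in> carrier V \<Longrightarrow> y \<in> carrier V \<Longrightarrow> nrm V (x \<ominus> y) \<le> nrm V x + nrm V y"
  using nrm_triangle[of x "\<ominus> y"] by (simp add: a_minus_def)

lemma nrm_minus_triangle:
  "\<lbrakk>a \<in> carrier V; b \<in> carrier V; c \<in> carrier V\<rbrakk> \<Longrightarrow> nrm V (a \<ominus> c) \<le> nrm V (a \<ominus> b) + nrm V (b \<ominus> c)"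
  using nrm_triangle[of "a \<ominus> b" "b \<ominus> c"] by (simp add: minus_add_minus)

lemma submod_iff:
  "submodule H (scalar_ring K) V \<longleftrightarrow> H \<subseteq> carrier V \<and> \<zero> \<in> H \<and>
     (\<forall>x\<in>H. \<forall>y\<in>H. x \<oplus> y \<in> H) \<and> (\<forall>c\<in>K. \<forall>x\<in>H. c \<odot> x \<in> H)" (is "?l = ?r")
proof
  assume l: ?l
  note E = submoduleE[OF l]
  from E(2) obtain h where h: "h \<in> H" by auto
  have "0 \<odot> h \<in> H" by (rule E(4)) (use h in auto)
  with h E(1) have "\<zero> \<in> H" by auto
  with E(1,4,5) show ?r by auto
next
  assume r: ?r
  show ?l
    by (rule submoduleI) (use r in \<open>auto simp: neg_eq subset_iff\<close>)
qed

lemma submod_minus: "submodule H (scalar_ring K) V \<Longrightarrow> x \<in> H \<Longrightarrow> y \<in> H \<Longrightarrow> x \<ominus> y \<in> H"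
  unfolding submod_iff by (simp add: minus_eq' subset_iff)

sublocale ms: Metric_space "carrier V" "ndist V"
proof
  show "0 \<le> ndist V x y" for x y by (simp add: ndist_def nrm_nonneg)
  show "ndist V x y = ndist V y x" for x y by (simp add: ndist_def nrm_minus_commute)
  show "ndist V x y = 0 \<longleftrightarrow> x = y" if "x \<in> carrier V" "y \<in> carrier V" for x y
    using that by (auto simp: ndist_def nrm_eq_0 intro: eq_if_minus_zero)
  show "ndist V x z \<le> ndist V x y + ndist V y z"
    if "x \<in> carrier V" "y \<in> carrier V" "z \<in> carrier V" for x y z
    using that by (simp add: ndist_def nrm_minus_triangle)
qed

lemma closedin_ntop_iff:
  "closedin (ntop V) F \<longleftrightarrow> F \<subseteq> carrier V \<and>
     (\<forall>v\<in>carrier V. (\<forall>e>0. \<exists>f\<in>F. nrm V (v \<ominus> f) < e) \<longrightarrow> v \<in> F)"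
proof -
  have 1: "disjnt F (ms.mball v r) \<longleftrightarrow> \<not> (\<exists>f\<in>F. nrm V (v \<ominus> f) < r)"
    if "F \<subseteq> carrier V" "v \<in> carrier V" for v r
    using that by (auto simp: disjnt_iff ndist_def)
  show ?thesis
    unfolding ntop_def ms.closedin_metric
    by (rule conj_cong[OF refl]) (metis 1 DiffE DiffI)
qed

text \<open>
  Completeness of a subset is expressed by the norm alone, so that it can be compared between
  a space and a subspace, a quotient or an image with another carrier.
\<close>

definition complete_set :: "'a set \<Rightarrow> bool" where
  "complete_set W \<longleftrightarrow> (\<forall>\<sigma>. (\<forall>n::nat. \<sigma> n \<in> W) \<and>
      (\<forall>e>0. \<exists>N. \<forall>m\<ge>N. \<forall>n\<ge>N. nrm V (\<sigma> m \<ominus> \<sigma> n) < e) \<longrightarrow>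
      (\<exists>x\<in>W. (\<lambda>n. nrm V (\<sigma> n \<ominus> x)) \<longlonglongrightarrow> 0))"

lemma mcomplete_iff: "ms.mcomplete \<longleftrightarrow> complete_set (carrier V)"
proof -
  have 1: "ms.MCauchy \<sigma> \<longleftrightarrow> (\<forall>n::nat. \<sigma> n \<in> carrier V) \<and>
      (\<forall>e>0. \<exists>N. \<forall>m\<ge>N. \<forall>n\<ge>N. nrm V (\<sigma> m \<ominus> \<sigma> n) < e)" for \<sigma>
    unfolding ms.MCauchy_def by (auto simp: ndist_def image_subset_iff)
  have 2: "limitin ms.mtopology \<sigma> x sequentially \<longleftrightarrow> x \<in> carrier V \<and> (\<lambda>n. nrm V (\<sigma> n \<ominus> x)) \<longlonglongrightarrow> 0"
    if s: "\<forall>n::nat. \<sigma> n \<in> carrier V" for \<sigma> x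
  proof -
    have "ndist V (\<sigma> n) x = nrm V (\<sigma> n \<ominus> x)" if "x \<in> carrier V" for n
      using that s by (simp add: ndist_def)
    then show ?thesis
      using s by (auto simp: ms.limitin_metric_dist_null)
  qed
  have 3: "(\<exists>x. limitin ms.mtopology \<sigma> x sequentially) \<longleftrightarrow>
      (\<exists>x\<in>carrier V. (\<lambda>n. nrm V (\<sigma> n \<ominus> x)) \<longlonglongrightarrow> 0)"
    if "\<forall>n::nat. \<sigma> n \<in> carrier V" for \<sigma>
    using 2[OF that] by auto
  show ?thesis
    unfolding ms.mcomplete_def complete_set_def 1 using 3 by (simp add: imp_conjL cong: imp_cong)
qed

lemma complete_set_closed:
  assumes "complete_set W" "W \<subseteq> carrier V"
  shows "closedin (ntop V) W"
  unfolding closedin_ntop_iff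
proof (intro conjI ballI impI assms)
  fix v assume v: "v \<in> carrier V" "\<forall>e>0. \<exists>f\<in>W. nrm V (v \<ominus> f) < e"
  have "\<exists>f\<in>W. nrm V (v \<ominus> f) < inverse (Suc n)" for n
    using v by simp
  then obtain f where f: "\<And>n. f n \<in> W" "\<And>n. nrm V (v \<ominus> f n) < inverse (Suc n)" by metis
  have fc: "f n \<in> carrier V" for n using f assms by auto
  have lim: "(\<lambda>n. nrm V (v \<ominus> f n)) \<longlonglongrightarrow> 0"
    by (rule real_tendsto_sandwich[OF _ _ tendsto_const LIMSEQ_inverse_real_of_nat])
       (use f(2) fc v in \<open>auto intro!: always_eventually nrm_nonneg intro: less_imp_le simp del: of_nat_Suc\<close>)
  have "\<exists>N. \<forall>m\<ge>N. \<forall>n\<ge>N. nrm V (f m \<ominus> f n) < e" if "e > 0" for e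
  proof -
    obtain N where N: "\<And>n. n \<ge> N \<Longrightarrow> nrm V (v \<ominus> f n) < e / 2"
      using order_tendstoD(2)[OF lim half_gt_zero[OF \<open>e > 0\<close>]] unfolding eventually_sequentially by blast
    have "nrm V (f m \<ominus> f n) < e" if "m \<ge> N" "n \<ge> N" for m n
      using nrm_minus_triangle[of "f m" v "f n"] fc v N that nrm_minus_commute[of "f m" v]
      by (smt (verit) field_sum_of_halves)
    then show ?thesis by blast
  qed
  then obtain x where x: "x \<in> W" "(\<lambda>n. nrm V (f n \<ominus> x)) \<longlonglongrightarrow> 0"
    using assms(1) f(1) unfolding complete_set_def by blast
  have xc: "x \<in> carrier V" using x assms by auto
  have "nrm V (v \<ominus> x) \<le> 0"
  proof (rule LIMSEQ_le_const)
    show "(\<lambda>n. nrm V (v \<ominus> f n) + nrm V (f n \<ominus> x)) \<longlonglongrightarrow> 0"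
      using tendsto_add[OF lim x(2)] by simp
    show "\<exists>N. \<forall>n\<ge>N. nrm V (v \<ominus> x) \<le> nrm V (v \<ominus> f n) + nrm V (f n \<ominus> x)"
      using nrm_minus_triangle fc v xc by blast
  qed
  then have "v \<ominus> x = \<zero>"
    using nrm_nonneg[of "v \<ominus> x"] nrm_eq_0[of "v \<ominus> x"] v xc by simp
  then show "v \<in> W" using eq_if_minus_zero v xc x by metis
qed

end

lemma kspaceI:
  assumes "K = \<real> \<or> K = UNIV" "normed_space K V"
  shows "kspace K V"
  using assms by (simp add: kspace_def kspace_axioms_def)

lemma banach_space_iff:
  "kspace K V \<Longrightarrow> banach_space K V \<longleftrightarrow> kspace.complete_set V (carrier V)"
  unfolding banach_space_def by (simp add: kspace.mcomplete_iff kspace.axioms(1))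

section \<open>Bounded linear maps\<close>

text \<open>
  The operators of the theorem are extensional, which composition and subtraction of plain functions do
  not preserve. Bounded maps drop this condition and replace continuity by a norm estimate.
\<close>

definition bounded_map :: "complex set \<Rightarrow> 'a nspace \<Rightarrow> 'b nspace \<Rightarrow> ('a \<Rightarrow> 'b) \<Rightarrow> bool" where
  "bounded_map K X Y f \<longleftrightarrow> f ` carrier X \<subseteq> carrier Y \<and>
     (\<forall>x\<in>carrier X. \<forall>y\<in>carrier X. f (x \<oplus>\<^bsub>X\<^esub> y) = f x \<oplus>\<^bsub>Y\<^esub> f y) \<and>
     (\<forall>c\<in>K. \<forall>x\<in>carrier X. f (c \<odot>\<^bsub>X\<^esub> x) = c \<odot>\<^bsub>Y\<^esub> f x) \<and>
     (\<exists>C. \<forall>x\<in>carrier X. nrm Y (f x) \<le> C * nrm X x)"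

lemma bounded_mapI:
  assumes "\<And>x. x \<in> carrier X \<Longrightarrow> f x \<in> carrier Y"
    and "\<And>x y. x \<in> carrier X \<Longrightarrow> y \<in> carrier X \<Longrightarrow> f (x \<oplus>\<^bsub>X\<^esub> y) = f x \<oplus>\<^bsub>Y\<^esub> f y"
    and "\<And>c x. c \<in> K \<Longrightarrow> x \<in> carrier X \<Longrightarrow> f (c \<odot>\<^bsub>X\<^esub> x) = c \<odot>\<^bsub>Y\<^esub> f x"
    and "\<And>x. x \<in> carrier X \<Longrightarrow> nrm Y (f x) \<le> C * nrm X x"
  shows "bounded_map K X Y f"
  using assms unfolding bounded_map_def by blast

lemma bounded_mapD:
  assumes "bounded_map K X Y f"
  shows "x \<in> carrier X \<Longrightarrow> f x \<in> carrier Y"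
    and "x \<in> carrier X \<Longrightarrow> y \<in> carrier X \<Longrightarrow> f (x \<oplus>\<^bsub>X\<^esub> y) = f x \<oplus>\<^bsub>Y\<^esub> f y"
    and "c \<in> K \<Longrightarrow> x \<in> carrier X \<Longrightarrow> f (c \<odot>\<^bsub>X\<^esub> x) = c \<odot>\<^bsub>Y\<^esub> f x"
  using assms unfolding bounded_map_def by auto

lemma bounded_map_zero:
  assumes "kspace K X" "kspace K Y" "bounded_map K X Y f"
  shows "f \<zero>\<^bsub>X\<^esub> = \<zero>\<^bsub>Y\<^esub>"
proof -
  interpret X: kspace K X by fact
  interpret Y: kspace K Y by fact
  have "f (0 \<odot>\<^bsub>X\<^esub> \<zero>\<^bsub>X\<^esub>) = 0 \<odot>\<^bsub>Y\<^esub> f \<zero>\<^bsub>X\<^esub>" using bounded_mapD[OF assms(3)] by blast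
  then show ?thesis using bounded_mapD[OF assms(3)] by simp
qed

lemma bounded_map_minus:
  assumes "kspace K X" "kspace K Y" "bounded_map K X Y f" "x \<in> carrier X" "y \<in> carrier X"
  shows "f (x \<ominus>\<^bsub>X\<^esub> y) = f x \<ominus>\<^bsub>Y\<^esub> f y"
proof -
  interpret X: kspace K X by fact
  interpret Y: kspace K Y by fact
  show ?thesis using assms(4,5) bounded_mapD[OF assms(3)]
    by (simp add: X.minus_eq' Y.minus_eq')
qed

lemma bounded_map_bound:
  assumes "kspace K X" "bounded_map K X Y f"
  obtains C where "C > 0" "\<And>x. x \<in> carrier X \<Longrightarrow> nrm Y (f x) \<le> C * nrm X x"
proof -
  interpret X: kspace K X by fact
  obtain C where C: "\<And>x. x \<in> carrier X \<Longrightarrow> nrm Y (f x) \<le> C * nrm X x"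
    using assms(2) unfolding bounded_map_def by blast
  have "nrm Y (f x) \<le> max C 1 * nrm X x" if "x \<in> carrier X" for x
    using C[OF that] mult_right_mono[OF max.cobounded1[of C 1] X.nrm_nonneg[OF that]] by linarith
  then show ?thesis using that[of "max C 1"] by simp
qed

lemma bounded_map_comp:
  assumes "kspace K X" "kspace K Y" "bounded_map K X Y f" "bounded_map K Y Z g"
  shows "bounded_map K X Z (\<lambda>x. g (f x))"
proof -
  obtain C where C: "C > 0" "\<And>x. x \<in> carrier X \<Longrightarrow> nrm Y (f x) \<le> C * nrm X x"
    using bounded_map_bound[OF assms(1,3)] by blast
  obtain D where D: "D > 0" "\<And>x. x \<in> carrier Y \<Longrightarrow> nrm Z (g x) \<le> D * nrm Y x"
    using bounded_map_bound[OF assms(2,4)] by blast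
  show ?thesis
  proof (rule bounded_mapI[where C = "D * C"])
    fix x assume x: "x \<in> carrier X"
    have "nrm Z (g (f x)) \<le> D * nrm Y (f x)" using D(2) bounded_mapD(1)[OF assms(3) x] by simp
    also have "\<dots> \<le> D * (C * nrm X x)" using C(2)[OF x] D(1) by simp
    finally show "nrm Z (g (f x)) \<le> D * C * nrm X x" by (simp add: mult.assoc)
  qed (use bounded_mapD[OF assms(3)] bounded_mapD[OF assms(4)] in auto)
qed

lemma bounded_map_diff:
  assumes "kspace K X" "kspace K Y" "bounded_map K X Y f" "bounded_map K X Y g"
  shows "bounded_map K X Y (\<lambda>x. f x \<ominus>\<^bsub>Y\<^esub> g x)"
proof -
  interpret X: kspace K X by fact
  interpret Y: kspace K Y by fact
  note f = bounded_mapD[OF assms(3)] and g = bounded_mapD[OF assms(4)]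
  obtain C where C: "C > 0" "\<And>x. x \<in> carrier X \<Longrightarrow> nrm Y (f x) \<le> C * nrm X x"
    using bounded_map_bound[OF assms(1,3)] by blast
  obtain D where D: "D > 0" "\<And>x. x \<in> carrier X \<Longrightarrow> nrm Y (g x) \<le> D * nrm X x"
    using bounded_map_bound[OF assms(1,4)] by blast
  show ?thesis
  proof (rule bounded_mapI[where C = "C + D"])
    fix x assume x: "x \<in> carrier X"
    show "nrm Y (f x \<ominus>\<^bsub>Y\<^esub> g x) \<le> (C + D) * nrm X x"
      using Y.nrm_minus_le[of "f x" "g x"] C(2)[OF x] D(2)[OF x] f(1)[OF x] g(1)[OF x]
      by (simp add: distrib_right)
  qed (use f g in \<open>auto simp: Y.smult_minus Y.add_minus_add\<close>)
qed

lemma bounded_map_cong: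
  assumes "kspace K X" "bounded_map K X Y f" "\<And>x. x \<in> carrier X \<Longrightarrow> g x = f x"
  shows "bounded_map K X Y g"
proof -
  interpret X: kspace K X by fact
  show ?thesis using assms(2) unfolding bounded_map_def by (simp add: assms(3) image_subset_iff)
qed

lemma bounded_map_continuous:
  assumes "kspace K X" "kspace K Y" "bounded_map K X Y f"
  shows "continuous_map (ntop X) (ntop Y) f"
proof -
  interpret X: kspace K X by fact
  interpret Y: kspace K Y by fact
  note f = bounded_mapD[OF assms(3)]
  obtain C where C: "C > 0" "\<And>x. x \<in> carrier X \<Longrightarrow> nrm Y (f x) \<le> C * nrm X x"
    using bounded_map_bound[OF assms(1,3)] by blast
  show ?thesis
    unfolding ntop_def X.ms.metric_continuous_map[OF Y.ms.Metric_space_axioms]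
  proof (intro conjI ballI allI impI)
    show "f ` carrier X \<subseteq> carrier Y" using f by auto
    fix a and e :: real assume a: "a \<in> carrier X" and e: "e > 0"
    have "ndist Y (f a) (f x) < e" if x: "x \<in> carrier X" "ndist X a x < e / C" for x
    proof -
      have "ndist Y (f a) (f x) = nrm Y (f (a \<ominus>\<^bsub>X\<^esub> x))"
        using a x f by (simp add: ndist_def bounded_map_minus[OF assms])
      also have "\<dots> \<le> C * ndist X a x" using C(2)[of "a \<ominus>\<^bsub>X\<^esub> x"] a x by (simp add: ndist_def)
      also have "\<dots> < e" using x(2) C(1) by (simp add: field_simps)
      finally show ?thesis .
    qed
    then show "\<exists>d>0. \<forall>x. x \<in> carrier X \<and> ndist X a x < d \<longrightarrow> ndist Y (f a) (f x) < e"
      using e C(1) by (intro exI[of _ "e / C"]) auto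
  qed
qed

text \<open>
  Continuity at \<open>0\<close> bounds \<open>f\<close> on a small ball, and every vector can be scaled into this ball.
\<close>

lemma linear_continuous_bounded:
  assumes "kspace K X" "kspace K Y"
    and "\<And>x. x \<in> carrier X \<Longrightarrow> f x \<in> carrier Y"
    and "\<And>x y. x \<in> carrier X \<Longrightarrow> y \<in> carrier X \<Longrightarrow> f (x \<oplus>\<^bsub>X\<^esub> y) = f x \<oplus>\<^bsub>Y\<^esub> f y"
    and "\<And>c x. c \<in> K \<Longrightarrow> x \<in> carrier X \<Longrightarrow> f (c \<odot>\<^bsub>X\<^esub> x) = c \<odot>\<^bsub>Y\<^esub> f x"
    and cont: "continuous_map (ntop X) (ntop Y) f"
  shows "bounded_map K X Y f"
proof -
  interpret X: kspace K X by fact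
  interpret Y: kspace K Y by fact
  have z: "f \<zero>\<^bsub>X\<^esub> = \<zero>\<^bsub>Y\<^esub>"
    using assms(5)[of 0 "\<zero>\<^bsub>X\<^esub>"] assms(3) by simp
  obtain d where d: "d > 0"
    "\<And>x. x \<in> carrier X \<Longrightarrow> ndist X \<zero>\<^bsub>X\<^esub> x < d \<Longrightarrow> ndist Y (f \<zero>\<^bsub>X\<^esub>) (f x) < 1"
    using cont unfolding ntop_def X.ms.metric_continuous_map[OF Y.ms.Metric_space_axioms]
    by (meson X.M.zero_closed zero_less_one)
  have d': "nrm Y (f x) \<le> 1" if "x \<in> carrier X" "nrm X x < d" for x
    using d(2)[of x] that assms(3)
    by (simp add: ndist_def z X.nrm_minus_commute[of _ x] Y.nrm_minus_commute[of _ "f x"] less_imp_le)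
  show ?thesis
  proof (rule bounded_mapI[where C = "2 / d"])
    fix x assume x: "x \<in> carrier X"
    show "nrm Y (f x) \<le> 2 / d * nrm X x"
    proof (cases "nrm X x = 0")
      case True
      then show ?thesis using X.nrm_eq_0[OF x] z by simp
    next
      case False
      then have p: "nrm X x > 0" using X.nrm_nonneg[OF x] by linarith
      define c where "c = d / (2 * nrm X x)"
      have c: "c > 0" using p d by (simp add: c_def)
      have "nrm X (complex_of_real c \<odot>\<^bsub>X\<^esub> x) = d / 2"
        using p c x by (simp add: X.nrm_smult) (simp add: c_def)
      then have "nrm Y (f (complex_of_real c \<odot>\<^bsub>X\<^esub> x)) \<le> 1" using d' d(1) x by simp
      then have "c * nrm Y (f x) \<le> 1" using assms(3,5) x c by (simp add: Y.nrm_smult)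
      then show ?thesis using p d(1) by (simp add: c_def field_simps)
    qed
  qed (use assms in auto)
qed

lemma operators_iff:
  assumes "kspace K X" "kspace K Y"
  shows "T \<in> operators K X Y \<longleftrightarrow> T \<in> extensional (carrier X) \<and> bounded_map K X Y T" (is "?l \<longleftrightarrow> ?r")
proof
  assume ?l
  then show ?r
    using linear_continuous_bounded[OF assms, of T] by (auto simp: operators_def PiE_def)
next
  assume r: ?r
  then show ?l
    using bounded_map_continuous[OF assms, of T] bounded_mapD[of K X Y T]
    by (auto simp: operators_def PiE_def)
qed

lemma restrict_operators:
  assumes "kspace K X" "kspace K Y" "bounded_map K X Y f"
  shows "restrict f (carrier X) \<in> operators K X Y"
  using bounded_map_cong[OF assms(1,3), of "restrict f (carrier X)"]
  by (simp add: operators_iff[OF assms(1,2)])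

lemma opnorm_le:
  assumes "kspace K X" "0 \<le> C" "\<And>x. x \<in> carrier X \<Longrightarrow> nrm Y (f x) \<le> C * nrm X x"
  shows "opnorm X Y f \<le> C"
  unfolding opnorm_def
proof (rule cSUP_least)
  interpret X: kspace K X by fact
  show "{x \<in> carrier X. nrm X x \<le> 1} \<noteq> {}" using X.M.zero_closed X.nrm_zero by force
  fix x assume "x \<in> {x \<in> carrier X. nrm X x \<le> 1}"
  then show "nrm Y (f x) \<le> C"
    using assms(3)[of x] mult_left_mono[of "nrm X x" 1 C] assms(2) by simp
qed

lemma opnorm_upper_ball:
  assumes "kspace K X" "bounded_map K X Y f" "x \<in> carrier X" "nrm X x \<le> 1"
  shows "nrm Y (f x) \<le> opnorm X Y f"
  unfolding opnorm_def
proof (rule cSUP_upper)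
  interpret X: kspace K X by fact
  obtain C where C: "C > 0" "\<And>x. x \<in> carrier X \<Longrightarrow> nrm Y (f x) \<le> C * nrm X x"
    using bounded_map_bound[OF assms(1,2)] by blast
  show "bdd_above ((\<lambda>x. nrm Y (f x)) ` {x \<in> carrier X. nrm X x \<le> 1})"
    using C by (intro bdd_aboveI[of _ C]) (force intro: order_trans mult_left_le simp: less_imp_le)
qed (use assms in auto)

lemma opnorm_nonneg:
  assumes "kspace K X" "kspace K Y" "bounded_map K X Y f"
  shows "0 \<le> opnorm X Y f"
proof -
  interpret X: kspace K X by fact
  interpret Y: kspace K Y by fact
  show ?thesis
    using opnorm_upper_ball[OF assms(1,3), of "\<zero>\<^bsub>X\<^esub>"] bounded_map_zero[OF assms] by simp
qed

lemma opnorm_upper: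
  assumes "kspace K X" "kspace K Y" "bounded_map K X Y f" "x \<in> carrier X"
  shows "nrm Y (f x) \<le> opnorm X Y f * nrm X x"
proof -
  interpret X: kspace K X by fact
  interpret Y: kspace K Y by fact
  note f = bounded_mapD[OF assms(3)]
  show ?thesis
  proof (cases "nrm X x = 0")
    case True
    then show ?thesis using X.nrm_eq_0[OF assms(4)] bounded_map_zero[OF assms(1-3)] by simp
  next
    case False
    then have p: "nrm X x > 0" using X.nrm_nonneg[OF assms(4)] by linarith
    define c where "c = 1 / nrm X x"
    have "nrm X (complex_of_real c \<odot>\<^bsub>X\<^esub> x) = 1" using p assms(4) by (simp add: X.nrm_smult c_def norm_divide)
    then have "nrm Y (f (complex_of_real c \<odot>\<^bsub>X\<^esub> x)) \<le> opnorm X Y f"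
      using opnorm_upper_ball[OF assms(1,3)] assms(4) by simp
    then have "c * nrm Y (f x) \<le> opnorm X Y f" using f assms(4) p by (simp add: Y.nrm_smult c_def norm_divide)
    then show ?thesis using p by (simp add: c_def field_simps)
  qed
qed

section \<open>Finite spans and finitely many functionals\<close>

context kspace
begin

lemma submodD:
  assumes "submodule H (scalar_ring K) V"
  shows "H \<subseteq> carrier V" "\<zero> \<in> H" "x \<in> H \<Longrightarrow> y \<in> H \<Longrightarrow> x \<oplus> y \<in> H" "c \<in> K \<Longrightarrow> x \<in> H \<Longrightarrow> c \<odot> x \<in> H"
    "x \<in> H \<Longrightarrow> x \<in> carrier V"
  using assms[unfolded submod_iff] by auto

lemma lin_span_submodule:
  assumes "B \<subseteq> carrier V"
  shows "submodule (lin_span K V B) (scalar_ring K) V"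
proof -
  have "lin_span K V B \<subseteq> carrier V"
    unfolding lin_span_def using assms carrier_is_submodule by (intro Inter_lower) simp
  then show ?thesis unfolding submod_iff by (auto simp: lin_span_def submod_iff)
qed

lemma lin_span_superset: "B \<subseteq> lin_span K V B"
  by (auto simp: lin_span_def)

lemma lin_span_minimal: "submodule H (scalar_ring K) V \<Longrightarrow> B \<subseteq> H \<Longrightarrow> lin_span K V B \<subseteq> H"
  by (auto simp: lin_span_def)

lemma lin_span_mono: "A \<subseteq> B \<Longrightarrow> lin_span K V A \<subseteq> lin_span K V B"
  by (auto simp: lin_span_def)

lemma lin_span_carrier: "B \<subseteq> carrier V \<Longrightarrow> lin_span K V B \<subseteq> carrier V"
  by (rule submodD(1)[OF lin_span_submodule])

lemma lin_span_self: "submodule H (scalar_ring K) V \<Longrightarrow> lin_span K V H = H"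
  using lin_span_minimal lin_span_superset by blast

lemma lin_span_insert:
  assumes "B \<subseteq> carrier V" "b \<in> carrier V"
  shows "lin_span K V (insert b B) = {w \<oplus> c \<odot> b |w c. w \<in> lin_span K V B \<and> c \<in> K}" (is "?l = ?r")
proof
  have sub: "submodule (lin_span K V B) (scalar_ring K) V" by (rule lin_span_submodule) fact
  note S = submodD[OF sub]
  have subi: "submodule (lin_span K V (insert b B)) (scalar_ring K) V"
    using assms by (intro lin_span_submodule) auto
  note Si = submodD[OF subi]
  have "submodule ?r (scalar_ring K) V"
    unfolding submod_iff
  proof (intro conjI ballI)
    show "?r \<subseteq> carrier V" using S(5) assms by auto
    have "\<zero> = \<zero> \<oplus> 0 \<odot> b" using assms by simp
    then show "\<zero> \<in> ?r" using S(2) K_closed(1) by blast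
    fix x y assume "x \<in> ?r" "y \<in> ?r"
    then obtain w c w' c' where x: "x = w \<oplus> c \<odot> b" "w \<in> lin_span K V B" "c \<in> K"
      and y: "y = w' \<oplus> c' \<odot> b" "w' \<in> lin_span K V B" "c' \<in> K" by blast
    moreover have "w \<in> carrier V" "w' \<in> carrier V" using x y S(5) by auto
    ultimately have "x \<oplus> y = (w \<oplus> w') \<oplus> (c + c') \<odot> b"
      using assms by (simp add: smult_add_left M.a_ac)
    then show "x \<oplus> y \<in> ?r" using S(3)[OF x(2) y(2)] K_closed(6)[OF x(3) y(3)] by blast
  next
    fix a x assume "a \<in> K" "x \<in> ?r"
    then obtain w c where x: "x = w \<oplus> c \<odot> b" "w \<in> lin_span K V B" "c \<in> K" and a: "a \<in> K" by blast
    moreover have "w \<in> carrier V" using x S(5) by auto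
    ultimately have "a \<odot> x = (a \<odot> w) \<oplus> (a * c) \<odot> b"
      using assms by (simp add: smult_add_right smult_smult)
    then show "a \<odot> x \<in> ?r" using S(4)[OF a x(2)] K_closed(8)[OF a x(3)] by blast
  qed
  moreover have "insert b B \<subseteq> ?r"
  proof -
    have "b = \<zero> \<oplus> 1 \<odot> b" using assms by simp
    then have "b \<in> ?r" using S(2) K_closed(2) by blast
    moreover have "x \<in> ?r" if "x \<in> B" for x
    proof -
      have "x = x \<oplus> 0 \<odot> b" using assms that by auto
      then show ?thesis using lin_span_superset[of B] that K_closed(1) by blast
    qed
    ultimately show ?thesis by blast
  qed
  ultimately show "?l \<subseteq> ?r" by (rule lin_span_minimal)
  have "lin_span K V B \<subseteq> ?l" "b \<in> ?l"
    using lin_span_mono[of B "insert b B"] lin_span_superset[of "insert b B"] by auto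
  then show "?r \<subseteq> ?l" using Si(3,4) by blast
qed

text \<open>
  Among the subsets of \<open>B\<close> with the same span, one of least cardinality is linearly independent. This
  reduces every dimension estimate below to counting generators.
\<close>

lemma dim_at_most_lin_span:
  assumes "finite B" "card B \<le> n" "B \<subseteq> carrier V"
  shows "dim_at_most K V (lin_span K V B) n"
proof -
  define P where "P C \<longleftrightarrow> C \<subseteq> B \<and> lin_span K V C = lin_span K V B" for C
  have "P B" by (simp add: P_def)
  then obtain C where C: "P C" "\<And>D. P D \<Longrightarrow> card C \<le> card D"
    using ex_has_least_nat[of P B card] by blast
  have fin: "finite C" "C \<subseteq> carrier V" using C(1) assms finite_subset[of C B] unfolding P_def by auto
  have "b \<notin> lin_span K V (C - {b})" if b: "b \<in> C" for b
  proof
    assume *: "b \<in> lin_span K V (C - {b})"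
    have "C - {b} \<subseteq> lin_span K V (C - {b})" by (rule lin_span_superset)
    then have "C \<subseteq> lin_span K V (C - {b})" using * by blast
    then have "lin_span K V C \<subseteq> lin_span K V (C - {b})"
      using fin by (intro lin_span_minimal[OF lin_span_submodule]) auto
    then have "P (C - {b})" using C(1) lin_span_mono[of "C - {b}" C] unfolding P_def by auto
    then have "card C \<le> card (C - {b})" by (rule C(2))
    then show False using b fin(1) by (meson card_Diff1_less not_le)
  qed
  moreover have "card C \<le> n" using C(2)[OF \<open>P B\<close>] assms(2) by simp
  ultimately show ?thesis
    unfolding dim_at_most_def using fin C(1) unfolding P_def by (intro exI[of _ C]) auto
qed

text \<open>
  The common kernel of \<open>k\<close> functionals has a complement of dimension at most \<open>k\<close>. Another functional
  \<open>e\<close> either is determined by the previous ones, or is nonzero at some \<open>r\<close> in their common kernel; in the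
  second case adding a multiple of \<open>r\<close> corrects the value of \<open>e\<close> without disturbing the others.
  The lemma is applied to functionals on \<open>X\<close> and to evaluations at points of \<open>Y\<close>, which are functionals
  on the dual of \<open>Y\<close>.
\<close>

lemma finite_functionals_split:
  assumes "finite E"
    and "\<And>e x y. e \<in> E \<Longrightarrow> x \<in> carrier V \<Longrightarrow> y \<in> carrier V \<Longrightarrow> e (x \<oplus> y) = e x + (e y :: complex)"
    and "\<And>e c x. e \<in> E \<Longrightarrow> c \<in> K \<Longrightarrow> x \<in> carrier V \<Longrightarrow> e (c \<odot> x) = c * e x"
    and "\<And>e x. e \<in> E \<Longrightarrow> x \<in> carrier V \<Longrightarrow> e x \<in> K"
  shows "\<exists>B. B \<subseteq> carrier V \<and> finite B \<and> card B \<le> card E \<and>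
     (\<forall>x\<in>carrier V. \<exists>s\<in>lin_span K V B. \<forall>e\<in>E. e s = e x)"
  using assms
proof (induction E)
  case empty
  show ?case
    using submodD(2)[OF lin_span_submodule[of "{}"]] by (intro exI[of _ "{}"]) auto
next
  case (insert e E)
  obtain B where B: "B \<subseteq> carrier V" "finite B" "card B \<le> card E"
    and s: "\<And>x. x \<in> carrier V \<Longrightarrow> \<exists>s\<in>lin_span K V B. \<forall>f\<in>E. f s = f x"
    using insert.IH insert.prems by auto
  have lin: "f (x \<oplus> c \<odot> y) = f x + c * f y" and fK: "f x \<in> K"
    if "f \<in> insert e E" "x \<in> carrier V" "y \<in> carrier V" "c \<in> K" for f x y c
    using insert.prems that by auto
  have sc: "lin_span K V B \<subseteq> carrier V" using B lin_span_carrier by blast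
  show ?case
  proof (cases "\<forall>r\<in>carrier V. (\<forall>f\<in>E. f r = 0) \<longrightarrow> e r = 0")
    case True
    have "\<exists>s\<in>lin_span K V B. \<forall>f\<in>insert e E. f s = f x" if x: "x \<in> carrier V" for x
    proof -
      obtain t where t: "t \<in> lin_span K V B" "\<forall>f\<in>E. f t = f x" using s[OF x] by blast
      have tc: "t \<in> carrier V" using t sc by auto
      have m: "f (x \<oplus> (-1) \<odot> t) = f x - f t" if "f \<in> insert e E" for f
        using lin[OF that x tc, of "-1"] by simp
      have "x \<oplus> (-1) \<odot> t \<in> carrier V" using x tc by simp
      moreover have "\<forall>f\<in>E. f (x \<oplus> (-1) \<odot> t) = 0"
        using m t(2) by (metis insertCI diff_self)
      ultimately have "e (x \<oplus> (-1) \<odot> t) = 0" using True by blast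
      then show ?thesis using t m[of e] by (intro bexI[of _ t]) auto
    qed
    then show ?thesis using B insert.hyps by (intro exI[of _ B]) (auto simp: card_insert_if)
  next
    case False
    then obtain r where r: "r \<in> carrier V" "\<forall>f\<in>E. f r = 0" "e r \<noteq> 0" by blast
    have "\<exists>s\<in>lin_span K V (insert r B). \<forall>f\<in>insert e E. f s = f x" if x: "x \<in> carrier V" for x
    proof -
      obtain t where t: "t \<in> lin_span K V B" "\<forall>f\<in>E. f t = f x" using s[OF x] by blast
      have tc: "t \<in> carrier V" using t sc by auto
      define c where "c = (e x - e t) / e r"
      have c: "c \<in> K" unfolding c_def using fK[OF insertI1] x tc r by blast
      have "f (t \<oplus> c \<odot> r) = f x" if f: "f \<in> insert e E" for f
      proof (cases "f = e")
        case True
        then show ?thesis using lin[OF f tc r(1) c] r(3) by (simp add: c_def)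
      next
        case False
        then show ?thesis using lin[OF f tc r(1) c] t(2) r(2) f by auto
      qed
      then have "\<forall>f\<in>insert e E. f (t \<oplus> c \<odot> r) = f x" by blast
      moreover have "t \<oplus> c \<odot> r \<in> lin_span K V (insert r B)"
        unfolding lin_span_insert[OF B(1) r(1)] using t c by blast
      ultimately show ?thesis by blast
    qed
    moreover have "card (insert r B) \<le> card (insert e E)"
      using B insert.hyps card_insert_le_m1 by (simp add: card_insert_if)
    ultimately show ?thesis using B r by (intro exI[of _ "insert r B"]) auto
  qed
qed

end

section \<open>Images, subspaces, products and quotients\<close>

text \<open>
  The axioms of a module are equations, so they pass to the image of any map that respects the
  operations, injective or not. This covers isometric copies as well as quotients.
\<close>

lemma kspace_surj_image:
  assumes V: "kspace K V"
    and im: "h ` carrier V = carrier W"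
    and add: "\<And>x y. x \<in> carrier V \<Longrightarrow> y \<in> carrier V \<Longrightarrow> h (x \<oplus>\<^bsub>V\<^esub> y) = h x \<oplus>\<^bsub>W\<^esub> h y"
    and smult: "\<And>c x. c \<in> K \<Longrightarrow> x \<in> carrier V \<Longrightarrow> h (c \<odot>\<^bsub>V\<^esub> x) = c \<odot>\<^bsub>W\<^esub> h x"
    and zero: "\<zero>\<^bsub>W\<^esub> = h \<zero>\<^bsub>V\<^esub>"
    and n1: "\<And>x. x \<in> carrier V \<Longrightarrow> 0 \<le> nrm W (h x)"
    and n2: "\<And>x. x \<in> carrier V \<Longrightarrow> nrm W (h x) = 0 \<Longrightarrow> h x = h \<zero>\<^bsub>V\<^esub>"
    and n3: "\<And>c x. c \<in> K \<Longrightarrow> x \<in> carrier V \<Longrightarrow> nrm W (h (c \<odot>\<^bsub>V\<^esub> x)) = cmod c * nrm W (h x)"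
    and n4: "\<And>x y. x \<in> carrier V \<Longrightarrow> y \<in> carrier V \<Longrightarrow> nrm W (h (x \<oplus>\<^bsub>V\<^esub> y)) \<le> nrm W (h x) + nrm W (h y)"
  shows "kspace K W"
proof -
  interpret V: kspace K V by fact
  have im': "\<exists>x\<in>carrier V. w = h x" if "w \<in> carrier W" for w
    using that unfolding im[symmetric] by auto
  have h: "h x \<in> carrier W" if "x \<in> carrier V" for x
    using that unfolding im[symmetric] by auto
  note [simp] = add[symmetric] smult[symmetric] zero h
  have grp: "abelian_group W"
  proof (rule abelian_groupI)
    fix x y assume "x \<in> carrier W" "y \<in> carrier W"
    then obtain a b where "x = h a" "y = h b" "a \<in> carrier V" "b \<in> carrier V" using im' by blast
    then show "x \<oplus>\<^bsub>W\<^esub> y \<in> carrier W" "x \<oplus>\<^bsub>W\<^esub> y = y \<oplus>\<^bsub>W\<^esub> x" by (simp_all add: V.M.a_comm)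
  next
    fix x y z assume "x \<in> carrier W" "y \<in> carrier W" "z \<in> carrier W"
    then obtain a b c where "x = h a" "y = h b" "z = h c" "a \<in> carrier V" "b \<in> carrier V" "c \<in> carrier V"
      using im' by meson
    then show "x \<oplus>\<^bsub>W\<^esub> y \<oplus>\<^bsub>W\<^esub> z = x \<oplus>\<^bsub>W\<^esub> (y \<oplus>\<^bsub>W\<^esub> z)" by (simp add: V.M.a_assoc)
  next
    fix x assume "x \<in> carrier W"
    then obtain a where a: "x = h a" "a \<in> carrier V" using im' by blast
    then show "\<zero>\<^bsub>W\<^esub> \<oplus>\<^bsub>W\<^esub> x = x" by simp
    have "h (\<ominus>\<^bsub>V\<^esub> a) \<oplus>\<^bsub>W\<^esub> x = \<zero>\<^bsub>W\<^esub>" using a by (simp add: V.M.l_neg)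
    then show "\<exists>y\<in>carrier W. y \<oplus>\<^bsub>W\<^esub> x = \<zero>\<^bsub>W\<^esub>" using a by (intro bexI[of _ "h (\<ominus>\<^bsub>V\<^esub> a)"]) auto
  qed simp
  have mod: "Module.module (scalar_ring K) W"
  proof (rule moduleI[OF cring_scalar_ring[OF V.scalars] grp])
    fix a x assume "a \<in> carrier (scalar_ring K)" "x \<in> carrier W"
    then obtain u where "x = h u" "u \<in> carrier V" "a \<in> K" using im' by auto
    then show "a \<odot>\<^bsub>W\<^esub> x \<in> carrier W" by simp
  next
    fix a b x assume "a \<in> carrier (scalar_ring K)" "b \<in> carrier (scalar_ring K)" "x \<in> carrier W"
    then obtain u where u: "x = h u" "u \<in> carrier V" "a \<in> K" "b \<in> K" using im' by auto
    then show "(a \<oplus>\<^bsub>scalar_ring K\<^esub> b) \<odot>\<^bsub>W\<^esub> x = a \<odot>\<^bsub>W\<^esub> x \<oplus>\<^bsub>W\<^esub> b \<odot>\<^bsub>W\<^esub> x"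
      using V.K_closed(6)[of a b] by (simp add: V.smult_add_left)
    from u show "(a \<otimes>\<^bsub>scalar_ring K\<^esub> b) \<odot>\<^bsub>W\<^esub> x = a \<odot>\<^bsub>W\<^esub> (b \<odot>\<^bsub>W\<^esub> x)"
      using V.K_closed(8)[of a b] by (simp add: V.smult_smult)
  next
    fix a x y assume "a \<in> carrier (scalar_ring K)" "x \<in> carrier W" "y \<in> carrier W"
    then obtain u v where "x = h u" "u \<in> carrier V" "y = h v" "v \<in> carrier V" "a \<in> K"
      using im' scalar_ring_simps by metis
    then show "a \<odot>\<^bsub>W\<^esub> (x \<oplus>\<^bsub>W\<^esub> y) = a \<odot>\<^bsub>W\<^esub> x \<oplus>\<^bsub>W\<^esub> a \<odot>\<^bsub>W\<^esub> y"
      by (simp add: V.smult_add_right)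
  next
    fix x assume "x \<in> carrier W"
    then obtain u where "x = h u" "u \<in> carrier V" using im' by blast
    then show "\<one>\<^bsub>scalar_ring K\<^esub> \<odot>\<^bsub>W\<^esub> x = x" by simp
  qed
  have "normed_space_axioms K W"
  proof
    fix x assume "x \<in> carrier W"
    then obtain u where u: "x = h u" "u \<in> carrier V" using im' by blast
    then show "0 \<le> nrm W x" using n1 by simp
    have "nrm W (h \<zero>\<^bsub>V\<^esub>) = 0" using n3[of 0 "\<zero>\<^bsub>V\<^esub>"] by simp
    then show "nrm W x = 0 \<longleftrightarrow> x = \<zero>\<^bsub>W\<^esub>" unfolding u(1) zero using n2[OF u(2)] by metis
  next
    fix c x assume "c \<in> K" "x \<in> carrier W"
    then obtain u where u: "x = h u" "u \<in> carrier V" "c \<in> K" using im' by blast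
    then show "nrm W (c \<odot>\<^bsub>W\<^esub> x) = cmod c * nrm W x" using n3[of c u] by simp
  next
    fix x y assume "x \<in> carrier W" "y \<in> carrier W"
    then obtain u v where u: "x = h u" "u \<in> carrier V" "y = h v" "v \<in> carrier V" using im' by metis
    then show "nrm W (x \<oplus>\<^bsub>W\<^esub> y) \<le> nrm W x + nrm W y" using n4[of u v] by simp
  qed
  then show ?thesis
    by (intro kspaceI V.scalars normed_space.intro mod)
qed

text \<open>
  The copy of \<open>V\<close> along an injection \<open>h\<close>; it places a space into the universe of test spaces.
\<close>

definition image_space :: "('a \<Rightarrow> 'b) \<Rightarrow> 'a nspace \<Rightarrow> 'b nspace" where
  "image_space h V = (let g = inv_into (carrier V) h in
     \<lparr>carrier = h ` carrier V, monoid.mult = undefined, one = undefined, zero = h \<zero>\<^bsub>V\<^esub>,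
      add = (\<lambda>a b. h (g a \<oplus>\<^bsub>V\<^esub> g b)), module.smult = (\<lambda>c a. h (c \<odot>\<^bsub>V\<^esub> g a)), nrm = (\<lambda>a. nrm V (g a))\<rparr>)"

lemma image_space_simps:
  assumes "inj_on h (carrier V)"
  shows "carrier (image_space h V) = h ` carrier V"
    and "zero (image_space h V) = h \<zero>\<^bsub>V\<^esub>"
    and "x \<in> carrier V \<Longrightarrow> y \<in> carrier V \<Longrightarrow> add (image_space h V) (h x) (h y) = h (x \<oplus>\<^bsub>V\<^esub> y)"
    and "x \<in> carrier V \<Longrightarrow> smult (image_space h V) c (h x) = h (c \<odot>\<^bsub>V\<^esub> x)"
    and "x \<in> carrier V \<Longrightarrow> nrm (image_space h V) (h x) = nrm V x"
  using assms by (simp_all add: image_space_def Let_def)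

lemma kspace_image_space:
  assumes "kspace K V" "inj_on h (carrier V)"
  shows "kspace K (image_space h V)"
proof -
  interpret V: kspace K V by fact
  note S = image_space_simps[OF assms(2)]
  show ?thesis
    by (rule kspace_surj_image[OF assms(1), of h])
      (simp_all add: S V.nrm_nonneg V.nrm_eq_0 V.nrm_smult V.nrm_triangle)
qed

lemma image_space_bounded_maps:
  assumes "kspace K V" "inj_on h (carrier V)"
  shows "bounded_map K V (image_space h V) h"
    and "bounded_map K (image_space h V) V (inv_into (carrier V) h)"
proof -
  interpret V: kspace K V by fact
  note S = image_space_simps[OF assms(2)]
  show "bounded_map K V (image_space h V) h"
    by (rule bounded_mapI[where C = 1]) (simp_all add: S)
  show "bounded_map K (image_space h V) V (inv_into (carrier V) h)"
    by (rule bounded_mapI[where C = 1]) (use assms(2) in \<open>auto simp: S\<close>)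
qed

text \<open>
  A linear map that is bounded below reflects Cauchy sequences, and a bounded one preserves limits.
\<close>

lemma complete_set_image:
  assumes V: "kspace K V" and W: "kspace K W" and j: "bounded_map K V W j"
    and a: "a > 0" "\<And>x. x \<in> carrier V \<Longrightarrow> a * nrm V x \<le> nrm W (j x)"
    and A: "kspace.complete_set V A" "A \<subseteq> carrier V"
  shows "kspace.complete_set W (j ` A)"
proof -
  interpret V: kspace K V by fact
  interpret W: kspace K W by fact
  show ?thesis
    unfolding W.complete_set_def
  proof (intro allI impI, elim conjE)
    fix \<sigma> :: "nat \<Rightarrow> 'b"
    assume s: "\<forall>n. \<sigma> n \<in> j ` A" and C: "\<forall>e>0. \<exists>N. \<forall>m\<ge>N. \<forall>n\<ge>N. nrm W (\<sigma> m \<ominus>\<^bsub>W\<^esub> \<sigma> n) < e"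
    from s have "\<forall>n. \<exists>x. x \<in> A \<and> \<sigma> n = j x" by auto
    then obtain \<tau> where t: "\<And>n. \<tau> n \<in> A" "\<And>n. \<sigma> n = j (\<tau> n)" by metis
    have tc: "\<tau> n \<in> carrier V" for n using t A by auto
    have "\<exists>N. \<forall>m\<ge>N. \<forall>n\<ge>N. nrm V (\<tau> m \<ominus>\<^bsub>V\<^esub> \<tau> n) < e" if e: "e > 0" for e
    proof -
      obtain N where N: "\<forall>m\<ge>N. \<forall>n\<ge>N. nrm W (\<sigma> m \<ominus>\<^bsub>W\<^esub> \<sigma> n) < a * e"
        using C e a by (meson mult_pos_pos)
      have "nrm V (\<tau> m \<ominus>\<^bsub>V\<^esub> \<tau> n) < e" if "m \<ge> N" "n \<ge> N" for m n
      proof -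
        have "a * nrm V (\<tau> m \<ominus>\<^bsub>V\<^esub> \<tau> n) < a * e"
          using a(2)[of "\<tau> m \<ominus>\<^bsub>V\<^esub> \<tau> n"] N that tc
          by (simp add: t(2) bounded_map_minus[OF V W j]) (meson le_less_trans)
        then show ?thesis using a(1) by simp
      qed
      then show ?thesis by blast
    qed
    then obtain x where x: "x \<in> A" "(\<lambda>n. nrm V (\<tau> n \<ominus>\<^bsub>V\<^esub> x)) \<longlonglongrightarrow> 0"
      using A(1) t(1) unfolding V.complete_set_def by blast
    have xc: "x \<in> carrier V" using x A by auto
    obtain C where C: "C > 0" "\<And>x. x \<in> carrier V \<Longrightarrow> nrm W (j x) \<le> C * nrm V x"
      using bounded_map_bound[OF V j] by blast
    have "(\<lambda>n. nrm W (\<sigma> n \<ominus>\<^bsub>W\<^esub> j x)) \<longlonglongrightarrow> 0"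
    proof (rule real_tendsto_sandwich[OF _ _ tendsto_const])
      show "\<forall>\<^sub>F n in sequentially. 0 \<le> nrm W (\<sigma> n \<ominus>\<^bsub>W\<^esub> j x)"
        using W.nrm_nonneg t tc xc bounded_mapD(1)[OF j] by simp
      show "\<forall>\<^sub>F n in sequentially. nrm W (\<sigma> n \<ominus>\<^bsub>W\<^esub> j x) \<le> C * nrm V (\<tau> n \<ominus>\<^bsub>V\<^esub> x)"
        using C(2)[OF V.M.minus_closed[OF tc xc]] t tc xc
        by (simp add: bounded_map_minus[OF V W j])
      show "(\<lambda>n. C * nrm V (\<tau> n \<ominus>\<^bsub>V\<^esub> x)) \<longlonglongrightarrow> 0"
        using tendsto_mult_right_zero[OF x(2), of C] by simp
    qed
    then show "\<exists>x\<in>j ` A. (\<lambda>n. nrm W (\<sigma> n \<ominus>\<^bsub>W\<^esub> x)) \<longlonglongrightarrow> 0" using x by blast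
  qed
qed

lemma banach_image_space:
  assumes "kspace K V" "inj_on h (carrier V)" "banach_space K V"
  shows "banach_space K (image_space h V)"
proof -
  note S = image_space_simps[OF assms(2)]
  have "kspace.complete_set (image_space h V) (h ` carrier V)"
    by (rule complete_set_image[OF assms(1) kspace_image_space[OF assms(1,2)]
          image_space_bounded_maps(1)[OF assms(1,2)], of 1])
       (use assms(3) in \<open>simp_all add: S banach_space_iff[OF assms(1)]\<close>)
  then show ?thesis
    by (simp add: banach_space_iff[OF kspace_image_space[OF assms(1,2)]] S)
qed

lemma kspace_subspace:
  assumes "kspace K V" "submodule H (scalar_ring K) V"
  shows "kspace K (V\<lparr>carrier := H\<rparr>)"
proof -
  interpret V: kspace K V by fact
  note H = V.submodD[OF assms(2)]
  have "Module.module (scalar_ring K) (V\<lparr>carrier := H\<rparr>)"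
    by (rule submodule.submodule_is_module[OF assms(2) V.module_axioms])
  moreover have "normed_space_axioms K (V\<lparr>carrier := H\<rparr>)"
    by standard (use H(5) in \<open>auto simp: V.nrm_nonneg V.nrm_eq_0 V.nrm_smult V.nrm_triangle\<close>)
  ultimately show ?thesis
    by (intro kspaceI V.scalars normed_space.intro)
qed

lemma subspace_minus:
  assumes "kspace K V" "submodule H (scalar_ring K) V" "x \<in> H" "y \<in> H"
  shows "x \<ominus>\<^bsub>V\<lparr>carrier := H\<rparr>\<^esub> y = x \<ominus>\<^bsub>V\<^esub> y"
proof -
  interpret V: kspace K V by fact
  interpret H: kspace K "V\<lparr>carrier := H\<rparr>" by (rule kspace_subspace[OF assms(1,2)])
  show ?thesis
    using assms(3,4) V.submodD(5)[OF assms(2)] H.minus_eq'[of x y] V.minus_eq'[of x y] by simp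
qed

lemma banach_subspace:
  assumes "kspace K V" "submodule H (scalar_ring K) V" "kspace.complete_set V H"
  shows "banach_space K (V\<lparr>carrier := H\<rparr>)"
proof -
  interpret V: kspace K V by fact
  interpret H: kspace K "V\<lparr>carrier := H\<rparr>" by (rule kspace_subspace[OF assms(1,2)])
  note [simp] = subspace_minus[OF assms(1,2)]
  show ?thesis
    unfolding banach_space_iff[OF H.kspace_axioms] H.complete_set_def
  proof (intro allI impI, elim conjE)
    fix \<sigma> :: "nat \<Rightarrow> 'a"
    assume s: "\<forall>n. \<sigma> n \<in> carrier (V\<lparr>carrier := H\<rparr>)"
      and C: "\<forall>e>0. \<exists>N. \<forall>m\<ge>N. \<forall>n\<ge>N.
        nrm (V\<lparr>carrier := H\<rparr>) (\<sigma> m \<ominus>\<^bsub>V\<lparr>carrier := H\<rparr>\<^esub> \<sigma> n) < e"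
    from s have s': "\<And>n. \<sigma> n \<in> H" by simp
    have "\<forall>e>0. \<exists>N. \<forall>m\<ge>N. \<forall>n\<ge>N. nrm V (\<sigma> m \<ominus>\<^bsub>V\<^esub> \<sigma> n) < e"
      using C by (simp add: s')
    then obtain x where "x \<in> H" "(\<lambda>n. nrm V (\<sigma> n \<ominus>\<^bsub>V\<^esub> x)) \<longlonglongrightarrow> 0"
      using assms(3) s' unfolding V.complete_set_def by blast
    then show "\<exists>x\<in>carrier (V\<lparr>carrier := H\<rparr>).
        (\<lambda>n. nrm (V\<lparr>carrier := H\<rparr>) (\<sigma> n \<ominus>\<^bsub>V\<lparr>carrier := H\<rparr>\<^esub> x)) \<longlonglongrightarrow> 0"
      by (intro bexI[of _ x]) (simp_all add: s')
  qed
qed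

text \<open>
  The weight \<open>r\<close> of the first factor is small for the pullback, where that factor should not spoil
  the norm of the lifting. For the pushout it is the norm that the extension is allowed to have.
\<close>

definition prod_space :: "real \<Rightarrow> 'a nspace \<Rightarrow> 'b nspace \<Rightarrow> ('a \<times> 'b) nspace" where
  "prod_space r X Y = \<lparr>carrier = carrier X \<times> carrier Y, monoid.mult = undefined, one = undefined,
     zero = (\<zero>\<^bsub>X\<^esub>, \<zero>\<^bsub>Y\<^esub>), add = (\<lambda>a b. (fst a \<oplus>\<^bsub>X\<^esub> fst b, snd a \<oplus>\<^bsub>Y\<^esub> snd b)),
     module.smult = (\<lambda>c a. (c \<odot>\<^bsub>X\<^esub> fst a, c \<odot>\<^bsub>Y\<^esub> snd a)), nrm = (\<lambda>a. r * nrm X (fst a) + nrm Y (snd a))\<rparr>"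

lemma prod_space_simps [simp]:
  "carrier (prod_space r X Y) = carrier X \<times> carrier Y"
  "zero (prod_space r X Y) = (\<zero>\<^bsub>X\<^esub>, \<zero>\<^bsub>Y\<^esub>)"
  "add (prod_space r X Y) a b = (fst a \<oplus>\<^bsub>X\<^esub> fst b, snd a \<oplus>\<^bsub>Y\<^esub> snd b)"
  "smult (prod_space r X Y) c a = (c \<odot>\<^bsub>X\<^esub> fst a, c \<odot>\<^bsub>Y\<^esub> snd a)"
  "nrm (prod_space r X Y) a = r * nrm X (fst a) + nrm Y (snd a)"
  by (simp_all add: prod_space_def)

lemma kspace_prod_space:
  assumes "kspace K X" "kspace K Y" "r > 0"
  shows "kspace K (prod_space r X Y)"
proof -
  interpret X: kspace K X by fact
  interpret Y: kspace K Y by fact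
  have "Module.module (scalar_ring K) (prod_space r X Y)"
  proof (rule moduleI[OF cring_scalar_ring[OF X.scalars]])
    show "abelian_group (prod_space r X Y)"
    proof (rule abelian_groupI)
      fix x assume "x \<in> carrier (prod_space r X Y)"
      then show "\<exists>y\<in>carrier (prod_space r X Y). y \<oplus>\<^bsub>prod_space r X Y\<^esub> x = \<zero>\<^bsub>prod_space r X Y\<^esub>"
        by (intro bexI[of _ "(\<ominus>\<^bsub>X\<^esub> fst x, \<ominus>\<^bsub>Y\<^esub> snd x)"]) (auto simp: X.M.l_neg Y.M.l_neg)
    qed (auto simp: X.M.a_ac Y.M.a_ac)
  qed (auto simp: X.smult_add_left Y.smult_add_left X.smult_add_right Y.smult_add_right
         X.smult_smult Y.smult_smult)
  moreover have "normed_space_axioms K (prod_space r X Y)"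
  proof
    fix x assume x: "x \<in> carrier (prod_space r X Y)"
    then have p: "nrm X (fst x) \<ge> 0" "nrm Y (snd x) \<ge> 0" using X.nrm_nonneg Y.nrm_nonneg by auto
    then show "0 \<le> nrm (prod_space r X Y) x" using assms by simp
    have "nrm (prod_space r X Y) x = 0 \<longleftrightarrow> nrm X (fst x) = 0 \<and> nrm Y (snd x) = 0"
      using p assms(3) by (simp add: add_nonneg_eq_0_iff)
    then show "nrm (prod_space r X Y) x = 0 \<longleftrightarrow> x = \<zero>\<^bsub>prod_space r X Y\<^esub>"
      using X.nrm_eq_0[of "fst x"] Y.nrm_eq_0[of "snd x"] x by (auto simp: prod_eq_iff)
  next
    fix c x assume "c \<in> K" "x \<in> carrier (prod_space r X Y)"
    then show "nrm (prod_space r X Y) (c \<odot>\<^bsub>prod_space r X Y\<^esub> x) = cmod c * nrm (prod_space r X Y) x"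
      by (auto simp: X.nrm_smult Y.nrm_smult algebra_simps)
  next
    fix x y assume xy: "x \<in> carrier (prod_space r X Y)" "y \<in> carrier (prod_space r X Y)"
    have "r * nrm X (fst x \<oplus>\<^bsub>X\<^esub> fst y) \<le> r * (nrm X (fst x) + nrm X (fst y))"
      using X.nrm_triangle[of "fst x" "fst y"] xy assms(3) by auto
    then show "nrm (prod_space r X Y) (x \<oplus>\<^bsub>prod_space r X Y\<^esub> y)
        \<le> nrm (prod_space r X Y) x + nrm (prod_space r X Y) y"
      using Y.nrm_triangle[of "snd x" "snd y"] xy by (auto simp: algebra_simps)
  qed
  ultimately show ?thesis by (intro kspaceI X.scalars normed_space.intro)
qed

lemma prod_space_minus:
  assumes "kspace K X" "kspace K Y" "r > 0"
    "a \<in> carrier X \<times> carrier Y" "b \<in> carrier X \<times> carrier Y"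
  shows "a \<ominus>\<^bsub>prod_space r X Y\<^esub> b = (fst a \<ominus>\<^bsub>X\<^esub> fst b, snd a \<ominus>\<^bsub>Y\<^esub> snd b)"
proof -
  interpret X: kspace K X by fact
  interpret Y: kspace K Y by fact
  interpret P: kspace K "prod_space r X Y" by (rule kspace_prod_space[OF assms(1-3)])
  show ?thesis using assms(4,5) P.minus_eq'[of a b]
    by (auto simp: X.minus_eq' Y.minus_eq')
qed

lemma prod_space_bounded_maps:
  assumes "kspace K X" "kspace K Y" "r > 0"
  shows "bounded_map K (prod_space r X Y) X fst" "bounded_map K (prod_space r X Y) Y snd"
    "bounded_map K X (prod_space r X Y) (\<lambda>x. (x, \<zero>\<^bsub>Y\<^esub>))"
    "bounded_map K Y (prod_space r X Y) (\<lambda>y. (\<zero>\<^bsub>X\<^esub>, y))"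
proof -
  interpret X: kspace K X by fact
  interpret Y: kspace K Y by fact
  show "bounded_map K (prod_space r X Y) X fst"
    using assms(3) by (intro bounded_mapI[where C = "1 / r"]) (auto simp: field_simps Y.nrm_nonneg)
  show "bounded_map K (prod_space r X Y) Y snd"
    using assms(3) by (intro bounded_mapI[where C = 1]) (auto simp: X.nrm_nonneg)
  show "bounded_map K X (prod_space r X Y) (\<lambda>x. (x, \<zero>\<^bsub>Y\<^esub>))"
    by (intro bounded_mapI[where C = r]) auto
  show "bounded_map K Y (prod_space r X Y) (\<lambda>y. (\<zero>\<^bsub>X\<^esub>, y))"
    by (intro bounded_mapI[where C = 1]) auto
qed

text \<open>
  The quotient norm of the coset of \<open>x\<close> is the distance of \<open>x\<close> from \<open>F\<close>. In
  \<open>kspace_quotient\<close> the subspace has to be closed, since otherwise nonzero cosets can have norm \<open>0\<close>.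
\<close>

lemma quotient_space_simps:
  "carrier (quotient_space V F) = a_rcosets\<^bsub>V\<^esub> F"
  "zero (quotient_space V F) = F"
  "add (quotient_space V F) = set_add V"
  "smult (quotient_space V F) c A = (\<Union>a\<in>A. F +>\<^bsub>V\<^esub> (c \<odot>\<^bsub>V\<^esub> a))"
  "nrm (quotient_space V F) A = (INF a\<in>A. nrm V a)"
  by (simp_all add: quotient_space_def)

context kspace
begin

lemma submodule_abelian_subgroup:
  "submodule F (scalar_ring K) V \<Longrightarrow> abelian_subgroup F V"
  by (intro abelian_subgroupI3 additive_subgroupI M.abelian_group_axioms submodule.axioms(1))

lemma coset_carrier: "carrier (quotient_space V F) = (\<lambda>x. F +> x) ` carrier V"
  by (auto simp: quotient_space_simps A_RCOSETS_def')

lemma coset_mem: "F +> x = {f \<oplus> x | f. f \<in> F}"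
  by (auto simp: a_r_coset_def')

lemma coset_self: "submodule F (scalar_ring K) V \<Longrightarrow> x \<in> carrier V \<Longrightarrow> x \<in> F +> x"
  using submodD(2)[of F] M.l_zero[of x] unfolding coset_mem by force

lemma coset_add:
  assumes "submodule F (scalar_ring K) V" "x \<in> carrier V" "y \<in> carrier V"
  shows "set_add V (F +> x) (F +> y) = F +> (x \<oplus> y)"
  by (rule abelian_subgroup.a_rcos_sum[OF submodule_abelian_subgroup[OF assms(1)] assms(2,3)])

lemma coset_eq_iff:
  assumes F: "submodule F (scalar_ring K) V" and "x \<in> carrier V" "y \<in> carrier V"
  shows "F +> x = F +> y \<longleftrightarrow> x \<ominus> y \<in> F"
proof
  interpret F: abelian_subgroup F V by (rule submodule_abelian_subgroup[OF F])
  note FD = submodD[OF F]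
  {
    assume "F +> x = F +> y"
    then have "x \<in> F +> y" using coset_self[OF F assms(2)] by simp
    then obtain f where "f \<in> F" "x = f \<oplus> y" unfolding coset_mem by blast
    then show "x \<ominus> y \<in> F" using FD(5) assms(3) by simp
  next
    assume "x \<ominus> y \<in> F"
    then have "x \<in> F +> y" unfolding coset_mem using assms(2,3) by (intro CollectI exI[of _ "x \<ominus> y"]) simp
    then show "F +> x = F +> y"
      using a_repr_independence[of x F y] assms(3) submodule.axioms(1)[OF F] by simp
  }
qed

lemma coset_smult:
  assumes F: "submodule F (scalar_ring K) V" and "c \<in> K" "x \<in> carrier V"
  shows "(\<Union>a\<in>F +> x. F +> (c \<odot> a)) = F +> (c \<odot> x)"
proof -
  note FD = submodD[OF F]
  have "F +> (c \<odot> a) = F +> (c \<odot> x)" if a: "a \<in> F +> x" for a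
  proof -
    obtain f where f: "f \<in> F" "a = f \<oplus> x" using a unfolding coset_mem by blast
    then have "c \<odot> a \<ominus> c \<odot> x = c \<odot> f" using FD(5) assms by (simp add: smult_add_right)
    then show ?thesis using coset_eq_iff[OF F, of "c \<odot> a" "c \<odot> x"] FD(4,5) f assms by simp
  qed
  then show ?thesis using coset_self[OF F assms(3)] by blast
qed

lemma quotient_norm_le:
  assumes F: "submodule F (scalar_ring K) V" and "x \<in> carrier V" "f \<in> F"
  shows "nrm (quotient_space V F) (F +> x) \<le> nrm V (x \<ominus> f)"
proof -
  note FD = submodD[OF F]
  have "x \<ominus> f \<in> F +> x"
    unfolding coset_mem using FD(4)[OF K_closed(4)[OF K_closed(2)] assms(3)] assms FD(5)
    by (auto intro!: exI[of _ "(-1) \<odot> f"] simp: minus_eq' M.a_comm)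
  then show ?thesis
    unfolding quotient_space_simps
    using FD(5) assms by (intro cINF_lower) (auto intro!: bdd_belowI[of _ 0] nrm_nonneg simp: coset_mem)
qed

lemma quotient_norm_ge:
  assumes F: "submodule F (scalar_ring K) V" and "x \<in> carrier V" "\<And>f. f \<in> F \<Longrightarrow> r \<le> nrm V (x \<ominus> f)"
  shows "r \<le> nrm (quotient_space V F) (F +> x)"
  unfolding quotient_space_simps
proof (rule cINF_greatest)
  note FD = submodD[OF F]
  show "F +> x \<noteq> {}" using coset_self[OF F assms(2)] by blast
  fix a assume "a \<in> F +> x"
  then obtain f where f: "f \<in> F" "a = f \<oplus> x" unfolding coset_mem by blast
  then have "a = x \<ominus> (-1) \<odot> f" using FD(5) assms by (simp add: minus_eq' M.a_comm smult_smult)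
  then show "r \<le> nrm V a" using assms(3) FD(4) f by simp
qed

lemma quotient_norm_less:
  assumes F: "submodule F (scalar_ring K) V" and "x \<in> carrier V"
    and "nrm (quotient_space V F) (F +> x) < r"
  shows "\<exists>f\<in>F. nrm V (x \<ominus> f) < r"
proof (rule ccontr)
  assume "\<not> ?thesis"
  then have "r \<le> nrm (quotient_space V F) (F +> x)"
    by (intro quotient_norm_ge[OF assms(1,2)]) auto
  then show False using assms(3) by simp
qed

lemma quotient_norm_nonneg:
  assumes F: "submodule F (scalar_ring K) V" and "x \<in> carrier V"
  shows "0 \<le> nrm (quotient_space V F) (F +> x)"
  using submodD(5)[OF F] assms(2) by (intro quotient_norm_ge[OF F] nrm_nonneg) auto

lemma kspace_quotient:
  assumes "closed_subspace K V F"
  shows "kspace K (quotient_space V F)"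
proof -
  have F: "submodule F (scalar_ring K) V" and cl: "closedin (ntop V) F"
    using assms by (auto simp: closed_subspace_def)
  note FD = submodD[OF F]
  let ?Q = "quotient_space V F"
  have smult_le: "nrm ?Q (F +> (c \<odot> x)) \<le> cmod c * nrm ?Q (F +> x)"
    if c: "c \<in> K" "c \<noteq> 0" and x: "x \<in> carrier V" for c x
  proof -
    have "nrm ?Q (F +> (c \<odot> x)) / cmod c \<le> nrm V (x \<ominus> f)" if f: "f \<in> F" for f
    proof -
      have "nrm ?Q (F +> (c \<odot> x)) \<le> nrm V (c \<odot> x \<ominus> c \<odot> f)"
        using FD(4)[OF c(1) f] c x by (intro quotient_norm_le[OF F]) auto
      also have "\<dots> = cmod c * nrm V (x \<ominus> f)"
        using c x FD(5)[OF f] by (simp flip: smult_minus add: nrm_smult)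
      finally show ?thesis using c by (simp add: field_simps)
    qed
    then have "nrm ?Q (F +> (c \<odot> x)) / cmod c \<le> nrm ?Q (F +> x)"
      by (rule quotient_norm_ge[OF F x])
    then show ?thesis using c by (simp add: field_simps)
  qed
  show ?thesis
  proof (rule kspace_surj_image[OF kspace_axioms, of "\<lambda>x. F +> x"])
    show "(\<lambda>x. F +> x) ` carrier V = carrier ?Q" by (simp add: coset_carrier)
    show "\<zero>\<^bsub>?Q\<^esub> = F +> \<zero>"
      using FD(1) by (simp add: quotient_space_simps)
  next
    fix x assume x: "x \<in> carrier V"
    show "0 \<le> nrm ?Q (F +> x)" by (rule quotient_norm_nonneg[OF F x])
    assume "nrm ?Q (F +> x) = 0"
    then have "\<forall>e>0. \<exists>f\<in>F. nrm V (x \<ominus> f) < e" using quotient_norm_less[OF F x] by simp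
    then have "x \<in> F" using cl x unfolding closedin_ntop_iff by blast
    then show "F +> x = F +> \<zero>" using coset_eq_iff[OF F x] x by simp
  next
    fix c x assume c: "c \<in> K" and x: "x \<in> carrier V"
    show "F +> (c \<odot> x) = c \<odot>\<^bsub>?Q\<^esub> (F +> x)"
      using coset_smult[OF F c x] by (simp add: quotient_space_simps)
    show "nrm ?Q (F +> (c \<odot> x)) = cmod c * nrm ?Q (F +> x)"
    proof (cases "c = 0")
      case True
      then show ?thesis
        using quotient_norm_le[OF F M.zero_closed FD(2)] quotient_norm_nonneg[OF F M.zero_closed] x by simp
    next
      case False
      have "nrm ?Q (F +> (inverse c \<odot> (c \<odot> x))) \<le> cmod (inverse c) * nrm ?Q (F +> (c \<odot> x))"
        using False c x by (intro smult_le) auto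
      then have "cmod c * nrm ?Q (F +> x) \<le> nrm ?Q (F +> (c \<odot> x))"
        using False c x by (simp add: smult_smult norm_inverse norm_divide field_simps)
      with smult_le[OF c False x] show ?thesis by simp
    qed
  next
    fix x y assume x: "x \<in> carrier V" and y: "y \<in> carrier V"
    show "F +> (x \<oplus> y) = (F +> x) \<oplus>\<^bsub>?Q\<^esub> (F +> y)"
      using coset_add[OF F x y] by (simp add: quotient_space_simps)
    have *: "nrm ?Q (F +> (x \<oplus> y)) \<le> nrm V (x \<ominus> f) + nrm V (y \<ominus> g)" if "f \<in> F" "g \<in> F" for f g
    proof -
      have "nrm ?Q (F +> (x \<oplus> y)) \<le> nrm V ((x \<oplus> y) \<ominus> (f \<oplus> g))"
        using x y FD(3)[OF that] by (intro quotient_norm_le[OF F]) auto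
      also have "\<dots> \<le> nrm V (x \<ominus> f) + nrm V (y \<ominus> g)"
        using x y that FD(5) by (simp add: add_minus_add nrm_triangle)
      finally show ?thesis .
    qed
    have "nrm ?Q (F +> (x \<oplus> y)) - nrm V (x \<ominus> f) \<le> nrm ?Q (F +> y)" if "f \<in> F" for f
      using *[OF that] by (intro quotient_norm_ge[OF F y]) (simp add: algebra_simps)
    then have "nrm ?Q (F +> (x \<oplus> y)) - nrm ?Q (F +> y) \<le> nrm ?Q (F +> x)"
      by (intro quotient_norm_ge[OF F x]) (simp add: algebra_simps)
    then show "nrm ?Q (F +> (x \<oplus> y)) \<le> nrm ?Q (F +> x) + nrm ?Q (F +> y)" by simp
  qed
qed

lemma bounded_map_quotient:
  assumes F: "submodule F (scalar_ring K) V"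
  shows "bounded_map K V (quotient_space V F) (\<lambda>x. F +> x)"
proof (rule bounded_mapI[where C = 1])
  fix x assume x: "x \<in> carrier V"
  show "F +> x \<in> carrier (quotient_space V F)" using x by (simp add: coset_carrier)
  show "nrm (quotient_space V F) (F +> x) \<le> 1 * nrm V x"
    using quotient_norm_le[OF F x submodD(2)[OF F]] x by simp
qed (use coset_add[OF F] coset_smult[OF F] in \<open>auto simp: quotient_space_simps\<close>)

end

section \<open>Finite-dimensional extensions of Banach spaces\<close>

text \<open>
  If \<open>b\<close> lies outside the closed subspace \<open>W\<close>, its distance \<open>e\<close> from \<open>W\<close> is positive, and
  \<open>|c| e \<le> \<parallel>w + c b\<parallel>\<close>. Hence in a Cauchy sequence of vectors \<open>w + c b\<close> the coefficients \<open>c\<close>, and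
  consequently the vectors \<open>w\<close>, form Cauchy sequences of their own.
\<close>

lemma (in kspace) complete_set_add_line:
  assumes W: "submodule W (scalar_ring K) V" and cW: "complete_set W" and b: "b \<in> carrier V"
  shows "complete_set {w \<oplus> c \<odot> b |w c. w \<in> W \<and> c \<in> K}" (is "complete_set ?L")
proof (cases "b \<in> W")
  case True
  note WD = submodD[OF W]
  have "?L = W"
  proof
    show "?L \<subseteq> W" using WD(3,4) True by blast
    have "w = w \<oplus> 0 \<odot> b" if "w \<in> W" for w using WD(5)[OF that] b by simp
    then show "W \<subseteq> ?L" using K_closed(1) by blast
  qed
  then show ?thesis using cW by simp
next
  case False
  note WD = submodD[OF W]
  have "\<not> (\<forall>e>0. \<exists>f\<in>W. nrm V (b \<ominus> f) < e)"
    using complete_set_closed[OF cW WD(1)] False b unfolding closedin_ntop_iff by blast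
  then obtain e where e: "e > 0" "\<And>f. f \<in> W \<Longrightarrow> e \<le> nrm V (b \<ominus> f)" by (meson not_le)
  have low: "cmod c * e \<le> nrm V (w \<oplus> c \<odot> b)" if w: "w \<in> W" and c: "c \<in> K" for w c
  proof (cases "c = 0")
    case True
    then show ?thesis using WD(5)[OF w] b nrm_nonneg by simp
  next
    case nz: False
    have i: "- inverse c \<in> K" using c by blast
    have "c \<odot> (b \<ominus> (- inverse c) \<odot> w) = c \<odot> b \<oplus> w"
      using nz c i b WD(5)[OF w] by (simp add: minus_eq' smult_add_right smult_smult)
    then have "nrm V (w \<oplus> c \<odot> b) = cmod c * nrm V (b \<ominus> (- inverse c) \<odot> w)"
      using nrm_smult[OF c, of "b \<ominus> (- inverse c) \<odot> w"] b c i WD(5)[OF w] by (simp add: M.a_comm)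
    then show ?thesis using e(2)[OF WD(4)[OF i w]] by (simp add: mult_left_mono)
  qed
  show ?thesis
    unfolding complete_set_def
  proof (intro allI impI, elim conjE)
    fix \<sigma> :: "nat \<Rightarrow> 'a"
    assume s: "\<forall>n. \<sigma> n \<in> ?L" and C: "\<forall>e>0. \<exists>N. \<forall>m\<ge>N. \<forall>n\<ge>N. nrm V (\<sigma> m \<ominus> \<sigma> n) < e"
    from s have "\<forall>n. \<exists>p. fst p \<in> W \<and> snd p \<in> K \<and> \<sigma> n = fst p \<oplus> snd p \<odot> b" by fastforce
    then obtain p where p: "\<And>n. fst (p n) \<in> W" "\<And>n. snd (p n) \<in> K" "\<And>n. \<sigma> n = fst (p n) \<oplus> snd (p n) \<odot> b"
      by metis
    define w where "w n = fst (p n)" for n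
    define c where "c n = snd (p n)" for n
    have w: "w n \<in> W" "w n \<in> carrier V" and c: "c n \<in> K" and sw: "\<sigma> n = w n \<oplus> c n \<odot> b" for n
      using p WD(5) by (auto simp: w_def c_def)
    have scb: "c m \<odot> b \<ominus> c n \<odot> b = (c m - c n) \<odot> b" for m n
      using c b smult_add_left[of "c m" "- c n" b] by (simp add: minus_eq' smult_smult)
    have diff: "\<sigma> m \<ominus> \<sigma> n = (w m \<ominus> w n) \<oplus> (c m - c n) \<odot> b" for m n
      unfolding sw scb[symmetric] using w c b by (simp add: add_minus_add)
    have cd: "cmod (c m - c n) * e \<le> nrm V (\<sigma> m \<ominus> \<sigma> n)" for m n
      unfolding diff using w c by (intro low submod_minus[OF W]) auto
    have "Cauchy c"
      unfolding Cauchy_def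
    proof (intro allI impI)
      fix d :: real assume "d > 0"
      then obtain N where N: "\<forall>m\<ge>N. \<forall>n\<ge>N. nrm V (\<sigma> m \<ominus> \<sigma> n) < d * e" using C e by (meson mult_pos_pos)
      have "dist (c m) (c n) < d" if "m \<ge> N" "n \<ge> N" for m n
      proof -
        have "cmod (c m - c n) * e < d * e" using cd[of m n] N that by (meson le_less_trans)
        then show ?thesis using e by (simp add: dist_norm)
      qed
      then show "\<exists>N. \<forall>m\<ge>N. \<forall>n\<ge>N. dist (c m) (c n) < d" by blast
    qed
    then obtain l where l: "c \<longlonglongrightarrow> l" using Cauchy_convergent convergent_def by blast
    have lK: "l \<in> K" using K_limit c l by blast
    have wd: "nrm V (w m \<ominus> w n) \<le> (1 + nrm V b / e) * nrm V (\<sigma> m \<ominus> \<sigma> n)" for m n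
    proof -
      have "w m \<ominus> w n = (\<sigma> m \<ominus> \<sigma> n) \<ominus> (c m - c n) \<odot> b"
        unfolding diff using w c b by simp
      then have "nrm V (w m \<ominus> w n) \<le> nrm V (\<sigma> m \<ominus> \<sigma> n) + cmod (c m - c n) * nrm V b"
        using nrm_minus_le[of "\<sigma> m \<ominus> \<sigma> n" "(c m - c n) \<odot> b"] w c b sw by (simp add: nrm_smult)
      also have "cmod (c m - c n) * nrm V b \<le> (nrm V (\<sigma> m \<ominus> \<sigma> n) / e) * nrm V b"
        using cd[of m n] e(1) nrm_nonneg[OF b] by (intro mult_right_mono) (auto simp: field_simps)
      finally show ?thesis by (simp add: algebra_simps)
    qed
    define Q where "Q = 1 + nrm V b / e"
    have Q: "Q > 0" using e(1) nrm_nonneg[OF b] by (simp add: Q_def add_pos_nonneg)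
    have "\<exists>N. \<forall>m\<ge>N. \<forall>n\<ge>N. nrm V (w m \<ominus> w n) < d" if d: "d > 0" for d
    proof -
      obtain N where N: "\<forall>m\<ge>N. \<forall>n\<ge>N. nrm V (\<sigma> m \<ominus> \<sigma> n) < d / Q" using C d Q by (meson divide_pos_pos)
      have "nrm V (w m \<ominus> w n) < d" if "m \<ge> N" "n \<ge> N" for m n
      proof -
        have "nrm V (w m \<ominus> w n) \<le> Q * nrm V (\<sigma> m \<ominus> \<sigma> n)" unfolding Q_def by (rule wd)
        also have "\<dots> < Q * (d / Q)" using N that Q by (intro mult_strict_left_mono) auto
        finally show ?thesis using Q by simp
      qed
      then show ?thesis by blast
    qed
    then obtain x where x: "x \<in> W" "(\<lambda>n. nrm V (w n \<ominus> x)) \<longlonglongrightarrow> 0"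
      using cW w(1) unfolding complete_set_def by blast
    have xc: "x \<in> carrier V" using x WD(5) by simp
    have "(\<lambda>n. nrm V (\<sigma> n \<ominus> (x \<oplus> l \<odot> b))) \<longlonglongrightarrow> 0"
    proof (rule real_tendsto_sandwich[OF _ _ tendsto_const])
      show "\<forall>\<^sub>F n in sequentially. 0 \<le> nrm V (\<sigma> n \<ominus> (x \<oplus> l \<odot> b))"
        using w c b xc lK sw by (auto intro!: always_eventually nrm_nonneg)
      have "nrm V (\<sigma> n \<ominus> (x \<oplus> l \<odot> b)) \<le> nrm V (w n \<ominus> x) + cmod (c n - l) * nrm V b" for n
      proof -
        have "c n \<odot> b \<ominus> l \<odot> b = (c n - l) \<odot> b"
          using c b lK smult_add_left[of "c n" "- l" b] by (simp add: minus_eq' smult_smult)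
        then have "\<sigma> n \<ominus> (x \<oplus> l \<odot> b) = (w n \<ominus> x) \<oplus> (c n - l) \<odot> b"
          unfolding sw using w c b xc lK by (simp add: add_minus_add)
        then show ?thesis
          using nrm_triangle[of "w n \<ominus> x" "(c n - l) \<odot> b"] w c b xc lK by (simp add: nrm_smult)
      qed
      then show "\<forall>\<^sub>F n in sequentially. nrm V (\<sigma> n \<ominus> (x \<oplus> l \<odot> b))
          \<le> nrm V (w n \<ominus> x) + cmod (c n - l) * nrm V b" by simp
      have "(\<lambda>n. cmod (c n - l)) \<longlonglongrightarrow> 0" using l by (simp add: LIM_zero_iff tendsto_norm_zero_iff)
      then show "(\<lambda>n. nrm V (w n \<ominus> x) + cmod (c n - l) * nrm V b) \<longlonglongrightarrow> 0"
        using tendsto_add[OF x(2) tendsto_mult_left_zero] by fastforce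
    qed
    then show "\<exists>x\<in>?L. (\<lambda>n. nrm V (\<sigma> n \<ominus> x)) \<longlonglongrightarrow> 0" using x(1) lK by blast
  qed
qed

lemma image_submodule:
  assumes "kspace K W" "kspace K V" "bounded_map K W V j" "submodule H (scalar_ring K) W"
  shows "submodule (j ` H) (scalar_ring K) V"
proof -
  interpret W: kspace K W by fact
  interpret V: kspace K V by fact
  note j = bounded_mapD[OF assms(3)] and H = W.submodD[OF assms(4)]
  show ?thesis
    unfolding V.submod_iff
  proof (intro conjI ballI)
    show "\<zero>\<^bsub>V\<^esub> \<in> j ` H" using bounded_map_zero[OF assms(1-3)] H(2) by force
    show "x \<oplus>\<^bsub>V\<^esub> y \<in> j ` H" if xy: "x \<in> j ` H" "y \<in> j ` H" for x y
    proof -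
      obtain u v where "u \<in> H" "v \<in> H" "x = j u" "y = j v" using xy by blast
      then show ?thesis using j(2)[of u v] H(3,5) by (intro image_eqI[of _ _ "u \<oplus>\<^bsub>W\<^esub> v"]) auto
    qed
    show "c \<odot>\<^bsub>V\<^esub> x \<in> j ` H" if cx: "c \<in> K" "x \<in> j ` H" for c x
    proof -
      obtain u where "u \<in> H" "x = j u" using cx by blast
      then show ?thesis using j(3)[of c u] cx H(4,5) by (intro image_eqI[of _ _ "c \<odot>\<^bsub>W\<^esub> u"]) auto
    qed
  qed (use j(1) H(5) in auto)
qed

lemma preimage_submodule:
  assumes "kspace K W" "kspace K V" "bounded_map K W V j" "submodule H (scalar_ring K) V"
  shows "submodule {x \<in> carrier W. j x \<in> H} (scalar_ring K) W"
proof -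
  interpret W: kspace K W by fact
  interpret V: kspace K V by fact
  note j = bounded_mapD[OF assms(3)] and H = V.submodD[OF assms(4)]
  show ?thesis
    unfolding W.submod_iff using j H bounded_map_zero[OF assms(1-3)] by auto
qed

text \<open>
  Adding finitely many vectors to an isomorphic copy of a Banach space \<open>W\<close> keeps it complete. Each
  vector of the extension is described by an element of \<open>W\<close> and finitely many scalars; the map \<open>r\<close> records
  that there are no more vectors than such descriptions.
\<close>

lemma finite_extension:
  fixes W :: "'w nspace" and V :: "'v nspace"
  assumes W: "kspace K W" "banach_space K W" and V: "kspace K V"
    and j: "bounded_map K W V j" "a > 0" "\<And>x. x \<in> carrier W \<Longrightarrow> a * nrm W x \<le> nrm V (j x)"
    and B: "finite B" "B \<subseteq> carrier V"
  shows "kspace.complete_set V (lin_span K V (j ` carrier W \<union> B)) \<and>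
    (\<exists>r :: 'w \<times> (nat \<Rightarrow> complex) \<Rightarrow> 'v. lin_span K V (j ` carrier W \<union> B) \<subseteq> range r)"
  using B
proof (induction B)
  interpret W: kspace K W by fact
  interpret V: kspace K V by fact
  case empty
  have "submodule (j ` carrier W) (scalar_ring K) V"
    by (rule image_submodule[OF W(1) V j(1) W.carrier_is_submodule])
  then have "lin_span K V (j ` carrier W \<union> {}) = j ` carrier W" by (simp add: V.lin_span_self)
  moreover have "V.complete_set (j ` carrier W)"
    using complete_set_image[OF W(1) V j] W(2) by (simp add: banach_space_iff[OF W(1)])
  moreover have "j ` carrier W \<subseteq> range (\<lambda>p :: 'w \<times> (nat \<Rightarrow> complex). j (fst p))"
  proof
    fix y assume "y \<in> j ` carrier W"
    then obtain x where "y = j (fst (x, \<lambda>_ :: nat. 0 :: complex))" by auto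
    then show "y \<in> range (\<lambda>p :: 'w \<times> (nat \<Rightarrow> complex). j (fst p))" by blast
  qed
  ultimately show ?case by metis
next
  interpret V: kspace K V by fact
  case (insert b B)
  let ?L = "lin_span K V (j ` carrier W \<union> B)"
  have b: "b \<in> carrier V" and sub: "j ` carrier W \<union> B \<subseteq> carrier V"
    using insert.prems bounded_mapD(1)[OF j(1)] by auto
  have eq: "lin_span K V (j ` carrier W \<union> insert b B) = {w \<oplus>\<^bsub>V\<^esub> c \<odot>\<^bsub>V\<^esub> b |w c. w \<in> ?L \<and> c \<in> K}"
    using V.lin_span_insert[OF sub b] by simp
  obtain r :: "'w \<times> (nat \<Rightarrow> complex) \<Rightarrow> 'v" where r: "?L \<subseteq> range r" and c: "V.complete_set ?L"
    using insert by auto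
  define r' :: "'w \<times> (nat \<Rightarrow> complex) \<Rightarrow> 'v"
    where "r' p = r (fst p, \<lambda>i. snd p (Suc i)) \<oplus>\<^bsub>V\<^esub> snd p 0 \<odot>\<^bsub>V\<^esub> b" for p
  have "lin_span K V (j ` carrier W \<union> insert b B) \<subseteq> range r'"
    unfolding eq
  proof clarify
    fix w c assume "w \<in> ?L" "c \<in> K"
    then obtain x v where w: "w = r (x, v)" using r by force
    have "w \<oplus>\<^bsub>V\<^esub> c \<odot>\<^bsub>V\<^esub> b = r' (x, case_nat c v)" by (simp add: r'_def w)
    then show "w \<oplus>\<^bsub>V\<^esub> c \<odot>\<^bsub>V\<^esub> b \<in> range r'" by simp
  qed
  moreover have "V.complete_set (lin_span K V (j ` carrier W \<union> insert b B))"
    unfolding eq by (rule V.complete_set_add_line[OF V.lin_span_submodule[OF sub] c b])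
  ultimately show ?case by blast
qed

text \<open>
  A pair \<open>(x, v)\<close> is encoded as a function on \<open>'w \<Rightarrow> complex\<close>. Its value at the constant function
  \<open>i + 2\<close> is \<open>v i\<close>, and elsewhere it is evaluation at \<open>x\<close>. The indicator functions of points
  identify \<open>x\<close>. They take the value \<open>1\<close>, so they are none of these constants, even if \<open>'w\<close> has just
  one element; this is the reason for the shift by \<open>2\<close>.
\<close>

lemma universe_embedding:
  fixes r :: "'w \<times> (nat \<Rightarrow> complex) \<Rightarrow> 'v"
  assumes "A \<subseteq> range r"
  obtains h :: "'v \<Rightarrow> 'w universe" where "inj_on h A"
proof -
  define k :: "nat \<Rightarrow> 'w \<Rightarrow> complex" where "k i = (\<lambda>_. of_nat (i + 2))" for i
  have k: "k i = k i' \<longleftrightarrow> i = i'" for i i' by (auto simp: k_def fun_eq_iff simp del: of_nat_add)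
  define \<Phi> :: "'w \<times> (nat \<Rightarrow> complex) \<Rightarrow> 'w universe"
    where "\<Phi> p f = (if f \<in> range k then snd p (the_inv k f) else f (fst p))" for p f
  have ik: "inj k" by (simp add: inj_def k)
  have 1: "\<Phi> p (k i) = snd p i" for p i by (simp add: \<Phi>_def the_inv_f_f[OF ik])
  have 2: "\<Phi> p (\<lambda>a. if a = y then 1 else 0) = (if fst p = y then 1 else 0)" for p y
  proof -
    have "k i y \<noteq> 1" for i
      unfolding k_def using of_nat_eq_iff[of "i + 2" 1, where ?'a = complex] by (simp del: of_nat_eq_iff)
    then have "(\<lambda>a. if a = y then 1 else 0) \<notin> range k" by (auto simp: fun_eq_iff) metis
    then show ?thesis by (simp add: \<Phi>_def)
  qed
  have "inj \<Phi>"
  proof (rule injI)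
    fix p q assume eq: "\<Phi> p = \<Phi> q"
    have "snd p = snd q" using 1[of p] 1[of q] eq by (auto simp: fun_eq_iff)
    moreover have "fst p = fst q" using 2[of p "fst q"] 2[of q "fst q"] eq by (auto split: if_splits)
    ultimately show "p = q" by (simp add: prod_eq_iff)
  qed
  moreover have "inj_on (inv_into UNIV r) A" using assms by (rule inj_on_inv_into)
  ultimately have "inj_on (\<Phi> \<circ> inv_into UNIV r) A" using comp_inj_on inj_on_subset by blast
  then show ?thesis by (rule that)
qed

section \<open>Spaces of operators\<close>

lemma kspace_scalar_space:
  assumes K: "K = \<real> \<or> K = UNIV"
  shows "kspace K (scalar_space K)"
proof -
  have "Module.module (scalar_ring K) (scalar_space K)"
  proof (rule moduleI[OF cring_scalar_ring[OF K]])
    show "abelian_group (scalar_space K)"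
      using K by (intro abelian_groupI)
       (auto simp: scalar_space_def add.assoc add.commute intro: bexI[of _ "- x" for x])
  qed (use K in \<open>auto simp: scalar_space_def algebra_simps\<close>)
  moreover have "normed_space_axioms K (scalar_space K)"
    by standard (auto simp: scalar_space_def norm_mult norm_triangle_ineq)
  ultimately show ?thesis using K by (intro kspaceI normed_space.intro)
qed

lemma scalar_space_simps [simp]:
  "carrier (scalar_space K) = K" "zero (scalar_space K) = 0" "add (scalar_space K) = (+)"
  "smult (scalar_space K) = (*)" "nrm (scalar_space K) = cmod"
  by (simp_all add: scalar_space_def)

lemma op_space_simps [simp]:
  "carrier (op_space K X Y) = operators K X Y"
  "zero (op_space K X Y) = (\<lambda>x\<in>carrier X. \<zero>\<^bsub>Y\<^esub>)"
  "add (op_space K X Y) S T = (\<lambda>x\<in>carrier X. S x \<oplus>\<^bsub>Y\<^esub> T x)"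
  "smult (op_space K X Y) c T = (\<lambda>x\<in>carrier X. c \<odot>\<^bsub>Y\<^esub> T x)"
  "nrm (op_space K X Y) = opnorm X Y"
  by (simp_all add: op_space_def)

lemma bounded_map_const_zero:
  assumes "kspace K X" "kspace K Y"
  shows "bounded_map K X Y (\<lambda>x. \<zero>\<^bsub>Y\<^esub>)"
proof -
  interpret Y: kspace K Y by fact
  show ?thesis by (rule bounded_mapI[where C = 0]) auto
qed

lemma bounded_map_add:
  assumes "kspace K X" "kspace K Y" "bounded_map K X Y f" "bounded_map K X Y g"
  shows "bounded_map K X Y (\<lambda>x. f x \<oplus>\<^bsub>Y\<^esub> g x)"
proof -
  interpret X: kspace K X by fact
  interpret Y: kspace K Y by fact
  note f = bounded_mapD[OF assms(3)] and g = bounded_mapD[OF assms(4)]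
  obtain C where C: "C > 0" "\<And>x. x \<in> carrier X \<Longrightarrow> nrm Y (f x) \<le> C * nrm X x"
    using bounded_map_bound[OF assms(1,3)] by blast
  obtain D where D: "D > 0" "\<And>x. x \<in> carrier X \<Longrightarrow> nrm Y (g x) \<le> D * nrm X x"
    using bounded_map_bound[OF assms(1,4)] by blast
  show ?thesis
  proof (rule bounded_mapI[where C = "C + D"])
    fix x assume x: "x \<in> carrier X"
    show "nrm Y (f x \<oplus>\<^bsub>Y\<^esub> g x) \<le> (C + D) * nrm X x"
      using Y.nrm_triangle[of "f x" "g x"] C(2)[OF x] D(2)[OF x] f(1)[OF x] g(1)[OF x]
      by (simp add: distrib_right)
  qed (use f g in \<open>auto simp: Y.smult_add_right Y.M.a_ac\<close>)
qed

lemma bounded_map_smult: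
  assumes "kspace K X" "kspace K Y" "bounded_map K X Y f" "c \<in> K"
  shows "bounded_map K X Y (\<lambda>x. c \<odot>\<^bsub>Y\<^esub> f x)"
proof -
  interpret X: kspace K X by fact
  interpret Y: kspace K Y by fact
  note f = bounded_mapD[OF assms(3)]
  obtain C where C: "C > 0" "\<And>x. x \<in> carrier X \<Longrightarrow> nrm Y (f x) \<le> C * nrm X x"
    using bounded_map_bound[OF assms(1,3)] by blast
  show ?thesis
  proof (rule bounded_mapI[where C = "cmod c * C"])
    fix x assume x: "x \<in> carrier X"
    show "nrm Y (c \<odot>\<^bsub>Y\<^esub> f x) \<le> cmod c * C * nrm X x"
      using mult_left_mono[OF C(2)[OF x], of "cmod c"] f(1)[OF x] assms(4)
      by (simp add: Y.nrm_smult mult.assoc)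
  qed (use f assms(4) in \<open>auto simp: Y.smult_add_right Y.smult_smult mult.commute\<close>)
qed

lemma kspace_op_space:
  assumes X: "kspace K X" and Y: "kspace K Y"
  shows "kspace K (op_space K X Y)"
proof -
  interpret X: kspace K X by fact
  interpret Y: kspace K Y by fact
  let ?O = "op_space K X Y"
  have bm: "bounded_map K X Y S" if "S \<in> operators K X Y" for S
    using that by (simp add: operators_iff[OF X Y])
  have ext: "S \<in> extensional (carrier X)" if "S \<in> operators K X Y" for S
    using that by (simp add: operators_iff[OF X Y])
  note R = restrict_operators[OF X Y]
  have cl: "S x \<in> carrier Y" if "S \<in> operators K X Y" "x \<in> carrier X" for S x
    using bounded_mapD(1)[OF bm] that by blast
  have addc: "S \<oplus>\<^bsub>?O\<^esub> T \<in> operators K X Y" if "S \<in> operators K X Y" "T \<in> operators K X Y" for S T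
    using R[OF bounded_map_add[OF X Y bm bm]] that by simp
  have smc: "c \<odot>\<^bsub>?O\<^esub> S \<in> operators K X Y" if "S \<in> operators K X Y" "c \<in> K" for S c
    using R[OF bounded_map_smult[OF X Y bm]] that by simp
  have zc: "\<zero>\<^bsub>?O\<^esub> \<in> operators K X Y" using R[OF bounded_map_const_zero[OF X Y]] by simp
  have "Module.module (scalar_ring K) ?O"
  proof (rule moduleI[OF cring_scalar_ring[OF X.scalars]])
    show "abelian_group ?O"
    proof (rule abelian_groupI)
      fix S assume S: "S \<in> carrier ?O"
      have "((-1) \<odot>\<^bsub>?O\<^esub> S) \<oplus>\<^bsub>?O\<^esub> S = \<zero>\<^bsub>?O\<^esub>"
        using cl[of S] S by (auto simp: fun_eq_iff restrict_def Y.M.l_neg simp flip: Y.neg_eq)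
      then show "\<exists>T\<in>carrier ?O. T \<oplus>\<^bsub>?O\<^esub> S = \<zero>\<^bsub>?O\<^esub>"
        using smc[of S "-1"] S by (intro bexI[of _ "(-1) \<odot>\<^bsub>?O\<^esub> S"]) auto
      show "\<zero>\<^bsub>?O\<^esub> \<oplus>\<^bsub>?O\<^esub> S = S"
        using cl[of S] ext[of S] S by (auto simp: fun_eq_iff restrict_def extensional_def)
    next
      fix S T U assume "S \<in> carrier ?O" "T \<in> carrier ?O" "U \<in> carrier ?O"
      then show "S \<oplus>\<^bsub>?O\<^esub> T \<oplus>\<^bsub>?O\<^esub> U = S \<oplus>\<^bsub>?O\<^esub> (T \<oplus>\<^bsub>?O\<^esub> U)"
        using cl[of S] cl[of T] cl[of U] by (auto simp: fun_eq_iff restrict_def Y.M.a_assoc)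
    next
      fix S T assume "S \<in> carrier ?O" "T \<in> carrier ?O"
      then show "S \<oplus>\<^bsub>?O\<^esub> T = T \<oplus>\<^bsub>?O\<^esub> S"
        using cl[of S] cl[of T] by (auto simp: fun_eq_iff restrict_def Y.M.a_comm)
    qed (use addc zc in auto)
  next
    fix a S assume "a \<in> carrier (scalar_ring K)" "S \<in> carrier ?O"
    then show "a \<odot>\<^bsub>?O\<^esub> S \<in> carrier ?O" using smc by auto
  next
    fix a b S assume "a \<in> carrier (scalar_ring K)" "b \<in> carrier (scalar_ring K)" "S \<in> carrier ?O"
    then show "(a \<oplus>\<^bsub>scalar_ring K\<^esub> b) \<odot>\<^bsub>?O\<^esub> S = a \<odot>\<^bsub>?O\<^esub> S \<oplus>\<^bsub>?O\<^esub> b \<odot>\<^bsub>?O\<^esub> S"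
      "(a \<otimes>\<^bsub>scalar_ring K\<^esub> b) \<odot>\<^bsub>?O\<^esub> S = a \<odot>\<^bsub>?O\<^esub> (b \<odot>\<^bsub>?O\<^esub> S)"
      using cl[of S] by (auto simp: fun_eq_iff restrict_def Y.smult_add_left Y.smult_smult)
  next
    fix a S T assume "a \<in> carrier (scalar_ring K)" "S \<in> carrier ?O" "T \<in> carrier ?O"
    then show "a \<odot>\<^bsub>?O\<^esub> (S \<oplus>\<^bsub>?O\<^esub> T) = a \<odot>\<^bsub>?O\<^esub> S \<oplus>\<^bsub>?O\<^esub> a \<odot>\<^bsub>?O\<^esub> T"
      using cl[of S] cl[of T] by (auto simp: fun_eq_iff restrict_def Y.smult_add_right)
  next
    fix S assume "S \<in> carrier ?O"
    then show "\<one>\<^bsub>scalar_ring K\<^esub> \<odot>\<^bsub>?O\<^esub> S = S"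
      using cl[of S] ext[of S] by (auto simp: fun_eq_iff restrict_def extensional_def)
  qed
  moreover have "normed_space_axioms K ?O"
  proof
    fix S assume "S \<in> carrier ?O"
    then have S: "S \<in> operators K X Y" by simp
    show "0 \<le> nrm ?O S" using opnorm_nonneg[OF X Y bm[OF S]] by simp
    show "nrm ?O S = 0 \<longleftrightarrow> S = \<zero>\<^bsub>?O\<^esub>"
    proof
      assume "nrm ?O S = 0"
      then have "nrm Y (S x) \<le> 0" if "x \<in> carrier X" for x
        using opnorm_upper[OF X Y bm[OF S] that] by simp
      then have "S x = \<zero>\<^bsub>Y\<^esub>" if "x \<in> carrier X" for x
        using Y.nrm_eq_0 Y.nrm_nonneg cl[OF S that] that by (meson order_antisym)
      then show "S = \<zero>\<^bsub>?O\<^esub>" using ext[OF S] by (auto simp: fun_eq_iff restrict_def extensional_def)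
    next
      assume S0: "S = \<zero>\<^bsub>?O\<^esub>"
      have "opnorm X Y S \<le> 0" by (rule opnorm_le[OF X]) (auto simp: S0)
      then show "nrm ?O S = 0" using opnorm_nonneg[OF X Y bm[OF S]] by simp
    qed
  next
    fix c S assume c: "c \<in> K" and "S \<in> carrier ?O"
    then have S: "S \<in> operators K X Y" by simp
    have le: "opnorm X Y (c \<odot>\<^bsub>?O\<^esub> S) \<le> cmod c * opnorm X Y S" if c: "c \<in> K" and S: "S \<in> operators K X Y" for c S
    proof (rule opnorm_le[OF X])
      show "0 \<le> cmod c * opnorm X Y S" using opnorm_nonneg[OF X Y bm[OF S]] by simp
      fix x assume x: "x \<in> carrier X"
      then show "nrm Y ((c \<odot>\<^bsub>?O\<^esub> S) x) \<le> cmod c * opnorm X Y S * nrm X x"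
        using mult_left_mono[OF opnorm_upper[OF X Y bm[OF S] x], of "cmod c"] cl[OF S x] c
        by (simp add: Y.nrm_smult mult.assoc)
    qed
    show "nrm ?O (c \<odot>\<^bsub>?O\<^esub> S) = cmod c * nrm ?O S"
    proof (cases "c = 0")
      case True
      then show ?thesis using le[OF c S] opnorm_nonneg[OF X Y bm[OF smc[OF S c]]] by simp
    next
      case False
      have "inverse c \<odot>\<^bsub>?O\<^esub> (c \<odot>\<^bsub>?O\<^esub> S) = S"
        using False cl[OF S] ext[OF S] c by (auto simp: fun_eq_iff restrict_def extensional_def Y.smult_smult)
      then have "opnorm X Y S \<le> cmod (inverse c) * opnorm X Y (c \<odot>\<^bsub>?O\<^esub> S)"
        using le[of "inverse c" "c \<odot>\<^bsub>?O\<^esub> S"] smc[OF S c] c by auto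
      then have "cmod c * opnorm X Y S \<le> opnorm X Y (c \<odot>\<^bsub>?O\<^esub> S)"
        using False by (simp add: norm_inverse norm_divide field_simps del: op_space_simps)
      then show ?thesis using le[OF c S] by simp
    qed
  next
    fix S T assume "S \<in> carrier ?O" "T \<in> carrier ?O"
    then have S: "S \<in> operators K X Y" and T: "T \<in> operators K X Y" by auto
    have "opnorm X Y (S \<oplus>\<^bsub>?O\<^esub> T) \<le> opnorm X Y S + opnorm X Y T"
    proof (rule opnorm_le[OF X])
      show "0 \<le> opnorm X Y S + opnorm X Y T" using opnorm_nonneg[OF X Y bm] S T by (simp add: add_nonneg_nonneg)
      fix x assume x: "x \<in> carrier X"
      show "nrm Y ((S \<oplus>\<^bsub>?O\<^esub> T) x) \<le> (opnorm X Y S + opnorm X Y T) * nrm X x"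
        using opnorm_upper[OF X Y bm[OF S] x] opnorm_upper[OF X Y bm[OF T] x] x
          Y.nrm_triangle[OF cl[OF S x] cl[OF T x]] by (simp add: distrib_right)
    qed
    then show "nrm ?O (S \<oplus>\<^bsub>?O\<^esub> T) \<le> nrm ?O S + nrm ?O T" by simp
  qed
  ultimately show ?thesis by (intro kspaceI X.scalars normed_space.intro)
qed

lemma op_space_minus:
  assumes X: "kspace K X" and Y: "kspace K Y" and "S \<in> operators K X Y" "T \<in> operators K X Y" "x \<in> carrier X"
  shows "(S \<ominus>\<^bsub>op_space K X Y\<^esub> T) x = S x \<ominus>\<^bsub>Y\<^esub> T x"
proof -
  interpret X: kspace K X by fact
  interpret Y: kspace K Y by fact
  interpret O: kspace K "op_space K X Y" by (rule kspace_op_space[OF X Y])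
  have "S x \<in> carrier Y" "T x \<in> carrier Y"
    using assms(3-5) bounded_mapD(1)[of K X Y] by (simp_all add: operators_iff[OF X Y])
  then show ?thesis using O.minus_eq'[of S T] assms(3-5) by (simp add: Y.minus_eq')
qed

section \<open>Norming functionals (Hahn-Banach)\<close>

context kspace
begin

text \<open>
  Domination by the norm is made part of the notion, since it bounds infima of such functions from
  below. The value \<open>0\<close> off the carrier makes minimality with respect to the pointwise order meaningful.
\<close>

definition sublinear :: "('a \<Rightarrow> real) \<Rightarrow> bool" where
  "sublinear p \<longleftrightarrow>
     (\<forall>x\<in>carrier V. \<forall>y\<in>carrier V. p (x \<oplus> y) \<le> p x + p y) \<and>
     (\<forall>r\<ge>0. \<forall>x\<in>carrier V. p (complex_of_real r \<odot> x) = r * p x) \<and>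
     (\<forall>x\<in>carrier V. p x \<le> nrm V x) \<and> (\<forall>x. x \<notin> carrier V \<longrightarrow> p x = 0)"

lemma sublinearI:
  assumes "\<And>x y. x \<in> carrier V \<Longrightarrow> y \<in> carrier V \<Longrightarrow> p (x \<oplus> y) \<le> p x + p y"
    and hom: "\<And>r x. r > 0 \<Longrightarrow> x \<in> carrier V \<Longrightarrow> p (complex_of_real r \<odot> x) \<le> r * p x"
    and zero: "p \<zero> = 0"
    and "\<And>x. x \<in> carrier V \<Longrightarrow> p x \<le> nrm V x" "\<And>x. x \<notin> carrier V \<Longrightarrow> p x = 0"
  shows "sublinear p"
proof -
  have "p (complex_of_real r \<odot> x) = r * p x" if r: "r \<ge> 0" and x: "x \<in> carrier V" for r x
  proof (cases "r = 0")
    case True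
    then show ?thesis using x zero by simp
  next
    case False
    then have r: "r > 0" using r by simp
    have "p (complex_of_real (inverse r) \<odot> (complex_of_real r \<odot> x)) \<le> inverse r * p (complex_of_real r \<odot> x)"
      using r x by (intro hom) auto
    moreover have "complex_of_real (inverse r) \<odot> (complex_of_real r \<odot> x) = x"
      using r x smult_smult[of "complex_of_real (inverse r)" "complex_of_real r" x] by (simp flip: of_real_mult)
    ultimately have "r * p x \<le> p (complex_of_real r \<odot> x)" using r by (simp add: field_simps)
    then show ?thesis using hom[OF r x] by simp
  qed
  then show ?thesis using assms unfolding sublinear_def by blast
qed

lemma sublinearD:
  assumes "sublinear p"
  shows "x \<in> carrier V \<Longrightarrow> y \<in> carrier V \<Longrightarrow> p (x \<oplus> y) \<le> p x + p y"
    and "r \<ge> 0 \<Longrightarrow> x \<in> carrier V \<Longrightarrow> p (complex_of_real r \<odot> x) = r * p x"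
    and "x \<in> carrier V \<Longrightarrow> p x \<le> nrm V x" and "x \<notin> carrier V \<Longrightarrow> p x = 0" and "p \<zero> = 0"
    and "x \<in> carrier V \<Longrightarrow> - nrm V x \<le> p x"
proof -
  note p = assms[unfolded sublinear_def]
  show 1: "p (x \<oplus> y) \<le> p x + p y" if "x \<in> carrier V" "y \<in> carrier V" for x y using p that by blast
  show 2: "p (complex_of_real r \<odot> x) = r * p x" if "r \<ge> 0" "x \<in> carrier V" for r x using p that by blast
  show 3: "p x \<le> nrm V x" if "x \<in> carrier V" for x using p that by blast
  show "p x = 0" if "x \<notin> carrier V" for x using p that by blast
  show 4: "p \<zero> = 0" using 2[of 0 \<zero>] by simp
  show "- nrm V x \<le> p x" if "x \<in> carrier V" for x
    using 1[of x "\<ominus> x"] 3[of "\<ominus> x"] 4 that by (simp add: M.r_neg)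
qed

text \<open>
  The witness is \<open>q x = inf {p (x + t y) - t p y | t \<ge> 0}\<close>. The shift serves two
  purposes: starting from the norm it forces a functional to attain the norm at \<open>y\<close>, and it shows that
  a minimal sublinear function is additive.
\<close>

lemma sublinear_shift:
  assumes p: "sublinear p" and y: "y \<in> carrier V"
  obtains q where "sublinear q" "\<And>x. q x \<le> p x"
    "\<And>x. x \<in> carrier V \<Longrightarrow> q x \<le> p (x \<oplus> y) - p y"
proof -
  note P = sublinearD[OF p]
  define s where "s t x = p (x \<oplus> complex_of_real t \<odot> y) - t * p y" for t x
  define q where "q x = (if x \<in> carrier V then INF t\<in>{0..}. s t x else 0)" for x
  have ty: "complex_of_real t \<odot> y \<in> carrier V" for t using y by blast
  have low: "- p (\<ominus> x) \<le> s t x" if x: "x \<in> carrier V" and t: "t \<ge> 0" for x t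
  proof -
    have "t * p y = p ((x \<oplus> complex_of_real t \<odot> y) \<oplus> \<ominus> x)"
      using x ty[of t] P(2)[OF t y] add_minus_cancel''[of "complex_of_real t \<odot> y" x]
      by (simp add: a_minus_def)
    also have "\<dots> \<le> p (x \<oplus> complex_of_real t \<odot> y) + p (\<ominus> x)" using x ty by (intro P(1)) auto
    finally show ?thesis by (simp add: s_def)
  qed
  have qle: "q x \<le> s t x" if x: "x \<in> carrier V" and t: "t \<ge> 0" for x t
    using low[OF x] x t unfolding q_def by (auto intro!: cINF_lower bdd_belowI2)
  have qge: "b \<le> q x" if x: "x \<in> carrier V" and b: "\<And>t. t \<ge> 0 \<Longrightarrow> b \<le> s t x" for x b
    using x b unfolding q_def by (auto intro!: cINF_greatest)
  have qp: "q x \<le> p x" for x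
    using qle[of x 0] y P(4)[of x] by (cases "x \<in> carrier V") (auto simp: s_def q_def)
  have "sublinear q"
  proof (rule sublinearI)
    fix x x' assume x: "x \<in> carrier V" and x': "x' \<in> carrier V"
    have *: "q (x \<oplus> x') \<le> s t x + s u x'" if t: "t \<ge> 0" and u: "u \<ge> 0" for t u
    proof -
      have "q (x \<oplus> x') \<le> s (t + u) (x \<oplus> x')" using t u x x' by (intro qle) auto
      also have "(x \<oplus> x') \<oplus> complex_of_real (t + u) \<odot> y
          = (x \<oplus> complex_of_real t \<odot> y) \<oplus> (x' \<oplus> complex_of_real u \<odot> y)"
        using smult_add_left[of "complex_of_real t" "complex_of_real u" y] x x' y by (simp add: M.a_ac)
      then have "s (t + u) (x \<oplus> x') \<le> s t x + s u x'"
        using P(1)[of "x \<oplus> complex_of_real t \<odot> y" "x' \<oplus> complex_of_real u \<odot> y"] x x' ty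
        by (simp add: s_def algebra_simps)
      finally show ?thesis .
    qed
    have "q (x \<oplus> x') - s t x \<le> q x'" if "t \<ge> 0" for t
      using *[OF that] by (intro qge[OF x']) (simp add: algebra_simps)
    then have "q (x \<oplus> x') - q x' \<le> q x" by (intro qge[OF x]) (simp add: algebra_simps)
    then show "q (x \<oplus> x') \<le> q x + q x'" by simp
  next
    fix r :: real and x assume r: "r > 0" and x: "x \<in> carrier V"
    have "q (complex_of_real r \<odot> x) / r \<le> s t x" if t: "t \<ge> 0" for t
    proof -
      have "q (complex_of_real r \<odot> x) \<le> s (r * t) (complex_of_real r \<odot> x)" using r t x by (intro qle) auto
      also have "complex_of_real r \<odot> x \<oplus> complex_of_real (r * t) \<odot> y
          = complex_of_real r \<odot> (x \<oplus> complex_of_real t \<odot> y)"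
        using x y by (simp add: smult_add_right smult_smult)
      then have "s (r * t) (complex_of_real r \<odot> x) = r * s t x"
        using P(2)[of r "x \<oplus> complex_of_real t \<odot> y"] r x ty by (simp add: s_def algebra_simps)
      finally show ?thesis using r by (simp add: field_simps)
    qed
    then have "q (complex_of_real r \<odot> x) / r \<le> q x" by (intro qge[OF x])
    then show "q (complex_of_real r \<odot> x) \<le> r * q x" using r by (simp add: field_simps)
  next
    have "s t \<zero> = 0" if "t \<ge> 0" for t using P(2)[OF that y] ty by (simp add: s_def)
    then show "q \<zero> = 0" by (simp add: q_def)
  next
    show "q x \<le> nrm V x" if "x \<in> carrier V" for x using qp[of x] P(3)[OF that] by simp
  qed (simp add: q_def)
  moreover have "q x \<le> p (x \<oplus> y) - p y" if "x \<in> carrier V" for x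
    using qle[OF that, of 1] y by (simp add: s_def)
  ultimately show ?thesis using qp that by blast
qed

text \<open>
  Zorn's lemma: the pointwise infimum of a chain of sublinear functions is sublinear. Subadditivity uses
  that two members of a chain are comparable, so that the smaller one can replace both.
\<close>

lemma minimal_sublinear:
  assumes p: "sublinear p"
  obtains m where "sublinear m" "\<And>x. m x \<le> p x" "\<And>q. sublinear q \<Longrightarrow> (\<And>x. q x \<le> m x) \<Longrightarrow> q = m"
proof -
  define A where "A = {q. sublinear q \<and> (\<forall>x. q x \<le> p x)}"
  define R where "R q q' \<longleftrightarrow> (\<forall>x. q' x \<le> q x)" for q q' :: "'a \<Rightarrow> real"
  have "\<exists>m\<in>A. \<forall>a\<in>A. R m a \<longrightarrow> a = m"
  proof (rule predicate_Zorn)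
    show "partial_order_on A (relation_of R A)"
      by (rule partial_order_on_relation_ofI) (auto simp: R_def fun_eq_iff intro: order_trans order_antisym)
    fix C assume C: "C \<in> Chains (relation_of R A)"
    have CA: "C \<subseteq> A" using C by (auto simp: Chains_def relation_of_def)
    have tot: "R a b \<or> R b a" if "a \<in> C" "b \<in> C" for a b
      using C that by (auto simp: Chains_def relation_of_def)
    show "\<exists>u\<in>A. \<forall>a\<in>C. R a u"
    proof (cases "C = {}")
      case True
      then show ?thesis using p by (auto simp: A_def)
    next
      case ne: False
      have S: "sublinear c" "\<And>x. c x \<le> p x" if "c \<in> C" for c using CA that by (auto simp: A_def)
      define u where "u x = (if x \<in> carrier V then INF c\<in>C. c x else 0)" for x
      have ule: "u x \<le> c x" if c: "c \<in> C" for x c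
      proof (cases "x \<in> carrier V")
        case True
        have "bdd_below ((\<lambda>c. c x) ` C)"
          using sublinearD(6)[OF S(1) True] by (auto intro!: bdd_belowI2[of _ "- nrm V x"])
        then show ?thesis using True c by (auto simp: u_def intro: cINF_lower)
      next
        case False
        then show ?thesis using sublinearD(4)[OF S(1)[OF c]] by (simp add: u_def)
      qed
      have uge: "b \<le> u x" if "x \<in> carrier V" "\<And>c. c \<in> C \<Longrightarrow> b \<le> c x" for x b
        using that ne by (auto simp: u_def intro!: cINF_greatest)
      obtain c0 where c0: "c0 \<in> C" using ne by blast
      have "sublinear u"
      proof (rule sublinearI)
        fix x y assume x: "x \<in> carrier V" and y: "y \<in> carrier V"
        have *: "u (x \<oplus> y) \<le> a x + b y" if a: "a \<in> C" and b: "b \<in> C" for a b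
        proof -
          \<comment> \<open>The smaller of \<open>a\<close> and \<open>b\<close>.\<close>
          obtain c where c: "c \<in> C" "c x \<le> a x" "c y \<le> b y"
            using tot[OF a b] a b unfolding R_def by (metis order_refl)
          show ?thesis using ule[OF c(1), of "x \<oplus> y"] sublinearD(1)[OF S(1)[OF c(1)] x y] c by simp
        qed
        have "u (x \<oplus> y) - a x \<le> u y" if "a \<in> C" for a
          using *[OF that] by (intro uge[OF y]) (simp add: algebra_simps)
        then have "u (x \<oplus> y) - u y \<le> u x" by (intro uge[OF x]) (simp add: algebra_simps)
        then show "u (x \<oplus> y) \<le> u x + u y" by simp
      next
        fix r :: real and x assume r: "r > 0" and x: "x \<in> carrier V"
        have "u (complex_of_real r \<odot> x) / r \<le> c x" if c: "c \<in> C" for c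
          using ule[OF c, of "complex_of_real r \<odot> x"] sublinearD(2)[OF S(1)[OF c], of r x] r x
          by (simp add: field_simps)
        then have "u (complex_of_real r \<odot> x) / r \<le> u x" by (rule uge[OF x])
        then show "u (complex_of_real r \<odot> x) \<le> r * u x" using r by (simp add: field_simps)
      next
        have "c \<zero> = 0" if "c \<in> C" for c using sublinearD(5)[OF S(1)[OF that]] .
        then show "u \<zero> = 0" using uge[of \<zero> 0] ule[OF c0, of \<zero>] c0 by force
      next
        show "u x \<le> nrm V x" if "x \<in> carrier V" for x
          using ule[OF c0, of x] sublinearD(3)[OF S(1)[OF c0] that] by simp
      qed (simp add: u_def)
      moreover have "u x \<le> p x" for x using ule[OF c0, of x] S(2)[OF c0, of x] by simp
      ultimately have "u \<in> A" by (simp add: A_def)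
      then show ?thesis using ule by (auto simp: R_def)
    qed
  qed
  then obtain m where m: "m \<in> A" "\<And>a. a \<in> A \<Longrightarrow> R m a \<Longrightarrow> a = m" by blast
  show ?thesis
  proof (rule that[of m])
    show "sublinear m" "m x \<le> p x" for x using m(1) by (auto simp: A_def)
    fix q assume q: "sublinear q" "\<And>x. q x \<le> m x"
    have "q x \<le> p x" for x using q(2)[of x] m(1) by (auto simp: A_def intro: order_trans)
    then show "q = m" using q by (intro m(2)) (auto simp: A_def R_def)
  qed
qed

text \<open>
  A minimal sublinear \<open>f\<close> coincides with its shift along every \<open>b\<close>, whence \<open>f a + f b \<le> f (a + b)\<close>,
  so \<open>f\<close> is linear. It is taken below the shift \<open>p\<close> of the norm along \<open>y\<close>; since
  \<open>p (-y) \<le> - \<parallel>y\<parallel>\<close>, it has the value \<open>\<parallel>y\<parallel>\<close> at \<open>y\<close>.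
\<close>

lemma real_norming_functional:
  assumes y: "y \<in> carrier V"
  obtains f where "\<And>a b. a \<in> carrier V \<Longrightarrow> b \<in> carrier V \<Longrightarrow> f (a \<oplus> b) = f a + f b"
    and "\<And>r a. a \<in> carrier V \<Longrightarrow> f (complex_of_real r \<odot> a) = r * f a"
    and "\<And>a. a \<in> carrier V \<Longrightarrow> f a \<le> nrm V a" and "f y = nrm V y"
proof -
  \<comment> \<open>Shift the norm along \<open>y\<close>, so that everything below the result is at most \<open>- \<parallel>y\<parallel>\<close> at \<open>- y\<close>.\<close>
  have "sublinear (\<lambda>x. if x \<in> carrier V then nrm V x else 0)"
    by (rule sublinearI) (auto simp: nrm_smult nrm_triangle)
  then obtain p where p: "sublinear p"
    "\<And>x. x \<in> carrier V \<Longrightarrow> p x \<le> (if x \<oplus> y \<in> carrier V then nrm V (x \<oplus> y) else 0)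
        - (if y \<in> carrier V then nrm V y else 0)"
    using sublinear_shift[OF _ y] by blast
  have p': "p (\<ominus> y) \<le> - nrm V y" using p(2)[of "\<ominus> y"] y by (simp add: M.l_neg)
  obtain f where f: "sublinear f" "\<And>x. f x \<le> p x" "\<And>q. sublinear q \<Longrightarrow> (\<And>x. q x \<le> f x) \<Longrightarrow> q = f"
    using minimal_sublinear[OF p(1)] by blast
  note F = sublinearD[OF f(1)]
  have add: "f (a \<oplus> b) = f a + f b" if a: "a \<in> carrier V" and b: "b \<in> carrier V" for a b
  proof -
    obtain q where q: "sublinear q" "\<And>x. q x \<le> f x" "\<And>x. x \<in> carrier V \<Longrightarrow> q x \<le> f (x \<oplus> b) - f b"
      using sublinear_shift[OF f(1) b] by blast
    have "q = f" using f(3) q by blast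
    then show ?thesis using q(3)[OF a] F(1)[OF a b] by simp
  qed
  have neg: "f (\<ominus> a) = - f a" if "a \<in> carrier V" for a
    using add[of a "\<ominus> a"] that F(5) by (simp add: M.r_neg)
  have hom: "f (complex_of_real r \<odot> a) = r * f a" if a: "a \<in> carrier V" for r a
  proof (cases "r \<ge> 0")
    case True
    then show ?thesis using F(2) a by simp
  next
    case False
    have "complex_of_real r \<odot> a = \<ominus> (complex_of_real (- r) \<odot> a)"
      using a by (simp add: neg_eq smult_smult)
    then show ?thesis using F(2)[of "- r" a] neg[of "complex_of_real (- r) \<odot> a"] a False by simp
  qed
  have fy: "f y = nrm V y"
    using neg[OF y] f(2)[of "\<ominus> y"] p' F(3)[OF y] by simp
  show ?thesis by (rule that[of f, OF add hom F(3) fy])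
qed

text \<open>
  In the complex case \<open>f x - \<i> f (\<i> x)\<close> is the complex linear functional with real part \<open>f\<close>. Its norm is
  that of \<open>f\<close>, because multiplying \<open>x\<close> by a scalar of modulus \<open>1\<close> makes its value real.
\<close>

theorem norming_functional:
  assumes y: "y \<in> carrier V"
  obtains \<phi> where "\<phi> \<in> operators K V (scalar_space K)"
    "\<And>x. x \<in> carrier V \<Longrightarrow> cmod (\<phi> x) \<le> nrm V x" "cmod (\<phi> y) = nrm V y"
proof -
  obtain f where add: "\<And>a b. a \<in> carrier V \<Longrightarrow> b \<in> carrier V \<Longrightarrow> f (a \<oplus> b) = f a + f b"
    and hom: "\<And>r a. a \<in> carrier V \<Longrightarrow> f (complex_of_real r \<odot> a) = r * f a"
    and le: "\<And>a. a \<in> carrier V \<Longrightarrow> f a \<le> nrm V a" and fy: "f y = nrm V y"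
    using real_norming_functional[OF y] by blast
  obtain g where gK: "\<And>x. x \<in> carrier V \<Longrightarrow> g x \<in> K"
    and gadd: "\<And>a b. a \<in> carrier V \<Longrightarrow> b \<in> carrier V \<Longrightarrow> g (a \<oplus> b) = g a + g b"
    and ghom: "\<And>c a. c \<in> K \<Longrightarrow> a \<in> carrier V \<Longrightarrow> g (c \<odot> a) = c * g a"
    and gRe: "\<And>a. a \<in> carrier V \<Longrightarrow> Re (g a) = f a"
  proof (cases "K = \<real>")
    case True
    show ?thesis
      by (rule that[of "\<lambda>x. complex_of_real (f x)"]) (use True add hom in \<open>auto elim!: Reals_cases\<close>)
  next
    case False
    then have U: "K = UNIV" using scalars by simp
    define g where "g x = complex_of_real (f x) - \<i> * complex_of_real (f (\<i> \<odot> x))" for x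
    have ic: "c \<odot> a \<in> carrier V" if "a \<in> carrier V" for c a using that U smult_in[of c a] by simp
    have gadd: "g (a \<oplus> b) = g a + g b" if "a \<in> carrier V" "b \<in> carrier V" for a b
      using that ic add[OF that] add[of "\<i> \<odot> a" "\<i> \<odot> b"] smult_add_right[of \<i> a b] U
      by (simp add: g_def algebra_simps)
    have greal: "g (complex_of_real r \<odot> a) = complex_of_real r * g a" if a: "a \<in> carrier V" for r a
      using hom[OF a, of r] hom[OF ic[OF a], of r \<i>] a U
      by (simp add: g_def smult_smult algebra_simps)
    have gi: "g (\<i> \<odot> a) = \<i> * g a" if a: "a \<in> carrier V" for a
      using hom[OF a, of "-1"] a U by (simp add: g_def smult_smult algebra_simps)
    have ghom: "g (c \<odot> a) = c * g a" if a: "a \<in> carrier V" for c a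
    proof -
      have "c \<odot> a = complex_of_real (Re c) \<odot> a \<oplus> complex_of_real (Im c) \<odot> (\<i> \<odot> a)"
        using smult_add_left[of "complex_of_real (Re c)" "complex_of_real (Im c) * \<i>" a] a U
          complex_eq[of c] by (simp add: smult_smult mult.commute)
      then have "g (c \<odot> a) = complex_of_real (Re c) * g a + complex_of_real (Im c) * (\<i> * g a)"
        using gadd[of "complex_of_real (Re c) \<odot> a" "complex_of_real (Im c) \<odot> (\<i> \<odot> a)"]
          greal[OF a] greal[OF ic[OF a]] gi[OF a] ic[OF a] ic[OF ic[OF a]] by simp
      also have "\<dots> = c * g a"
        by (simp add: complex_eq_iff algebra_simps)
      finally show ?thesis .
    qed
    show ?thesis
      by (rule that[of g]) (use U gadd ghom in \<open>auto simp: g_def\<close>)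
  qed
  have bd: "cmod (g x) \<le> nrm V x" if x: "x \<in> carrier V" for x
  proof (cases "g x = 0")
    case True
    then show ?thesis using nrm_nonneg[OF x] by simp
  next
    case False
    \<comment> \<open>Rotate \<open>x\<close> such that the value of \<open>g\<close> becomes real and equals that of \<open>f\<close>.\<close>
    define u where "u = complex_of_real (cmod (g x)) / g x"
    have u: "u \<in> K" unfolding u_def using gK[OF x] by blast
    have "cmod u = 1" using False by (simp add: u_def norm_divide)
    moreover have "g (u \<odot> x) = complex_of_real (cmod (g x))"
      using ghom[OF u x] False by (simp add: u_def)
    ultimately have "cmod (g x) = f (u \<odot> x)" using gRe[of "u \<odot> x"] u x by simp
    also have "\<dots> \<le> nrm V x" using le[of "u \<odot> x"] u x \<open>cmod u = 1\<close> by (simp add: nrm_smult)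
    finally show ?thesis .
  qed
  have S: "kspace K (scalar_space K)" by (rule kspace_scalar_space[OF scalars])
  have "bounded_map K V (scalar_space K) g"
    by (rule bounded_mapI[where C = 1]) (use gK gadd ghom bd in auto)
  then have "restrict g (carrier V) \<in> operators K V (scalar_space K)"
    by (rule restrict_operators[OF kspace_axioms S])
  moreover have "cmod (g y) = nrm V y"
    using bd[OF y] gRe[OF y] fy complex_Re_le_cmod[of "g y"] by simp
  ultimately show ?thesis using bd y by (intro that[of "restrict g (carrier V)"]) auto
qed

end

section \<open>Kolmogorov diameters\<close>

lemma coset_map_bounded:
  assumes X: "kspace K X" and Y: "kspace K Y" and T: "bounded_map K X Y T"
    and G: "submodule G (scalar_ring K) Y"
  shows "bounded_map K X (quotient_space Y G) (compose (carrier X) (quotient_map Y G) T)"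
  by (rule bounded_map_cong[OF X bounded_map_comp[OF X Y T kspace.bounded_map_quotient[OF Y G]]])
     (use bounded_mapD(1)[OF T] in \<open>simp add: compose_def quotient_map_def\<close>)

lemma coset_map_opnorm_nonneg:
  assumes X: "kspace K X" and Y: "kspace K Y" and T: "bounded_map K X Y T"
    and G: "submodule G (scalar_ring K) Y"
  shows "0 \<le> opnorm X (quotient_space Y G) (compose (carrier X) (quotient_map Y G) T)"
proof -
  interpret X: kspace K X by fact
  interpret Y: kspace K Y by fact
  have z: "T \<zero>\<^bsub>X\<^esub> \<in> carrier Y" using bounded_mapD(1)[OF T] by simp
  have "0 \<le> nrm (quotient_space Y G) (compose (carrier X) (quotient_map Y G) T \<zero>\<^bsub>X\<^esub>)"
    using Y.quotient_norm_nonneg[OF G z] z by (simp add: compose_def quotient_map_def)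
  also have "\<dots> \<le> opnorm X (quotient_space Y G) (compose (carrier X) (quotient_map Y G) T)"
    by (rule opnorm_upper_ball[OF X coset_map_bounded[OF assms]]) auto
  finally show ?thesis .
qed

lemma kolmogorov_set_bdd_below:
  assumes "kspace K X" "kspace K Y" "bounded_map K X Y T"
  shows "bdd_below {opnorm X (quotient_space Y G) (compose (carrier X) (quotient_map Y G) T) | G.
       submodule G (scalar_ring K) Y \<and> dim_at_most K Y G n}"
  using coset_map_opnorm_nonneg[OF assms] by (auto intro!: bdd_belowI[of _ 0])

lemma kolmogorov_set_nonempty:
  assumes "kspace K Y"
  shows "{opnorm X (quotient_space Y G) (compose (carrier X) (quotient_map Y G) T) | G.
       submodule G (scalar_ring K) Y \<and> dim_at_most K Y G n} \<noteq> {}"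
  using kspace.dim_at_most_lin_span[OF assms, of "{}" n] kspace.lin_span_submodule[OF assms, of "{}"] by auto

lemma kolmogorov_diameter_nonneg:
  assumes "kspace K X" "kspace K Y" "bounded_map K X Y T"
  shows "0 \<le> kolmogorov_diameter K X Y n T"
  unfolding kolmogorov_diameter_def
  using coset_map_opnorm_nonneg[OF assms] by (intro cInf_greatest kolmogorov_set_nonempty assms) auto

text \<open>
  This lemma and \<open>kolmogorov_diameter_approx\<close> translate between the infimum over quotient maps and
  approximation by elements of a span of at most \<open>n\<close> vectors. Together with
  nonnegativity they are all that the rest of the proof needs to know about the diameters.
\<close>

lemma kolmogorov_diameter_le:
  assumes X: "kspace K X" and Y: "kspace K Y" and T: "bounded_map K X Y T"
    and B: "finite B" "card B \<le> n" "B \<subseteq> carrier Y" and C: "0 \<le> C"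
    and app: "\<And>x. x \<in> carrier X \<Longrightarrow> \<exists>g\<in>lin_span K Y B. nrm Y (T x \<ominus>\<^bsub>Y\<^esub> g) \<le> C * nrm X x"
  shows "kolmogorov_diameter K X Y n T \<le> C"
proof -
  interpret Y: kspace K Y by fact
  let ?G = "lin_span K Y B"
  have G: "submodule ?G (scalar_ring K) Y" by (rule Y.lin_span_submodule[OF B(3)])
  have "kolmogorov_diameter K X Y n T
      \<le> opnorm X (quotient_space Y ?G) (compose (carrier X) (quotient_map Y ?G) T)"
    unfolding kolmogorov_diameter_def
    using G Y.dim_at_most_lin_span[OF B] by (intro cInf_lower kolmogorov_set_bdd_below[OF X Y T]) auto
  also have "\<dots> \<le> C"
  proof (rule opnorm_le[OF X C])
    fix x assume x: "x \<in> carrier X"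
    then obtain g where g: "g \<in> ?G" "nrm Y (T x \<ominus>\<^bsub>Y\<^esub> g) \<le> C * nrm X x" using app by blast
    have Tx: "T x \<in> carrier Y" using bounded_mapD(1)[OF T x] .
    then show "nrm (quotient_space Y ?G) (compose (carrier X) (quotient_map Y ?G) T x) \<le> C * nrm X x"
      using Y.quotient_norm_le[OF G Tx g(1)] g(2) x by (simp add: compose_def quotient_map_def)
  qed
  finally show ?thesis .
qed

lemma kolmogorov_diameter_approx:
  assumes X: "kspace K X" and Y: "kspace K Y" and T: "bounded_map K X Y T" and "e > 0"
  obtains B where "finite B" "card B \<le> n" "B \<subseteq> carrier Y"
    "\<And>x. x \<in> carrier X \<Longrightarrow>
       \<exists>g\<in>lin_span K Y B. nrm Y (T x \<ominus>\<^bsub>Y\<^esub> g) \<le> (kolmogorov_diameter K X Y n T + e) * nrm X x"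
proof -
  interpret X: kspace K X by fact
  interpret Y: kspace K Y by fact
  let ?d = "kolmogorov_diameter K X Y n T + e"
  have "kolmogorov_diameter K X Y n T < ?d" using \<open>e > 0\<close> by simp
  then obtain G where G: "submodule G (scalar_ring K) Y" "dim_at_most K Y G n"
    and less: "opnorm X (quotient_space Y G) (compose (carrier X) (quotient_map Y G) T) < ?d"
    using cInf_lessD[OF kolmogorov_set_nonempty[OF Y]] unfolding kolmogorov_diameter_def by blast
  obtain B where B: "B \<subseteq> carrier Y" "finite B" "card B \<le> n" and GB: "lin_span K Y B = G"
    using G(2) unfolding dim_at_most_def by blast
  note T' = bounded_mapD[OF T]
  note GD = Y.submodD[OF G(1)]
  have ball: "\<exists>g\<in>G. nrm Y (T x \<ominus>\<^bsub>Y\<^esub> g) < ?d" if x: "x \<in> carrier X" "nrm X x \<le> 1" for x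
  proof (rule Y.quotient_norm_less[OF G(1) T'(1)[OF x(1)]])
    show "nrm (quotient_space Y G) (G +>\<^bsub>Y\<^esub> T x) < ?d"
      using opnorm_upper_ball[OF X coset_map_bounded[OF X Y T G(1)] x] less x(1) T'(1)[OF x(1)]
      by (simp add: compose_def quotient_map_def)
  qed
  have "\<exists>g\<in>lin_span K Y B. nrm Y (T x \<ominus>\<^bsub>Y\<^esub> g) \<le> ?d * nrm X x" if x: "x \<in> carrier X" for x
  proof (cases "nrm X x = 0")
    case True
    then have "T x = \<zero>\<^bsub>Y\<^esub>" using X.nrm_eq_0[OF x] bounded_map_zero[OF X Y T] by simp
    then show ?thesis using GD(2) True unfolding GB by (intro bexI[of _ "\<zero>\<^bsub>Y\<^esub>"]) auto
  next
    case False
    define p where "p = nrm X x"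
    have p: "p > 0" using False X.nrm_nonneg[OF x] by (simp add: p_def)
    let ?x = "complex_of_real (inverse p) \<odot>\<^bsub>X\<^esub> x"
    have "nrm X ?x = inverse p * p"
      using X.nrm_smult[of "complex_of_real (inverse p)" x] x p
      by (simp only: X.K_closed norm_of_real p_def) simp
    then have "nrm X ?x \<le> 1" using p by simp
    then obtain g where g: "g \<in> G" "nrm Y (T ?x \<ominus>\<^bsub>Y\<^esub> g) < ?d" using ball[of ?x] x by blast
    have Tx: "T ?x \<in> carrier Y" "T x \<in> carrier Y" using T'(1) x by auto
    have "complex_of_real p \<odot>\<^bsub>Y\<^esub> T ?x = T x"
      using T'(3)[of "complex_of_real (inverse p)" x] x Tx(2) p
        Y.smult_smult[of "complex_of_real p" "complex_of_real (inverse p)" "T x"]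
      by (simp flip: of_real_mult)
    then have "T x \<ominus>\<^bsub>Y\<^esub> complex_of_real p \<odot>\<^bsub>Y\<^esub> g = complex_of_real p \<odot>\<^bsub>Y\<^esub> (T ?x \<ominus>\<^bsub>Y\<^esub> g)"
      using Tx GD(5)[OF g(1)] Y.smult_minus[of "complex_of_real p" "T ?x" g] by simp
    then have "nrm Y (T x \<ominus>\<^bsub>Y\<^esub> complex_of_real p \<odot>\<^bsub>Y\<^esub> g) = p * nrm Y (T ?x \<ominus>\<^bsub>Y\<^esub> g)"
      using Tx GD(5)[OF g(1)] p by (simp add: Y.nrm_smult)
    also have "\<dots> \<le> ?d * nrm X x" using g(2) p by (simp add: p_def mult.commute mult_left_mono)
    finally show ?thesis using GD(4)[OF Y.K_closed(3) g(1)] unfolding GB by blast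
  qed
  with B show ?thesis using that by blast
qed

section \<open>Duals and adjoints\<close>

lemma kspace_dual: "kspace K X \<Longrightarrow> kspace K (dual K X)"
  unfolding dual_def by (intro kspace_op_space kspace_scalar_space kspace.scalars)

lemma dual_iff:
  assumes "kspace K X"
  shows "\<phi> \<in> carrier (dual K X) \<longleftrightarrow> \<phi> \<in> extensional (carrier X) \<and> bounded_map K X (scalar_space K) \<phi>"
  using operators_iff[OF assms kspace_scalar_space[OF kspace.scalars[OF assms]]] by (simp add: dual_def)

lemma dual_norm_le:
  assumes "kspace K X" "0 \<le> C" "\<And>x. x \<in> carrier X \<Longrightarrow> cmod (\<phi> x) \<le> C * nrm X x"
  shows "nrm (dual K X) \<phi> \<le> C"
  using opnorm_le[OF assms(1,2), of "scalar_space K" \<phi>] assms(3) by (simp add: dual_def)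

lemma dual_norm_upper:
  assumes "kspace K X" "\<phi> \<in> carrier (dual K X)" "x \<in> carrier X"
  shows "cmod (\<phi> x) \<le> nrm (dual K X) \<phi> * nrm X x"
  using opnorm_upper[OF assms(1) kspace_scalar_space[OF kspace.scalars[OF assms(1)]], of \<phi> x] assms
  by (simp add: dual_iff[OF assms(1)]) (simp add: dual_def)

lemma bounded_map_eval:
  assumes "kspace K X" "x \<in> carrier X"
  shows "bounded_map K (dual K X) (scalar_space K) (\<lambda>\<phi>. \<phi> x)"
proof (rule bounded_mapI[where C = "nrm X x"])
  fix \<phi> assume f: "\<phi> \<in> carrier (dual K X)"
  show "\<phi> x \<in> carrier (scalar_space K)"
    using f assms(2) bounded_mapD(1)[of K X "scalar_space K" \<phi> x] by (simp add: dual_iff[OF assms(1)])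
  show "nrm (scalar_space K) (\<phi> x) \<le> nrm X x * nrm (dual K X) \<phi>"
    using dual_norm_upper[OF assms(1) f assms(2)] by (simp add: mult.commute)
qed (use assms in \<open>simp_all add: dual_def\<close>)

lemma bounded_map_adjoint:
  assumes X: "kspace K X" and Y: "kspace K Y" and T: "bounded_map K X Y T"
  shows "bounded_map K (dual K Y) (dual K X) (adjoint_op K X Y T)"
proof -
  interpret X: kspace K X by fact
  interpret Y: kspace K Y by fact
  interpret DY: kspace K "dual K Y" by (rule kspace_dual[OF Y])
  have S: "kspace K (scalar_space K)" by (rule kspace_scalar_space[OF X.scalars])
  note T' = bounded_mapD[OF T]
  obtain C where C: "C > 0" "\<And>x. x \<in> carrier X \<Longrightarrow> nrm Y (T x) \<le> C * nrm X x"
    using bounded_map_bound[OF X T] by blast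
  show ?thesis
  proof (rule bounded_mapI[where C = C])
    fix \<phi> assume f: "\<phi> \<in> carrier (dual K Y)"
    then have fb: "bounded_map K Y (scalar_space K) \<phi>" by (simp add: dual_iff[OF Y])
    show "adjoint_op K X Y T \<phi> \<in> carrier (dual K X)"
      using restrict_operators[OF X S bounded_map_comp[OF X Y T fb]] f
      by (simp add: adjoint_op_def compose_def dual_def)
    show "nrm (dual K X) (adjoint_op K X Y T \<phi>) \<le> C * nrm (dual K Y) \<phi>"
    proof (rule dual_norm_le[OF X])
      have n: "0 \<le> nrm (dual K Y) \<phi>" by (rule DY.nrm_nonneg[OF f])
      then show "0 \<le> C * nrm (dual K Y) \<phi>" using C(1) by simp
      fix x assume x: "x \<in> carrier X"
      have "cmod (\<phi> (T x)) \<le> nrm (dual K Y) \<phi> * nrm Y (T x)" by (rule dual_norm_upper[OF Y f T'(1)[OF x]])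
      also have "\<dots> \<le> nrm (dual K Y) \<phi> * (C * nrm X x)" using C(2)[OF x] n by (rule mult_left_mono)
      finally show "cmod (adjoint_op K X Y T \<phi> x) \<le> C * nrm (dual K Y) \<phi> * nrm X x"
        using f x by (simp add: adjoint_op_def compose_def mult_ac)
    qed
  next
    fix \<phi> \<psi> assume f: "\<phi> \<in> carrier (dual K Y)" and g: "\<psi> \<in> carrier (dual K Y)"
    have "\<phi> \<oplus>\<^bsub>dual K Y\<^esub> \<psi> \<in> carrier (dual K Y)"
      using f g by (rule DY.M.a_closed)
    then show "adjoint_op K X Y T (\<phi> \<oplus>\<^bsub>dual K Y\<^esub> \<psi>)
        = adjoint_op K X Y T \<phi> \<oplus>\<^bsub>dual K X\<^esub> adjoint_op K X Y T \<psi>"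
      using f g T'(1) by (auto simp: adjoint_op_def compose_def dual_def fun_eq_iff restrict_def)
  next
    fix c \<phi> assume c: "c \<in> K" and f: "\<phi> \<in> carrier (dual K Y)"
    have "c \<odot>\<^bsub>dual K Y\<^esub> \<phi> \<in> carrier (dual K Y)"
      using c f by (rule DY.smult_in)
    then show "adjoint_op K X Y T (c \<odot>\<^bsub>dual K Y\<^esub> \<phi>) = c \<odot>\<^bsub>dual K X\<^esub> adjoint_op K X Y T \<phi>"
      using f c T'(1) by (auto simp: adjoint_op_def compose_def dual_def fun_eq_iff restrict_def)
  qed
qed

section \<open>Approximation of finite rank from the lifting property\<close>

lemma kernel_closed_subspace:
  assumes V: "kspace K V" and W: "kspace K W" and f: "\<And>f. f \<in> E \<Longrightarrow> bounded_map K V W f"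
  shows "closed_subspace K V {x \<in> carrier V. \<forall>f\<in>E. f x = \<zero>\<^bsub>W\<^esub>}"
proof -
  interpret V: kspace K V by fact
  interpret W: kspace K W by fact
  let ?N = "{x \<in> carrier V. \<forall>f\<in>E. f x = \<zero>\<^bsub>W\<^esub>}"
  have "submodule ?N (scalar_ring K) V"
    unfolding V.submod_iff
  proof (intro conjI ballI)
    show "\<zero>\<^bsub>V\<^esub> \<in> ?N" using bounded_map_zero[OF V W f] by simp
    fix x assume x: "x \<in> ?N"
    show "x \<oplus>\<^bsub>V\<^esub> y \<in> ?N" if y: "y \<in> ?N" for y
    proof -
      have "g (x \<oplus>\<^bsub>V\<^esub> y) = \<zero>\<^bsub>W\<^esub>" if g: "g \<in> E" for g
      proof -
        have "g x = \<zero>\<^bsub>W\<^esub>" "g y = \<zero>\<^bsub>W\<^esub>" using x y g by blast+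
        then show ?thesis using bounded_mapD(2)[OF f[OF g], of x y] x y by simp
      qed
      then show ?thesis using x y by simp
    qed
    show "c \<odot>\<^bsub>V\<^esub> x \<in> ?N" if c: "c \<in> K" for c
    proof -
      have "g (c \<odot>\<^bsub>V\<^esub> x) = \<zero>\<^bsub>W\<^esub>" if g: "g \<in> E" for g
      proof -
        have "g x = \<zero>\<^bsub>W\<^esub>" using x g by blast
        then show ?thesis using bounded_mapD(3)[OF f[OF g] c, of x] x c by simp
      qed
      then show ?thesis using x c by simp
    qed
  qed auto
  moreover have "closedin (ntop V) ?N"
    unfolding V.closedin_ntop_iff
  proof (intro conjI ballI impI)
    fix v assume v: "v \<in> carrier V" and near: "\<forall>e>0. \<exists>x\<in>?N. nrm V (v \<ominus>\<^bsub>V\<^esub> x) < e"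
    have "f v = \<zero>\<^bsub>W\<^esub>" if fE: "f \<in> E" for f
    proof -
      obtain C where C: "C > 0" "\<And>x. x \<in> carrier V \<Longrightarrow> nrm W (f x) \<le> C * nrm V x"
        using bounded_map_bound[OF V f[OF fE]] by blast
      have fv: "f v \<in> carrier W" using bounded_mapD(1)[OF f[OF fE] v] .
      have lt: "nrm W (f v) < e" if e: "e > 0" for e
      proof -
        obtain x where x: "x \<in> ?N" "nrm V (v \<ominus>\<^bsub>V\<^esub> x) < e / C"
          using near e C(1) by (meson divide_pos_pos)
        have "f x = \<zero>\<^bsub>W\<^esub>" using x(1) fE by blast
        then have "f v = f (v \<ominus>\<^bsub>V\<^esub> x)"
          using bounded_map_minus[OF V W f[OF fE] v, of x] x(1) fE fv by simp
        then have "nrm W (f v) \<le> C * nrm V (v \<ominus>\<^bsub>V\<^esub> x)" using C(2)[of "v \<ominus>\<^bsub>V\<^esub> x"] v x(1) by simp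
        also have "\<dots> < e" using x(2) C(1) by (simp add: field_simps)
        finally show ?thesis .
      qed
      then have "nrm W (f v) \<le> 0" using lt[of "nrm W (f v)"] by linarith
      then show ?thesis using W.nrm_nonneg[OF fv] W.nrm_eq_0[OF fv] by simp
    qed
    then show "v \<in> ?N" using v by simp
  qed auto
  ultimately show ?thesis by (simp add: closed_subspace_def)
qed

lemma closed_subspace_Int:
  assumes V: "kspace K V" and "closed_subspace K V A" "closed_subspace K V B"
  shows "closed_subspace K V (A \<inter> B)"
  using assms(2,3) unfolding closed_subspace_def kspace.submod_iff[OF V] by auto

lemma bounded_map_subspace:
  assumes "kspace K V" "submodule H (scalar_ring K) V" "bounded_map K V W f"
  shows "bounded_map K (V\<lparr>carrier := H\<rparr>) W f"
proof -
  have H: "x \<in> carrier V" if "x \<in> H" for x by (rule kspace.submodD(5)[OF assms(1,2) that])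
  obtain C where "C > 0" "\<And>x. x \<in> carrier V \<Longrightarrow> nrm W (f x) \<le> C * nrm V x"
    using bounded_map_bound[OF assms(1,3)] by blast
  then show ?thesis
    by (intro bounded_mapI[where C = C]) (use H bounded_mapD[OF assms(3)] in auto)
qed

text \<open>
  On the pullback \<open>Z\<close> of all \<open>(x, y)\<close> with \<open>T x - y \<in> G\<close>, where \<open>G\<close> is the span of \<open>B\<close>, consider the norm
  \<open>\<eta> \<parallel>x\<parallel> + \<parallel>y\<parallel>\<close> with a small \<open>\<eta> > 0\<close>. The first projection has kernel \<open>F = {0} \<times> G\<close>, and the inverse
  of the induced map from \<open>Z / F\<close> to \<open>X\<close> has norm at most \<open>c + \<eta>\<close>, since \<open>y\<close> may be any \<open>T x - g\<close> with
  \<open>g \<in> G\<close>. A lifting sends \<open>x\<close> to a pair \<open>(x, y)\<close>, in which \<open>y\<close> is small and depends linearly on \<open>x\<close>.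
  Then \<open>A x = T x - y\<close>.
\<close>

lemma lifting_approximation:
  fixes X :: "'a nspace" and Y :: "'b nspace"
  assumes X: "kspace K X" "banach_space K X" "metric_lifting_property K X" and Y: "kspace K Y"
    and T: "bounded_map K X Y T" and B: "finite B" "B \<subseteq> carrier Y" and c: "0 \<le> c" "c < c'"
    and app: "\<And>x. x \<in> carrier X \<Longrightarrow> \<exists>g\<in>lin_span K Y B. nrm Y (T x \<ominus>\<^bsub>Y\<^esub> g) \<le> c * nrm X x"
  obtains A where "bounded_map K X Y A" "\<And>x. x \<in> carrier X \<Longrightarrow> A x \<in> lin_span K Y B"
    "\<And>x. x \<in> carrier X \<Longrightarrow> nrm Y (T x \<ominus>\<^bsub>Y\<^esub> A x) \<le> c' * nrm X x"
proof -
  interpret X: kspace K X by fact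
  interpret Y: kspace K Y by fact
  define \<eta> where "\<eta> = (c' - c) / 2"
  have \<eta>: "\<eta> > 0" using c by (simp add: \<eta>_def)
  define E where "E = prod_space \<eta> X Y"
  have E: "kspace K E" unfolding E_def by (rule kspace_prod_space[OF X(1) Y \<eta>])
  interpret E: kspace K E by (rule E)
  note Ebm = prod_space_bounded_maps[OF X(1) Y \<eta>, folded E_def]
  note T' = bounded_mapD[OF T]
  have Ec: "carrier E = carrier X \<times> carrier Y" by (simp add: E_def)
  \<comment> \<open>\<open>Z\<close> is generated by the graph of \<open>T\<close>, a copy of \<open>X\<close>, and by \<open>{0} \<times> B\<close>.\<close>
  define j where "j x = (x, T x)" for x
  define B' where "B' = Pair \<zero>\<^bsub>X\<^esub> ` B"
  obtain C where C: "C > 0" "\<And>x. x \<in> carrier X \<Longrightarrow> nrm Y (T x) \<le> C * nrm X x"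
    using bounded_map_bound[OF X(1) T] by blast
  have jb: "bounded_map K X E j"
    by (rule bounded_mapI[where C = "\<eta> + C"]) (use T' C(2) in \<open>auto simp: E_def j_def distrib_right\<close>)
  have jlow: "\<eta> * nrm X x \<le> nrm E (j x)" if "x \<in> carrier X" for x
    using Y.nrm_nonneg[OF T'(1)[OF that]] by (simp add: E_def j_def)
  have B': "finite B'" "B' \<subseteq> carrier E" using B by (auto simp: B'_def Ec)
  have gen: "j ` carrier X \<union> B' \<subseteq> carrier E" using B'(2) bounded_mapD(1)[OF jb] by auto
  define Z0 where "Z0 = lin_span K E (j ` carrier X \<union> B')"
  have Z0: "submodule Z0 (scalar_ring K) E" unfolding Z0_def by (rule E.lin_span_submodule[OF gen])
  note Z0D = E.submodD[OF Z0]
  let ?G = "lin_span K Y B"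
  have G: "submodule ?G (scalar_ring K) Y" by (rule Y.lin_span_submodule[OF B(2)])
  note GD = Y.submodD[OF G]
  have Z0_fst: "T (fst a) \<ominus>\<^bsub>Y\<^esub> snd a \<in> ?G" if "a \<in> Z0" for a
  proof -
    have d: "bounded_map K E Y (\<lambda>a. T (fst a) \<ominus>\<^bsub>Y\<^esub> snd a)"
      by (rule bounded_map_diff[OF E Y bounded_map_comp[OF E X(1) Ebm(1) T] Ebm(2)])
    have "T (fst a) \<ominus>\<^bsub>Y\<^esub> snd a \<in> ?G" if a: "a \<in> j ` carrier X \<union> B'" for a
      using a
    proof
      assume "a \<in> j ` carrier X"
      then show ?thesis using T'(1) GD(2) by (auto simp: j_def)
    next
      assume "a \<in> B'"
      then obtain b where b: "b \<in> B" "a = (\<zero>\<^bsub>X\<^esub>, b)" by (auto simp: B'_def)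
      then have "T (fst a) \<ominus>\<^bsub>Y\<^esub> snd a = \<zero>\<^bsub>Y\<^esub> \<ominus>\<^bsub>Y\<^esub> b" by (simp add: bounded_map_zero[OF X(1) Y T])
      also have "\<dots> \<in> ?G" using b(1) Y.lin_span_superset[of B] by (intro Y.submod_minus[OF G GD(2)]) auto
      finally show ?thesis .
    qed
    then have "j ` carrier X \<union> B' \<subseteq> {a \<in> carrier E. T (fst a) \<ominus>\<^bsub>Y\<^esub> snd a \<in> ?G}" using gen by blast
    from E.lin_span_minimal[OF preimage_submodule[OF E Y d G] this] that
    show ?thesis unfolding Z0_def by blast
  qed
  have jZ0: "j x \<in> Z0" if "x \<in> carrier X" for x
    using that E.lin_span_superset[of "j ` carrier X \<union> B'"] unfolding Z0_def by blast
  have gZ0: "(\<zero>\<^bsub>X\<^esub>, g) \<in> Z0" if "g \<in> ?G" for g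
  proof -
    have "B' \<subseteq> Z0" using E.lin_span_superset[of "j ` carrier X \<union> B'"] unfolding Z0_def by blast
    then have "B \<subseteq> {y \<in> carrier Y. (\<zero>\<^bsub>X\<^esub>, y) \<in> Z0}" using B(2) by (auto simp: B'_def)
    from Y.lin_span_minimal[OF preimage_submodule[OF Y E Ebm(4) Z0] this] that
    show ?thesis by blast
  qed
  have FE: "E.complete_set Z0 \<and> (\<exists>r :: 'a \<times> (nat \<Rightarrow> complex) \<Rightarrow> 'a \<times> 'b. Z0 \<subseteq> range r)"
    unfolding Z0_def by (rule finite_extension[OF X(1,2) E jb \<eta> jlow B'])
  then obtain r :: "'a \<times> (nat \<Rightarrow> complex) \<Rightarrow> 'a \<times> 'b" where "Z0 \<subseteq> range r" by blast
  then obtain h :: "'a \<times> 'b \<Rightarrow> 'a universe" where h: "inj_on h Z0" by (rule universe_embedding)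
  define E' where "E' = E\<lparr>carrier := Z0\<rparr>"
  have E': "kspace K E'" unfolding E'_def by (rule kspace_subspace[OF E Z0])
  have E'c: "carrier E' = Z0" and E'n: "nrm E' = nrm E" by (simp_all add: E'_def)
  have E'm: "a \<ominus>\<^bsub>E'\<^esub> b = a \<ominus>\<^bsub>E\<^esub> b" if "a \<in> Z0" "b \<in> Z0" for a b
    unfolding E'_def by (rule subspace_minus[OF E Z0 that])
  have E'B: "banach_space K E'" unfolding E'_def by (rule banach_subspace[OF E Z0]) (use FE in blast)
  have h': "inj_on h (carrier E')" using h by (simp add: E'c)
  define Z where "Z = image_space h E'"
  have Z: "kspace K Z" unfolding Z_def by (rule kspace_image_space[OF E' h'])
  interpret Z: kspace K Z by (rule Z)
  have ZB: "banach_space K Z" unfolding Z_def by (rule banach_image_space[OF E' h' E'B])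
  note Zs = image_space_simps[OF h', folded Z_def]
  define hi where "hi = inv_into (carrier E') h"
  note hb = image_space_bounded_maps[OF E' h', folded Z_def hi_def]
  have hih: "hi (h a) = a" if "a \<in> Z0" for a using that h by (simp add: hi_def E'c)
  have hiZ: "hi z \<in> Z0" "h (hi z) = z" if "z \<in> carrier Z" for z
    using that unfolding Zs(1) hi_def by (auto simp: E'c inv_into_into f_inv_into_f)
  have p1: "bounded_map K Z X (\<lambda>z. fst (hi z))" and p2: "bounded_map K Z Y (\<lambda>z. snd (hi z))"
    unfolding E'_def
    by (rule bounded_map_comp[OF Z E' hb(2)],
        unfold E'_def, rule bounded_map_subspace[OF E Z0], rule Ebm)+
  define F where "F = {z \<in> carrier Z. \<forall>f\<in>{\<lambda>z. fst (hi z)}. f z = \<zero>\<^bsub>X\<^esub>}"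
  have Fcl: "closed_subspace K Z F"
    unfolding F_def by (rule kernel_closed_subspace[OF Z X(1)]) (use p1 in simp)
  then have F: "submodule F (scalar_ring K) Z" by (simp add: closed_subspace_def)
  have jb': "bounded_map K X Z (\<lambda>x. h (j x))"
  proof (rule bounded_map_comp[OF X(1) E' _ hb(1)])
    show "bounded_map K X E' j"
      using jb jZ0 unfolding bounded_map_def by (auto simp: E'_def)
  qed
  define Q where "Q = restrict (\<lambda>x. F +>\<^bsub>Z\<^esub> h (j x)) (carrier X)"
  have ZF: "kspace K (quotient_space Z F)" by (rule Z.kspace_quotient[OF Fcl])
  have Qop: "Q \<in> operators K X (quotient_space Z F)"
    unfolding Q_def
    by (rule restrict_operators[OF X(1) ZF bounded_map_comp[OF X(1) Z jb' Z.bounded_map_quotient[OF F]]])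
  have Qn: "opnorm X (quotient_space Z F) Q \<le> c + \<eta>"
  proof (rule opnorm_le[OF X(1)])
    fix x assume x: "x \<in> carrier X"
    obtain g where g: "g \<in> ?G" "nrm Y (T x \<ominus>\<^bsub>Y\<^esub> g) \<le> c * nrm X x" using app[OF x] by blast
    have gF: "h (\<zero>\<^bsub>X\<^esub>, g) \<in> F"
      unfolding F_def Zs(1) using gZ0[OF g(1)] hih[OF gZ0[OF g(1)]] by (simp add: E'c)
    have "nrm (quotient_space Z F) (Q x) \<le> nrm Z (h (j x) \<ominus>\<^bsub>Z\<^esub> h (\<zero>\<^bsub>X\<^esub>, g))"
      using Z.quotient_norm_le[OF F bounded_mapD(1)[OF jb' x] gF] x by (simp add: Q_def)
    also have "h (j x) \<ominus>\<^bsub>Z\<^esub> h (\<zero>\<^bsub>X\<^esub>, g) = h (j x \<ominus>\<^bsub>E\<^esub> (\<zero>\<^bsub>X\<^esub>, g))"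
      using bounded_map_minus[OF E' Z hb(1), of "j x" "(\<zero>\<^bsub>X\<^esub>, g)"] jZ0[OF x] gZ0[OF g(1)]
      by (simp add: E'c E'm)
    also have "nrm Z \<dots> = nrm E (j x \<ominus>\<^bsub>E\<^esub> (\<zero>\<^bsub>X\<^esub>, g))"
      using Zs(5) E.submod_minus[OF Z0 jZ0[OF x] gZ0[OF g(1)]] by (simp add: E'c E'n)
    also have "\<dots> = \<eta> * nrm X x + nrm Y (T x \<ominus>\<^bsub>Y\<^esub> g)"
      using prod_space_minus[OF X(1) Y \<eta>, of "j x" "(\<zero>\<^bsub>X\<^esub>, g)"] x T'(1) GD(5)[OF g(1)]
      by (simp add: E_def j_def)
    finally show "nrm (quotient_space Z F) (Q x) \<le> (c + \<eta>) * nrm X x"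
      using g(2) by (simp add: algebra_simps)
  qed (use c \<eta> in simp)
  \<comment> \<open>Chosen such that the lifted norm bound \<open>(1 + \<epsilon>) (c + \<eta>)\<close> is \<open>c + 2 \<eta> = c'\<close>.\<close>
  define \<epsilon> where "\<epsilon> = \<eta> / (c + \<eta>)"
  have \<epsilon>: "\<epsilon> > 0" using c \<eta> by (simp add: \<epsilon>_def)
  have "(1 + \<epsilon>) * (c + \<eta>) = c + \<eta> + \<eta>" using c \<eta> by (simp add: \<epsilon>_def distrib_right)
  also have "\<dots> = c'" by (simp add: \<eta>_def)
  finally have \<epsilon>': "(1 + \<epsilon>) * (c + \<eta>) = c'" .
  obtain S where S: "S \<in> operators K X Z" "opnorm X Z S \<le> (1 + \<epsilon>) * opnorm X (quotient_space Z F) Q"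
    and QS: "Q = compose (carrier X) (quotient_map Z F) S"
    using X(3) ZB Fcl Qop \<epsilon> unfolding metric_lifting_property_def by blast
  have Sb: "bounded_map K X Z S" using S(1) by (simp add: operators_iff[OF X(1) Z])
  have Sn: "nrm Z (S x) \<le> c' * nrm X x" if x: "x \<in> carrier X" for x
  proof -
    have "nrm Z (S x) \<le> opnorm X Z S * nrm X x" by (rule opnorm_upper[OF X(1) Z Sb x])
    also have "opnorm X Z S \<le> (1 + \<epsilon>) * (c + \<eta>)"
      using S(2) mult_left_mono[OF Qn, of "1 + \<epsilon>"] \<epsilon> by linarith
    then have "opnorm X Z S * nrm X x \<le> c' * nrm X x"
      using \<epsilon>' X.nrm_nonneg[OF x] by (simp add: mult_right_mono)
    finally show ?thesis .
  qed
  have Sx: "S x \<in> carrier Z" if "x \<in> carrier X" for x using bounded_mapD(1)[OF Sb that] .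
  have fstS: "fst (hi (S x)) = x" if x: "x \<in> carrier X" for x
  proof -
    have hj: "h (j x) \<in> carrier Z" using bounded_mapD(1)[OF jb' x] .
    have "F +>\<^bsub>Z\<^esub> h (j x) = F +>\<^bsub>Z\<^esub> S x"
      using fun_cong[OF QS, of x] x Sx[OF x] by (simp add: Q_def compose_def quotient_map_def)
    then have "h (j x) \<ominus>\<^bsub>Z\<^esub> S x \<in> F" using Z.coset_eq_iff[OF F hj Sx[OF x]] by simp
    then have "fst (hi (h (j x))) \<ominus>\<^bsub>X\<^esub> fst (hi (S x)) = \<zero>\<^bsub>X\<^esub>"
      using bounded_map_minus[OF Z X(1) p1 hj Sx[OF x]] by (simp add: F_def)
    then have "x \<ominus>\<^bsub>X\<^esub> fst (hi (S x)) = \<zero>\<^bsub>X\<^esub>" using hih[OF jZ0[OF x]] by (simp add: j_def)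
    then show ?thesis by (rule X.eq_if_minus_zero[OF x bounded_mapD(1)[OF p1 Sx[OF x]], symmetric])
  qed
  define A where "A x = T x \<ominus>\<^bsub>Y\<^esub> snd (hi (S x))" for x
  show ?thesis
  proof (rule that[of A])
    show "bounded_map K X Y A"
      unfolding A_def by (rule bounded_map_diff[OF X(1) Y T bounded_map_comp[OF X(1) Z Sb p2]])
    fix x assume x: "x \<in> carrier X"
    show "A x \<in> ?G" using Z0_fst[OF hiZ(1)[OF Sx[OF x]]] fstS[OF x] by (simp add: A_def)
    have s: "snd (hi (S x)) \<in> carrier Y" using bounded_mapD(1)[OF p2 Sx[OF x]] .
    have "nrm Y (T x \<ominus>\<^bsub>Y\<^esub> A x) = nrm Y (snd (hi (S x)))" using T'(1)[OF x] s by (simp add: A_def)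
    also have "\<dots> \<le> nrm E (hi (S x))" using \<eta> X.nrm_nonneg[OF x] fstS[OF x] by (simp add: E_def)
    also have "\<dots> = nrm Z (S x)" using Zs(5)[of "hi (S x)"] hiZ[OF Sx[OF x]] by (simp add: E'c E'n)
    also have "\<dots> \<le> c' * nrm X x" by (rule Sn[OF x])
    finally show "nrm Y (T x \<ominus>\<^bsub>Y\<^esub> A x) \<le> c' * nrm X x" .
  qed
qed

section \<open>Extension from a subspace of finite codimension\<close>

text \<open>
  Let \<open>M\<close> be the common kernel of \<open>C\<close>, and let \<open>P\<close> be the quotient of \<open>X \<times> Y\<close>, normed by
  \<open>c \<parallel>x\<parallel> + \<parallel>y\<parallel>\<close>, by all \<open>(m, - T m)\<close> with \<open>m \<in> M\<close>. The bound \<open>\<parallel>T m\<parallel> \<le> c \<parallel>m\<parallel>\<close> says exactly that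
  passing to \<open>P\<close> does not shorten the vectors \<open>(0, y)\<close>. So the inverse of the embedding of \<open>Y\<close> into \<open>P\<close> has
  norm at most \<open>1\<close> and extends to \<open>P\<close>. Composed with \<open>x \<mapsto> (x, 0)\<close>, of norm at most \<open>c\<close>, it
  agrees with \<open>T\<close> on \<open>M\<close>, because \<open>(m, 0)\<close> and \<open>(0, T m)\<close> are the same element of \<open>P\<close>.
\<close>

lemma extension_approximation:
  fixes X :: "'a nspace" and Y :: "'b nspace"
  assumes X: "kspace K X" and Y: "kspace K Y" "banach_space K Y" "metric_extension_property K Y"
    and T: "bounded_map K X Y T" and C: "finite C" "C \<subseteq> carrier (dual K X)" and c: "c > 0"
    and small: "\<And>m. m \<in> carrier X \<Longrightarrow> (\<And>\<phi>. \<phi> \<in> C \<Longrightarrow> \<phi> m = 0) \<Longrightarrow> nrm Y (T m) \<le> c * nrm X m"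
  obtains S where "bounded_map K X Y S" "\<And>x. x \<in> carrier X \<Longrightarrow> nrm Y (S x) \<le> c * nrm X x"
    "\<And>m. m \<in> carrier X \<Longrightarrow> (\<And>\<phi>. \<phi> \<in> C \<Longrightarrow> \<phi> m = 0) \<Longrightarrow> S m = T m"
proof -
  interpret X: kspace K X by fact
  interpret Y: kspace K Y by fact
  define E where "E = prod_space c X Y"
  have E: "kspace K E" unfolding E_def by (rule kspace_prod_space[OF X Y(1) c])
  interpret E: kspace K E by (rule E)
  note Ebm = prod_space_bounded_maps[OF X Y(1) c, folded E_def]
  note T' = bounded_mapD[OF T]
  have Ec: "carrier E = carrier X \<times> carrier Y" by (simp add: E_def)
  have Em: "(x, y) \<ominus>\<^bsub>E\<^esub> (x', y') = (x \<ominus>\<^bsub>X\<^esub> x', y \<ominus>\<^bsub>Y\<^esub> y')"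
    if "x \<in> carrier X" "y \<in> carrier Y" "x' \<in> carrier X" "y' \<in> carrier Y" for x y x' y'
    using prod_space_minus[OF X Y(1) c, of "(x, y)" "(x', y')"] that by (simp add: E_def)
  have SK: "kspace K (scalar_space K)" by (rule kspace_scalar_space[OF X.scalars])
  have Cb: "bounded_map K X (scalar_space K) \<phi>" if "\<phi> \<in> C" for \<phi>
    using that C(2) by (auto simp: dual_iff[OF X])
  define N where "N = {a \<in> carrier E. \<forall>f\<in>(\<lambda>\<phi> a. \<phi> (fst a)) ` C. f a = \<zero>\<^bsub>scalar_space K\<^esub>}
    \<inter> {a \<in> carrier E. \<forall>f\<in>{\<lambda>a. T (fst a) \<oplus>\<^bsub>Y\<^esub> snd a}. f a = \<zero>\<^bsub>Y\<^esub>}"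
  have Ncl: "closed_subspace K E N"
    unfolding N_def
  proof (rule closed_subspace_Int[OF E kernel_closed_subspace[OF E SK] kernel_closed_subspace[OF E Y(1)]])
    show "bounded_map K E (scalar_space K) f" if "f \<in> (\<lambda>\<phi> a. \<phi> (fst a)) ` C" for f
      using that bounded_map_comp[OF E X Ebm(1) Cb] by blast
    show "bounded_map K E Y f" if "f \<in> {\<lambda>a. T (fst a) \<oplus>\<^bsub>Y\<^esub> snd a}" for f
      using that bounded_map_add[OF E Y(1) bounded_map_comp[OF E X Ebm(1) T] Ebm(2)] by simp
  qed
  then have N: "submodule N (scalar_ring K) E" by (simp add: closed_subspace_def)
  have Niff: "(x, y) \<in> N \<longleftrightarrow> x \<in> carrier X \<and> y \<in> carrier Y \<and> (\<forall>\<phi>\<in>C. \<phi> x = 0) \<and> y = \<ominus>\<^bsub>Y\<^esub> T x" for x y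
    using Y.M.minus_equality[of y "T x"] T'(1) by (auto simp: N_def Ec Y.M.r_neg Y.M.a_comm)
  define P where "P = quotient_space E N"
  define q where "q a = N +>\<^bsub>E\<^esub> a" for a
  have P: "kspace K P" unfolding P_def by (rule E.kspace_quotient[OF Ncl])
  interpret P: kspace K P by (rule P)
  have qb: "bounded_map K E P q" unfolding P_def q_def by (rule E.bounded_map_quotient[OF N])
  have q_eq: "q a = q b \<longleftrightarrow> a \<ominus>\<^bsub>E\<^esub> b \<in> N" if "a \<in> carrier E" "b \<in> carrier E" for a b
    unfolding q_def by (rule E.coset_eq_iff[OF N that])
  define j where "j y = q (\<zero>\<^bsub>X\<^esub>, y)" for y
  define i where "i x = q (x, \<zero>\<^bsub>Y\<^esub>)" for x
  have jb: "bounded_map K Y P j" unfolding j_def by (rule bounded_map_comp[OF Y(1) E Ebm(4) qb])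
  have ib: "bounded_map K X P i" unfolding i_def by (rule bounded_map_comp[OF X E Ebm(3) qb])
  have jlow: "1 * nrm Y y \<le> nrm P (j y)" if y: "y \<in> carrier Y" for y
    unfolding P_def j_def q_def
  proof (rule E.quotient_norm_ge[OF N])
    show "(\<zero>\<^bsub>X\<^esub>, y) \<in> carrier E" using y by (simp add: Ec)
    fix a assume a: "a \<in> N"
    obtain m z where mz: "a = (m, z)" by (cases a)
    then have m: "m \<in> carrier X" "\<And>\<phi>. \<phi> \<in> C \<Longrightarrow> \<phi> m = 0" and z: "z = \<ominus>\<^bsub>Y\<^esub> T m" "z \<in> carrier Y"
      using a Niff by auto
    have "nrm Y y \<le> nrm Y (y \<ominus>\<^bsub>Y\<^esub> z) + nrm Y z"
      using Y.nrm_triangle[of "y \<ominus>\<^bsub>Y\<^esub> z" z] y z(2) by simp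
    also have "nrm Y z \<le> c * nrm X m" using small[of m] m z(1) T'(1)[OF m(1)] by simp
    finally show "1 * nrm Y y \<le> nrm E ((\<zero>\<^bsub>X\<^esub>, y) \<ominus>\<^bsub>E\<^esub> a)"
      using Em[of "\<zero>\<^bsub>X\<^esub>" y m z] y m(1) z(2) X.nrm_minus_commute[of "\<zero>\<^bsub>X\<^esub>" m] by (simp add: mz) (simp add: E_def)
  qed
  have "\<exists>B. B \<subseteq> carrier X \<and> finite B \<and> card B \<le> card C \<and>
     (\<forall>x\<in>carrier X. \<exists>s\<in>lin_span K X B. \<forall>e\<in>C. e s = e x)"
    by (rule X.finite_functionals_split[OF C(1)]) (use bounded_mapD[OF Cb] in auto)
  then obtain B where B: "B \<subseteq> carrier X" "finite B"
    and Bs: "\<And>x. x \<in> carrier X \<Longrightarrow> \<exists>s\<in>lin_span K X B. \<forall>\<phi>\<in>C. \<phi> s = \<phi> x" by auto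
  have iB: "finite (i ` B)" "i ` B \<subseteq> carrier P" using B bounded_mapD(1)[OF ib] by auto
  have gen: "j ` carrier Y \<union> i ` B \<subseteq> carrier P" using iB(2) bounded_mapD(1)[OF jb] by auto
  let ?L = "lin_span K P (j ` carrier Y \<union> i ` B)"
  have L: "submodule ?L (scalar_ring K) P" by (rule P.lin_span_submodule[OF gen])
  have Lsup: "j ` carrier Y \<subseteq> ?L" "i ` B \<subseteq> ?L" using P.lin_span_superset[of "j ` carrier Y \<union> i ` B"] by auto
  \<comment> \<open>Split \<open>x = s + m\<close> with \<open>s\<close> in a finite span and \<open>m \<in> M\<close>; in \<open>P\<close>, \<open>(m, y)\<close> is \<open>(0, T m + y)\<close>.\<close>
  have "carrier P \<subseteq> ?L"
  proof
    fix a assume "a \<in> carrier P"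
    then obtain x y where a: "a = q (x, y)" "x \<in> carrier X" "y \<in> carrier Y"
      unfolding P_def E.coset_carrier q_def Ec by blast
    obtain s where s: "s \<in> lin_span K X B" "\<forall>\<phi>\<in>C. \<phi> s = \<phi> x" using Bs[OF a(2)] by blast
    have sc: "s \<in> carrier X" using X.lin_span_carrier[OF B(1)] s(1) by blast
    define m where "m = x \<ominus>\<^bsub>X\<^esub> s"
    have m: "m \<in> carrier X" using a(2) sc by (simp add: m_def)
    have Tm: "T m \<in> carrier Y" using T'(1)[OF m] .
    have m0: "\<forall>\<phi>\<in>C. \<phi> m = 0"
    proof
      interpret SK: kspace K "scalar_space K" by (rule SK)
      fix \<phi> assume f: "\<phi> \<in> C"
      have "\<phi> x \<in> K" using bounded_mapD(1)[OF Cb[OF f] a(2)] by simp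
      then have "\<phi> x \<ominus>\<^bsub>scalar_space K\<^esub> \<phi> x = 0" using SK.minus_self[of "\<phi> x"] by simp
      moreover have "\<phi> s = \<phi> x" using s(2) f by blast
      ultimately show "\<phi> m = 0" using bounded_map_minus[OF X SK Cb[OF f] a(2) sc] by (simp add: m_def)
    qed
    have "y \<ominus>\<^bsub>Y\<^esub> (T m \<oplus>\<^bsub>Y\<^esub> y) = \<ominus>\<^bsub>Y\<^esub> T m"
      using a(3) Tm by (simp add: a_minus_def Y.M.minus_add Y.M.a_ac Y.M.r_neg2 Y.M.r_neg1)
    then have "(x, y) \<ominus>\<^bsub>E\<^esub> (s, T m \<oplus>\<^bsub>Y\<^esub> y) \<in> N"
      using Em[OF a(2,3) sc, of "T m \<oplus>\<^bsub>Y\<^esub> y"] Tm a(3) m m0 by (simp add: Niff m_def[symmetric])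
    then have "a = q (s, T m \<oplus>\<^bsub>Y\<^esub> y)"
      unfolding a(1) using q_eq[of "(x, y)" "(s, T m \<oplus>\<^bsub>Y\<^esub> y)"] a(2,3) sc Tm by (simp add: Ec)
    also have "\<dots> = q ((s, \<zero>\<^bsub>Y\<^esub>) \<oplus>\<^bsub>E\<^esub> (\<zero>\<^bsub>X\<^esub>, T m \<oplus>\<^bsub>Y\<^esub> y))"
      using sc Tm a(3) by (simp add: E_def)
    also have "\<dots> = i s \<oplus>\<^bsub>P\<^esub> j (T m \<oplus>\<^bsub>Y\<^esub> y)"
      unfolding i_def j_def using sc Tm a(3) by (intro bounded_mapD(2)[OF qb]) (auto simp: Ec)
    also have "\<dots> \<in> ?L"
    proof (rule P.submodD(3)[OF L])
      have "B \<subseteq> {x \<in> carrier X. i x \<in> ?L}" using B(1) Lsup(2) by blast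
      from X.lin_span_minimal[OF preimage_submodule[OF X P ib L] this] s(1)
      show "i s \<in> ?L" by blast
      have "T m \<oplus>\<^bsub>Y\<^esub> y \<in> carrier Y" using Tm a(3) by simp
      then show "j (T m \<oplus>\<^bsub>Y\<^esub> y) \<in> ?L" using Lsup(1) by blast
    qed
    finally show "a \<in> ?L" .
  qed
  then have Lc: "?L = carrier P" using P.lin_span_carrier[OF gen] by blast
  have FE: "P.complete_set (carrier P) \<and>
    (\<exists>r :: 'b \<times> (nat \<Rightarrow> complex) \<Rightarrow> ('a \<times> 'b) set. carrier P \<subseteq> range r)"
    using finite_extension[OF Y(1,2) P jb zero_less_one jlow iB] unfolding Lc .
  then obtain r :: "'b \<times> (nat \<Rightarrow> complex) \<Rightarrow> ('a \<times> 'b) set" where "carrier P \<subseteq> range r" by blast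
  then obtain h :: "('a \<times> 'b) set \<Rightarrow> 'b universe" where h: "inj_on h (carrier P)" by (rule universe_embedding)
  have PB: "banach_space K P" using FE by (simp add: banach_space_iff[OF P])
  define Z where "Z = image_space h P"
  have Z: "kspace K Z" unfolding Z_def by (rule kspace_image_space[OF P h])
  interpret Z: kspace K Z by (rule Z)
  have ZB: "banach_space K Z" unfolding Z_def by (rule banach_image_space[OF P h PB])
  note Zs = image_space_simps[OF h, folded Z_def]
  note hb = image_space_bounded_maps(1)[OF P h, folded Z_def]
  define k where "k y = h (j y)" for y
  have kb: "bounded_map K Y Z k" unfolding k_def by (rule bounded_map_comp[OF Y(1) P jb hb])
  have klow: "1 * nrm Y y \<le> nrm Z (k y)" if "y \<in> carrier Y" for y
    using jlow[OF that] bounded_mapD(1)[OF jb that] by (simp add: k_def Zs(5))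
  have kinj: "y = y'" if y: "y \<in> carrier Y" "y' \<in> carrier Y" "k y = k y'" for y y'
  proof -
    have "k (y \<ominus>\<^bsub>Y\<^esub> y') = \<zero>\<^bsub>Z\<^esub>"
      using bounded_map_minus[OF Y(1) Z kb y(1,2)] y(3) bounded_mapD(1)[OF kb y(2)] by simp
    then have "nrm Y (y \<ominus>\<^bsub>Y\<^esub> y') \<le> 0" using klow[of "y \<ominus>\<^bsub>Y\<^esub> y'"] y by simp
    then have "y \<ominus>\<^bsub>Y\<^esub> y' = \<zero>\<^bsub>Y\<^esub>" using Y.nrm_nonneg[of "y \<ominus>\<^bsub>Y\<^esub> y'"] Y.nrm_eq_0[of "y \<ominus>\<^bsub>Y\<^esub> y'"] y by simp
    then show ?thesis using Y.eq_if_minus_zero y by blast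
  qed
  define M where "M = k ` carrier Y"
  have M: "submodule M (scalar_ring K) Z"
    unfolding M_def by (rule image_submodule[OF Y(1) Z kb Y.carrier_is_submodule])
  note MD = Z.submodD[OF M]
  have "Z.complete_set M"
    unfolding M_def using Y(2) by (intro complete_set_image[OF Y(1) Z kb zero_less_one klow])
      (simp_all add: banach_space_iff[OF Y(1)])
  then have Mcl: "closed_subspace K Z M"
    using Z.complete_set_closed[OF _ MD(1)] M by (simp add: closed_subspace_def)
  define ZM where "ZM = Z\<lparr>carrier := M\<rparr>"
  have ZM: "kspace K ZM" unfolding ZM_def by (rule kspace_subspace[OF Z M])
  have ZMs: "carrier ZM = M" "add ZM = add Z" "smult ZM = smult Z" "nrm ZM = nrm Z" by (simp_all add: ZM_def)
  define k' where "k' = inv_into (carrier Y) k"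
  have k'k: "k' (k y) = y" if "y \<in> carrier Y" for y
    unfolding k'_def by (rule inv_into_f_f[OF _ that]) (use kinj in \<open>auto simp: inj_on_def\<close>)
  have k'n: "nrm Y (k' z) \<le> 1 * nrm ZM z" if "z \<in> carrier ZM" for z
    using that klow k'k by (auto simp: ZMs M_def)
  have k'b: "bounded_map K ZM Y k'"
  proof (rule bounded_mapI[where C = 1])
    fix z assume "z \<in> carrier ZM"
    then show "nrm Y (k' z) \<le> 1 * nrm ZM z" by (rule k'n)
    show "k' z \<in> carrier Y" using \<open>z \<in> carrier ZM\<close> k'k by (auto simp: ZMs M_def)
  next
    fix z z' assume "z \<in> carrier ZM" "z' \<in> carrier ZM"
    then obtain y y' where "z = k y" "z' = k y'" "y \<in> carrier Y" "y' \<in> carrier Y" by (auto simp: ZMs M_def)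
    then show "k' (z \<oplus>\<^bsub>ZM\<^esub> z') = k' z \<oplus>\<^bsub>Y\<^esub> k' z'"
      by (simp add: ZMs k'k bounded_mapD(2)[OF kb, symmetric])
  next
    fix d z assume d: "d \<in> K" and "z \<in> carrier ZM"
    then obtain y where "z = k y" "y \<in> carrier Y" by (auto simp: ZMs M_def)
    then show "k' (d \<odot>\<^bsub>ZM\<^esub> z) = d \<odot>\<^bsub>Y\<^esub> k' z"
      using d by (simp add: ZMs k'k bounded_mapD(3)[OF kb, symmetric])
  qed
  define R where "R = restrict k' M"
  have Rop: "R \<in> operators K ZM Y"
    using restrict_operators[OF ZM Y(1) k'b] by (simp add: R_def ZMs)
  have Rn: "opnorm ZM Y R \<le> 1"
    by (rule opnorm_le[OF ZM]) (use k'n in \<open>auto simp: R_def ZMs\<close>)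
  obtain S where S: "S \<in> operators K Z Y" "R = compose M S (\<lambda>x\<in>M. x)" "opnorm ZM Y R = opnorm Z Y S"
    using Y(3) ZB Mcl Rop unfolding metric_extension_property_def ZM_def by blast
  have Sb: "bounded_map K Z Y S" using S(1) by (simp add: operators_iff[OF Z Y(1)])
  have Sk: "S (k y) = y" if y: "y \<in> carrier Y" for y
  proof -
    have "k y \<in> M" using y by (simp add: M_def)
    then show ?thesis using fun_cong[OF S(2), of "k y"] k'k[OF y] by (simp add: R_def compose_def)
  qed
  have ic: "i x \<in> carrier P" if "x \<in> carrier X" for x using bounded_mapD(1)[OF ib that] .
  show ?thesis
  proof (rule that[of "\<lambda>x. S (h (i x))"])
    show "bounded_map K X Y (\<lambda>x. S (h (i x)))"
      by (rule bounded_map_comp[OF X Z bounded_map_comp[OF X P ib hb] Sb])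
    fix x assume x: "x \<in> carrier X"
    have hix: "h (i x) \<in> carrier Z" using bounded_mapD(1)[OF hb ic[OF x]] .
    have "nrm Y (S (h (i x))) \<le> opnorm Z Y S * nrm Z (h (i x))" by (rule opnorm_upper[OF Z Y(1) Sb hix])
    also have "\<dots> \<le> 1 * nrm Z (h (i x))"
      using Rn S(3) Z.nrm_nonneg[OF hix] by (intro mult_right_mono) auto
    also have "\<dots> = nrm P (i x)" using Zs(5) ic[OF x] by simp
    also have "\<dots> \<le> nrm E ((x, \<zero>\<^bsub>Y\<^esub>) \<ominus>\<^bsub>E\<^esub> \<zero>\<^bsub>E\<^esub>)"
      unfolding P_def i_def q_def
      by (rule E.quotient_norm_le[OF N _ E.submodD(2)[OF N]]) (simp add: Ec x)
    also have "\<dots> = c * nrm X x" using x E.minus_zero'[of "(x, \<zero>\<^bsub>Y\<^esub>)"] by (simp add: Ec) (simp add: E_def)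
    finally show "nrm Y (S (h (i x))) \<le> c * nrm X x" .
  next
    fix m assume m: "m \<in> carrier X" "\<And>\<phi>. \<phi> \<in> C \<Longrightarrow> \<phi> m = 0"
    have Tm: "T m \<in> carrier Y" using T'(1)[OF m(1)] .
    have "\<zero>\<^bsub>Y\<^esub> \<ominus>\<^bsub>Y\<^esub> T m = \<ominus>\<^bsub>Y\<^esub> T m" using Tm by (simp add: a_minus_def)
    then have "(m, \<zero>\<^bsub>Y\<^esub>) \<ominus>\<^bsub>E\<^esub> (\<zero>\<^bsub>X\<^esub>, T m) \<in> N"
      using Em[of m "\<zero>\<^bsub>Y\<^esub>" "\<zero>\<^bsub>X\<^esub>" "T m"] m Tm by (simp add: Niff)
    then have "i m = j (T m)"
      unfolding i_def j_def using q_eq[of "(m, \<zero>\<^bsub>Y\<^esub>)" "(\<zero>\<^bsub>X\<^esub>, T m)"] m(1) Tm by (simp add: Ec)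
    then show "S (h (i m)) = T m" using Sk[OF Tm] by (simp add: k_def)
  qed
qed

section \<open>The diameters of an operator and of its adjoint\<close>

text \<open>
  If \<open>A\<close> maps into the span of \<open>B\<close>, then \<open>A\<^sup>* \<psi>\<close> depends only on the values of \<open>\<psi>\<close> on \<open>B\<close>. Splitting
  the dual of \<open>Y\<close> along the evaluations at the points of \<open>B\<close> therefore shows that the range of \<open>A\<^sup>*\<close> is
  spanned by at most \<open>card B\<close> functionals.
\<close>

lemma kolmogorov_diameter_adjoint_le:
  fixes X :: "'a nspace" and Y :: "'b nspace"
  assumes X: "kspace K X" "banach_space K X" "metric_lifting_property K X" and Y: "kspace K Y"
    and T: "bounded_map K X Y T"
  shows "kolmogorov_diameter K (dual K Y) (dual K X) n (adjoint_op K X Y T) \<le> kolmogorov_diameter K X Y n T"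
proof (rule field_le_epsilon)
  fix e :: real assume e: "e > 0"
  let ?d = "kolmogorov_diameter K X Y n T"
  interpret X: kspace K X by fact
  interpret Y: kspace K Y by fact
  interpret DX: kspace K "dual K X" by (rule kspace_dual[OF X(1)])
  interpret DY: kspace K "dual K Y" by (rule kspace_dual[OF Y])
  have SK: "kspace K (scalar_space K)" by (rule kspace_scalar_space[OF X.scalars])
  interpret SK: kspace K "scalar_space K" by (rule SK)
  note T' = bounded_mapD[OF T]
  have d: "0 \<le> ?d" by (rule kolmogorov_diameter_nonneg[OF X(1) Y T])
  obtain B where B: "finite B" "card B \<le> n" "B \<subseteq> carrier Y"
    and app: "\<And>x. x \<in> carrier X \<Longrightarrow> \<exists>g\<in>lin_span K Y B. nrm Y (T x \<ominus>\<^bsub>Y\<^esub> g) \<le> (?d + e / 2) * nrm X x"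
    using kolmogorov_diameter_approx[OF X(1) Y T half_gt_zero[OF e], of n] by blast
  have c: "0 \<le> ?d + e / 2" "?d + e / 2 < ?d + e" using d e by simp_all
  obtain A where A: "bounded_map K X Y A" "\<And>x. x \<in> carrier X \<Longrightarrow> A x \<in> lin_span K Y B"
    and TA: "\<And>x. x \<in> carrier X \<Longrightarrow> nrm Y (T x \<ominus>\<^bsub>Y\<^esub> A x) \<le> (?d + e) * nrm X x"
    using lifting_approximation[OF X Y T B(1,3) c app] by blast
  note A' = bounded_mapD[OF A(1)]
  let ?E = "(\<lambda>b (\<psi> :: 'b \<Rightarrow> complex). \<psi> b) ` B"
  have ev: "bounded_map K (dual K Y) (scalar_space K) f" if "f \<in> ?E" for f
    using that bounded_map_eval[OF Y] B(3) by auto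
  have "\<exists>C. C \<subseteq> carrier (dual K Y) \<and> finite C \<and> card C \<le> card ?E \<and>
     (\<forall>x\<in>carrier (dual K Y). \<exists>s\<in>lin_span K (dual K Y) C. \<forall>f\<in>?E. f s = f x)"
    by (rule DY.finite_functionals_split) (use B(1) bounded_mapD[OF ev] in auto)
  then obtain C where C: "C \<subseteq> carrier (dual K Y)" "finite C" "card C \<le> card ?E"
    and Cs: "\<And>\<psi>. \<psi> \<in> carrier (dual K Y) \<Longrightarrow> \<exists>\<theta>\<in>lin_span K (dual K Y) C. \<forall>f\<in>?E. f \<theta> = f \<psi>" by auto
  let ?As = "adjoint_op K X Y A" and ?Ts = "adjoint_op K X Y T"
  have As: "bounded_map K (dual K Y) (dual K X) ?As" by (rule bounded_map_adjoint[OF X(1) Y A(1)])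
  have Ts: "bounded_map K (dual K Y) (dual K X) ?Ts" by (rule bounded_map_adjoint[OF X(1) Y T])
  show "kolmogorov_diameter K (dual K Y) (dual K X) n ?Ts \<le> ?d + e"
  proof (rule kolmogorov_diameter_le[OF DY.kspace_axioms DX.kspace_axioms Ts])
    show "finite (?As ` C)" using C(2) by simp
    have "card (?As ` C) \<le> card C" by (rule card_image_le[OF C(2)])
    also have "\<dots> \<le> card B" using C(3) card_image_le[OF B(1), of "\<lambda>b (\<psi> :: 'b \<Rightarrow> complex). \<psi> b"] by (rule order_trans)
    finally show "card (?As ` C) \<le> n" using B(2) by simp
    show sub: "?As ` C \<subseteq> carrier (dual K X)" using C(1) bounded_mapD(1)[OF As] by auto
    show "0 \<le> ?d + e" using d e by simp
    fix \<psi> assume psi: "\<psi> \<in> carrier (dual K Y)"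
    obtain \<theta> where chi: "\<theta> \<in> lin_span K (dual K Y) C" "\<forall>f\<in>?E. f \<theta> = f \<psi>" using Cs[OF psi] by blast
    have chic: "\<theta> \<in> carrier (dual K Y)" using DY.lin_span_carrier[OF C(1)] chi(1) by blast
    have psib: "bounded_map K Y (scalar_space K) \<psi>" and chib: "bounded_map K Y (scalar_space K) \<theta>"
      using psi chic by (simp_all add: dual_iff[OF Y])
    have eq: "\<theta> y = \<psi> y" if "y \<in> lin_span K Y B" for y
    proof -
      have "submodule {y \<in> carrier Y. \<theta> y = \<psi> y} (scalar_ring K) Y"
        unfolding Y.submod_iff
        using bounded_mapD[OF psib] bounded_mapD[OF chib]
          bounded_map_zero[OF Y SK psib] bounded_map_zero[OF Y SK chib] by auto
      from Y.lin_span_minimal[OF this, of B] that chi(2) B(3) show ?thesis by auto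
    qed
    have "?As ` C \<subseteq> lin_span K (dual K X) (?As ` C)" by (rule DX.lin_span_superset)
    then have "C \<subseteq> {\<phi> \<in> carrier (dual K Y). ?As \<phi> \<in> lin_span K (dual K X) (?As ` C)}" using C(1) by blast
    from DY.lin_span_minimal[OF preimage_submodule[OF DY.kspace_axioms DX.kspace_axioms As
        DX.lin_span_submodule[OF sub]] this] chi(1)
    have in_span: "?As \<theta> \<in> lin_span K (dual K X) (?As ` C)" by blast
    have "nrm (dual K X) (?Ts \<psi> \<ominus>\<^bsub>dual K X\<^esub> ?As \<theta>) \<le> (?d + e) * nrm (dual K Y) \<psi>"
    proof (rule dual_norm_le[OF X(1)])
      have n: "0 \<le> nrm (dual K Y) \<psi>" by (rule DY.nrm_nonneg[OF psi])
      then show "0 \<le> (?d + e) * nrm (dual K Y) \<psi>" using d e by simp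
      fix x assume x: "x \<in> carrier X"
      have dd: "?Ts \<psi> \<in> operators K X (scalar_space K)" "?As \<theta> \<in> operators K X (scalar_space K)"
        using bounded_mapD(1)[OF Ts psi] bounded_mapD(1)[OF As chic] by (simp_all add: dual_def)
      have "(?Ts \<psi> \<ominus>\<^bsub>dual K X\<^esub> ?As \<theta>) x = ?Ts \<psi> x \<ominus>\<^bsub>scalar_space K\<^esub> ?As \<theta> x"
        unfolding dual_def by (rule op_space_minus[OF X(1) SK dd x])
      also have "\<dots> = \<psi> (T x) \<ominus>\<^bsub>scalar_space K\<^esub> \<psi> (A x)"
        using psi chic x eq[OF A(2)[OF x]] by (simp add: adjoint_op_def compose_def)
      also have "\<dots> = \<psi> (T x \<ominus>\<^bsub>Y\<^esub> A x)"
        using bounded_map_minus[OF Y SK psib T'(1)[OF x] A'(1)[OF x]] by simp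
      also have "cmod \<dots> \<le> nrm (dual K Y) \<psi> * nrm Y (T x \<ominus>\<^bsub>Y\<^esub> A x)"
        using T'(1)[OF x] A'(1)[OF x] by (intro dual_norm_upper[OF Y psi]) auto
      also have "\<dots> \<le> nrm (dual K Y) \<psi> * ((?d + e) * nrm X x)" using TA[OF x] n by (rule mult_left_mono)
      finally show "cmod ((?Ts \<psi> \<ominus>\<^bsub>dual K X\<^esub> ?As \<theta>) x) \<le> (?d + e) * nrm (dual K Y) \<psi> * nrm X x"
        by (simp add: mult_ac)
    qed
    with in_span show "\<exists>g\<in>lin_span K (dual K X) (?As ` C).
        nrm (dual K X) (?Ts \<psi> \<ominus>\<^bsub>dual K X\<^esub> g) \<le> (?d + e) * nrm (dual K Y) \<psi>" by blast
  qed
qed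

text \<open>
  A functional \<open>\<theta>\<close> in the span of \<open>C\<close> vanishes on the common kernel of \<open>C\<close>, so there \<open>\<psi> (T m)\<close> equals
  \<open>(T\<^sup>* \<psi> - \<theta>) m\<close>. A functional \<open>\<psi>\<close> norming \<open>T m\<close> turns the approximation of \<open>T\<^sup>* \<psi>\<close> by such \<open>\<theta>\<close> into
  a bound for \<open>\<parallel>T m\<parallel>\<close>.
\<close>

lemma kolmogorov_diameter_le_adjoint:
  fixes X :: "'a nspace" and Y :: "'b nspace"
  assumes X: "kspace K X" and Y: "kspace K Y" "banach_space K Y" "metric_extension_property K Y"
    and T: "bounded_map K X Y T"
  shows "kolmogorov_diameter K X Y n T \<le> kolmogorov_diameter K (dual K Y) (dual K X) n (adjoint_op K X Y T)"
proof (rule field_le_epsilon)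
  fix e :: real assume e: "e > 0"
  let ?Ts = "adjoint_op K X Y T"
  let ?c = "kolmogorov_diameter K (dual K Y) (dual K X) n ?Ts + e"
  interpret X: kspace K X by fact
  interpret Y: kspace K Y by fact
  interpret DX: kspace K "dual K X" by (rule kspace_dual[OF X])
  interpret DY: kspace K "dual K Y" by (rule kspace_dual[OF Y(1)])
  have SK: "kspace K (scalar_space K)" by (rule kspace_scalar_space[OF X.scalars])
  interpret SK: kspace K "scalar_space K" by (rule SK)
  note T' = bounded_mapD[OF T]
  have Ts: "bounded_map K (dual K Y) (dual K X) ?Ts" by (rule bounded_map_adjoint[OF X Y(1) T])
  have c: "?c > 0"
    using kolmogorov_diameter_nonneg[OF DY.kspace_axioms DX.kspace_axioms Ts, of n] e by simp
  obtain C where C: "finite C" "card C \<le> n" "C \<subseteq> carrier (dual K X)"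
    and app: "\<And>\<psi>. \<psi> \<in> carrier (dual K Y) \<Longrightarrow> \<exists>\<theta>\<in>lin_span K (dual K X) C.
        nrm (dual K X) (?Ts \<psi> \<ominus>\<^bsub>dual K X\<^esub> \<theta>) \<le> ?c * nrm (dual K Y) \<psi>"
    using kolmogorov_diameter_approx[OF DY.kspace_axioms DX.kspace_axioms Ts e, of n] by blast
  have small: "nrm Y (T m) \<le> ?c * nrm X m"
    if m: "m \<in> carrier X" and m0: "\<And>\<phi>. \<phi> \<in> C \<Longrightarrow> \<phi> m = 0" for m
  proof -
    obtain \<psi> where psi: "\<psi> \<in> operators K Y (scalar_space K)"
      "\<And>y. y \<in> carrier Y \<Longrightarrow> cmod (\<psi> y) \<le> nrm Y y" "cmod (\<psi> (T m)) = nrm Y (T m)"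
      using Y.norming_functional[OF T'(1)[OF m]] by blast
    have psic: "\<psi> \<in> carrier (dual K Y)" using psi(1) by (simp add: dual_def)
    have psin: "nrm (dual K Y) \<psi> \<le> 1" using psi(2) by (intro dual_norm_le[OF Y(1)]) auto
    obtain \<theta> where chi: "\<theta> \<in> lin_span K (dual K X) C"
      "nrm (dual K X) (?Ts \<psi> \<ominus>\<^bsub>dual K X\<^esub> \<theta>) \<le> ?c * nrm (dual K Y) \<psi>" using app[OF psic] by blast
    have chic: "\<theta> \<in> carrier (dual K X)" using DX.lin_span_carrier[OF C(3)] chi(1) by blast
    have "submodule {\<phi> \<in> carrier (dual K X). \<forall>f\<in>{\<lambda>\<phi>. \<phi> m}. f \<phi> = \<zero>\<^bsub>scalar_space K\<^esub>} (scalar_ring K) (dual K X)"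
      using kernel_closed_subspace[OF DX.kspace_axioms SK, of "{\<lambda>\<phi>. \<phi> m}"] bounded_map_eval[OF X m]
      by (simp add: closed_subspace_def)
    from DX.lin_span_minimal[OF this, of C] C(3) m0 chi(1) have chi0: "\<theta> m = 0" by auto
    have TsT: "?Ts \<psi> \<in> carrier (dual K X)" using bounded_mapD(1)[OF Ts psic] .
    then have dd: "?Ts \<psi> \<in> operators K X (scalar_space K)" "\<theta> \<in> operators K X (scalar_space K)"
      using chic by (simp_all add: dual_def)
    have pT: "\<psi> (T m) \<in> carrier (scalar_space K)"
      using bounded_mapD(1)[of K Y "scalar_space K" \<psi>] psic T'(1)[OF m] by (simp add: dual_iff[OF Y(1)])
    have "(?Ts \<psi> \<ominus>\<^bsub>dual K X\<^esub> \<theta>) m = ?Ts \<psi> m \<ominus>\<^bsub>scalar_space K\<^esub> \<theta> m"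
      unfolding dual_def by (rule op_space_minus[OF X SK dd m])
    also have "\<dots> = \<psi> (T m)"
      using SK.minus_zero'[OF pT] psic m chi0 by (simp add: adjoint_op_def compose_def)
    finally have "nrm Y (T m) = cmod ((?Ts \<psi> \<ominus>\<^bsub>dual K X\<^esub> \<theta>) m)" using psi(3) by simp
    also have "\<dots> \<le> nrm (dual K X) (?Ts \<psi> \<ominus>\<^bsub>dual K X\<^esub> \<theta>) * nrm X m"
      using TsT chic by (intro dual_norm_upper[OF X _ m]) simp
    also have "nrm (dual K X) (?Ts \<psi> \<ominus>\<^bsub>dual K X\<^esub> \<theta>) \<le> ?c * 1"
      using chi(2) mult_left_mono[OF psin, of ?c] c by linarith
    then have "nrm (dual K X) (?Ts \<psi> \<ominus>\<^bsub>dual K X\<^esub> \<theta>) * nrm X m \<le> ?c * nrm X m"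
      using X.nrm_nonneg[OF m] by (simp add: mult_right_mono)
    finally show ?thesis .
  qed
  obtain S where S: "bounded_map K X Y S" "\<And>x. x \<in> carrier X \<Longrightarrow> nrm Y (S x) \<le> ?c * nrm X x"
    and ST: "\<And>m. m \<in> carrier X \<Longrightarrow> (\<And>\<phi>. \<phi> \<in> C \<Longrightarrow> \<phi> m = 0) \<Longrightarrow> S m = T m"
    using extension_approximation[OF X Y T C(1,3) c small] by blast
  note S' = bounded_mapD[OF S(1)]
  have Cb: "bounded_map K X (scalar_space K) \<phi>" if "\<phi> \<in> C" for \<phi>
    using that C(3) by (auto simp: dual_iff[OF X])
  have "\<exists>B. B \<subseteq> carrier X \<and> finite B \<and> card B \<le> card C \<and>
     (\<forall>x\<in>carrier X. \<exists>s\<in>lin_span K X B. \<forall>f\<in>C. f s = f x)"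
    by (rule X.finite_functionals_split[OF C(1)]) (use bounded_mapD[OF Cb] in auto)
  then obtain B where B: "B \<subseteq> carrier X" "finite B" "card B \<le> card C"
    and Bs: "\<And>x. x \<in> carrier X \<Longrightarrow> \<exists>s\<in>lin_span K X B. \<forall>\<phi>\<in>C. \<phi> s = \<phi> x" by auto
  define R where "R x = T x \<ominus>\<^bsub>Y\<^esub> S x" for x
  have R: "bounded_map K X Y R" unfolding R_def by (rule bounded_map_diff[OF X Y(1) T S(1)])
  show "kolmogorov_diameter K X Y n T \<le> ?c"
  proof (rule kolmogorov_diameter_le[OF X Y(1) T])
    show "finite (R ` B)" using B(2) by simp
    show "card (R ` B) \<le> n" using card_image_le[OF B(2), of R] B(3) C(2) by linarith
    show sub: "R ` B \<subseteq> carrier Y" using B(1) bounded_mapD(1)[OF R] by auto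
    show "0 \<le> ?c" using c by simp
    fix x assume x: "x \<in> carrier X"
    obtain s where s: "s \<in> lin_span K X B" "\<forall>\<phi>\<in>C. \<phi> s = \<phi> x" using Bs[OF x] by blast
    have sc: "s \<in> carrier X" using X.lin_span_carrier[OF B(1)] s(1) by blast
    have xs: "x \<ominus>\<^bsub>X\<^esub> s \<in> carrier X" using x sc by simp
    have "\<phi> (x \<ominus>\<^bsub>X\<^esub> s) = 0" if f: "\<phi> \<in> C" for \<phi>
    proof -
      have "\<phi> x \<in> K" using bounded_mapD(1)[OF Cb[OF f] x] by simp
      then have "\<phi> x \<ominus>\<^bsub>scalar_space K\<^esub> \<phi> x = 0" using SK.minus_self[of "\<phi> x"] by simp
      moreover have "\<phi> s = \<phi> x" using s(2) f by blast
      ultimately show ?thesis using bounded_map_minus[OF X SK Cb[OF f] x sc] by simp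
    qed
    then have "S (x \<ominus>\<^bsub>X\<^esub> s) = T (x \<ominus>\<^bsub>X\<^esub> s)" by (rule ST[OF xs])
    then have "R (x \<ominus>\<^bsub>X\<^esub> s) = \<zero>\<^bsub>Y\<^esub>" using T'(1)[OF xs] by (simp add: R_def)
    then have "R x \<ominus>\<^bsub>Y\<^esub> R s = \<zero>\<^bsub>Y\<^esub>" using bounded_map_minus[OF X Y(1) R x sc] by simp
    then have "R x = R s"
      by (rule Y.eq_if_minus_zero[OF bounded_mapD(1)[OF R x] bounded_mapD(1)[OF R sc]])
    moreover have "B \<subseteq> {x \<in> carrier X. R x \<in> lin_span K Y (R ` B)}"
      using B(1) Y.lin_span_superset[of "R ` B"] by blast
    from X.lin_span_minimal[OF preimage_submodule[OF X Y(1) R Y.lin_span_submodule[OF sub]] this] s(1)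
    have "R s \<in> lin_span K Y (R ` B)" by blast
    moreover have "nrm Y (T x \<ominus>\<^bsub>Y\<^esub> R x) \<le> ?c * nrm X x"
      using S(2)[OF x] T'(1)[OF x] S'(1)[OF x] by (simp add: R_def)
    ultimately show "\<exists>g\<in>lin_span K Y (R ` B). nrm Y (T x \<ominus>\<^bsub>Y\<^esub> g) \<le> ?c * nrm X x" by auto
  qed
qed

theorem theorem2p4:
  fixes K :: "complex set" and X :: "'a nspace" and Y :: "'b nspace" and T :: "'a \<Rightarrow> 'b"
  assumes "K = \<real> \<or> K = UNIV"
    and "banach_space K X" and "banach_space K Y"
    and "metric_lifting_property K X" and "metric_extension_property K Y"
    and "T \<in> operators K X Y"
  shows "\<forall>n. kolmogorov_diameter K (dual K Y) (dual K X) n (adjoint_op K X Y T)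
           = kolmogorov_diameter K X Y n T"
proof
  fix n
  have X: "kspace K X" and Y: "kspace K Y"
    using assms(1-3) by (auto intro: kspaceI simp: banach_space_def)
  have T: "bounded_map K X Y T" using assms(6) by (simp add: operators_iff[OF X Y])
  show "kolmogorov_diameter K (dual K Y) (dual K X) n (adjoint_op K X Y T) = kolmogorov_diameter K X Y n T"
    by (rule antisym[OF kolmogorov_diameter_adjoint_le[OF X assms(2,4) Y T]
          kolmogorov_diameter_le_adjoint[OF X Y assms(3,5) T]])
qed

end
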